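(* Let $\mathcal F\in\{A\mathrm J,B\mathrm J,A\mathrm M,B\mathrm M\}$ be any of the four families of interpolation polynomials and let $p\in\Lambda$. (1) The following recursion characterizes the structure coefficients $c^\lambda_\mu(p)$ ($\lambda,\mu\in\mathcal P_n$), given that $c^\lambda_\mu(p)=0$ whenever $|\lambda|\leqslant|\mu|$ and $\lambda\ne\mu$: (i) $c^\lambda_\lambda(p)=p(\overline\lambda)$; (ii) if $|\lambda|>|\mu|$, then $$\bigl(\|\overline\lambda\|-\|\overline\mu\|\bigr)c^\lambda_\mu(p)=\sum_{\zeta\gtrdot\mu}c^\lambda_\zeta(p)\bigl(\|\overline\zeta\|-\|\overline\mu\|\bigr)a_{\zeta\mu}-\sum_{\zeta:\,\lambda\gtrdot\zeta}\bigl(\|\overline\lambda\|-\|\overline\zeta\|\bigr)a_{\lambda\zeta}c^\zeta_\mu(p).$$ (2) The matrices $C$ and $D$ satisfy: (i) $C=B^{-1}DB$; (ii) $[Z,C]=[C,[Z,A]]$. (3) For all $\lambda,\mu\in\mathcal P_n$, $$c^\lambda_\mu(p)=\sum_{\lambda\supseteq\zeta\supseteq\mu}b'_{\lambda\zeta}\,b_{\zeta\mu}\,p(\overline\zeta).$$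
   Context: Fix $n\geqslant1$. $\mathcal P_n=\{\lambda\in\mathbb Z^n:\lambda_1\geqslant\cdots\geqslant\lambda_n\geqslant0\}$, $|\lambda|=\lambda_1+\dots+\lambda_n$; $\lambda\supseteq\mu$ means $\lambda_i\geqslant\mu_i$ for all $i$; $\lambda\gtrdot\mu$ means $\lambda\supseteq\mu$ and $|\lambda|=|\mu|+1$. The four families $\mathcal F$ have the following data (base field $\mathbb F$, ring $\Lambda$, shifting map $\mathcal P_n\to\mathbb F^n$, $\lambda\mapsto\overline\lambda$, and "norm" $\|x\|$), with indeterminate parameters: - $A\mathrm J$: $\mathbb F=\mathbb Q(\tau)$; $\Lambda=\mathbb F[x_1,\dots,x_n]^{S_n}$; $\overline\lambda_i=\lambda_i+(n-i)\tau$; $\|x\|=\sum_i x_i$. - $B\mathrm J$: $\mathbb F=\mathbb Q(\tau,\alpha)$; $\Lambda=\mathbb F[x_1^2,\dots,x_n^2]^{S_n}$; $\overline\lambda_i=\lambda_i+(n-i)\tau+\alpha$; $\|x\|=\sum_i x_i^2$. - $A\mathrm M$: $\mathbb F=\mathbb Q(q,t)$; $\Lambda=\mathbb F[x_1,\dots,x_n]^{S_n}$; $\overline\lambda_i=q^{\lambda_i}t^{n-i}$; $\|x\|=\sum_i x_i$. - $B\mathrm M$: $\mathbb F=\mathbb Q(q,t,a)$; $\Lambda=\mathbb F[x_1+x_1^{-1},\dots,x_n+x_n^{-1}]^{S_n}$; $\overline\lambda_i=aq^{\lambda_i}t^{n-i}$; $\|x\|=\sum_i(x_i+x_i^{-1})$.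 The degree of a Laurent polynomial is the maximum of $|\alpha_1|+\dots+|\alpha_n|$ over monomials $x^\alpha$ occurring in it. For $\mu\in\mathcal P_n$, the (unital) interpolation polynomial $h_\mu$ is the unique element of $\Lambda$ of degree at most $|\mu|$ (at most $2|\mu|$ when $\mathcal F=B\mathrm J$) with $h_\mu(\overline\lambda)=\delta_{\lambda\mu}$ for all $\lambda\in\mathcal P_n$ with $|\lambda|\leqslant|\mu|$ (existence and uniqueness are known). The binomial coefficients are $b_{\lambda\mu}=h_\mu(\overline\lambda)\in\mathbb F$, and the adjacent binomial coefficients are $a_{\lambda\mu}=b_{\lambda\mu}$ if $\lambda\gtrdot\mu$ and $a_{\lambda\mu}=0$ otherwise. The $h_\lambda$ form an $\mathbb F$-basis of $\Lambda$, and for $p\in\Lambda$ the structure coefficients $c^\lambda_\mu(p)\in\mathbb F$ are defined by $p\,h_\mu=\sum_\lambda c^\lambda_\mu(p)h_\lambda$. Infinite matrices indexed by $\lambda,\mu\in\mathcal P_n$ (ordered by a total order compatible with size): $A=(a_{\lambda\mu})$, $B=(b_{\lambda\mu})$, $Z=(\|\overline\mu\|\delta_{\lambda\mu})$, $C=(c^\lambda_\mu(p))_{\lambda,\mu}$, $D=(p(\overline\mu)\delta_{\lambda\mu})$. $B$ is unitriangular, hence invertible, with $B^{-1}=(b'_{\lambda\mu})$. $[X,Y]=XY-YX$. "Characterizes" means that the stated array satisfies the recursion and is the only array doing so. *)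

theory Defs
  imports
    "HOL-Library.Poly_Mapping"
    "HOL-Library.Groups_Big_Fun"
    "HOL-Combinatorics.Permutations"
    "HOL-Computational_Algebra.Polynomial_Factorial"
begin

text \<open>
  Throughout, \<open>\<kappa>\<close>, \<open>\<mu>\<close>, \<open>\<zeta>\<close> denote partitions; \<open>\<kappa>\<close> plays the role of the Greek letter
  lambda, which is not available as an identifier.
\<close>

section \<open>Partitions of length at most \<open>n\<close>\<close>

text \<open>A partition is a function on the index set \<open>{1..n}\<close>, extended by \<open>0\<close>; containment
  of partitions is therefore the pointwise order \<open>\<le>\<close> on functions.\<close>

type_synonym partition = "nat \<Rightarrow> nat"

definition partitions :: "nat \<Rightarrow> partition set" where
  "partitions n = {\<kappa>. (\<forall>i. i \<notin> {1..n} \<longrightarrow> \<kappa> i = 0) \<and>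
                       (\<forall>i j. 1 \<le> i \<and> i \<le> j \<and> j \<le> n \<longrightarrow> \<kappa> j \<le> \<kappa> i)}"

definition psize :: "nat \<Rightarrow> partition \<Rightarrow> nat" where
  "psize n \<kappa> = (\<Sum>i = 1..n. \<kappa> i)"

definition covers :: "nat \<Rightarrow> partition \<Rightarrow> partition \<Rightarrow> bool" where
  "covers n \<kappa> \<mu> \<longleftrightarrow> \<mu> \<le> \<kappa> \<and> psize n \<kappa> = psize n \<mu> + 1"


section \<open>Laurent polynomials\<close>

text \<open>The group algebra of the finitely supported exponent vectors \<open>nat \<Rightarrow>\<^sub>0 int\<close>: Laurent
  polynomials in the variables \<open>x\<^sub>0, x\<^sub>1, x\<^sub>2, \<dots>\<close>, of which only \<open>x\<^sub>1, \<dots>, x\<^sub>n\<close> will occur.\<close>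

type_synonym 'k laurent = "(nat \<Rightarrow>\<^sub>0 int) \<Rightarrow>\<^sub>0 'k"

definition Const :: "'k::field \<Rightarrow> 'k laurent" where
  "Const c = Poly_Mapping.single 0 c"

definition Xpow :: "nat \<Rightarrow> int \<Rightarrow> 'k::field laurent" where
  "Xpow i e = Poly_Mapping.single (Poly_Mapping.single i e) 1"

definition lpoly_eval :: "'k::field laurent \<Rightarrow> (nat \<Rightarrow> 'k) \<Rightarrow> 'k" where
  "lpoly_eval f x = (\<Sum>\<alpha>\<in>Poly_Mapping.keys f. Poly_Mapping.lookup f \<alpha> *
                       (\<Prod>i\<in>Poly_Mapping.keys \<alpha>. x i powi Poly_Mapping.lookup \<alpha> i))"

text \<open>The zero polynomial gets degree \<open>0\<close>.\<close>

definition ldegree :: "'k::field laurent \<Rightarrow> nat" where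
  "ldegree f = Max (insert 0 ((\<lambda>\<alpha>. \<Sum>i\<in>Poly_Mapping.keys \<alpha>. nat \<bar>Poly_Mapping.lookup \<alpha> i\<bar>)
                              ` Poly_Mapping.keys f))"

text \<open>For a permutation \<open>\<sigma>\<close>, \<open>map_key \<sigma> \<alpha>\<close> is the exponent vector \<open>\<alpha> \<circ> \<sigma>\<close>.\<close>

definition is_symmetric :: "nat \<Rightarrow> 'k::field laurent \<Rightarrow> bool" where
  "is_symmetric n f \<longleftrightarrow> (\<forall>\<sigma>. \<sigma> permutes {1..n} \<longrightarrow>
     (\<forall>\<alpha>. Poly_Mapping.lookup f (Poly_Mapping.map_key \<sigma> \<alpha>) = Poly_Mapping.lookup f \<alpha>))"

inductive_set subalgebra :: "'k::field laurent set \<Rightarrow> 'k laurent set" for S where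
  const: "Const c \<in> subalgebra S"
| gen: "f \<in> S \<Longrightarrow> f \<in> subalgebra S"
| add: "f \<in> subalgebra S \<Longrightarrow> g \<in> subalgebra S \<Longrightarrow> f + g \<in> subalgebra S"
| mult: "f \<in> subalgebra S \<Longrightarrow> g \<in> subalgebra S \<Longrightarrow> f * g \<in> subalgebra S"


section \<open>The four families\<close>

text \<open>\<open>Lam\<close> is the ring \<open>\<Lambda>\<close>, \<open>shift\<close> the shifting map, \<open>nrm\<close> the norm, and
  \<open>degfac * |\<mu>|\<close> is the degree bound for the interpolation polynomial of \<open>\<mu>\<close>.
  Points of \<open>\<bbbF>\<^sup>n\<close> are functions of which only the values on \<open>{1..n}\<close> matter.\<close>

record (overloaded) 'k interp_family =
  nvars :: nat
  Lam :: "'k laurent set"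
  shift :: "partition \<Rightarrow> nat \<Rightarrow> 'k"
  nrm :: "(nat \<Rightarrow> 'k) \<Rightarrow> 'k"
  degfac :: nat

text \<open>\<open>\<rat>(\<tau>)\<close>, \<open>\<rat>(\<tau>,\<alpha>)\<close>, \<open>\<rat>(q,t)\<close> and \<open>\<rat>(q,t,a)\<close> are the fraction fields of iterated univariate
  polynomial rings over \<open>\<rat>\<close>, the first-named indeterminate being the innermost one.\<close>

definition AJ :: "nat \<Rightarrow> rat poly fract interp_family" where
  "AJ n = (let \<tau> = to_fract [:0, 1:] in
     \<lparr> nvars = n,
       Lam = {f \<in> subalgebra {Xpow i 1 |i. i \<in> {1..n}}. is_symmetric n f},
       shift = (\<lambda>\<kappa> i. of_nat (\<kappa> i) + of_nat (n - i) * \<tau>),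
       nrm = (\<lambda>x. \<Sum>i = 1..n. x i),
       degfac = 1 \<rparr>)"

definition BJ :: "nat \<Rightarrow> rat poly poly fract interp_family" where
  "BJ n = (let \<tau> = to_fract [:[:0, 1:]:]; \<alpha> = to_fract [:0, 1:] in
     \<lparr> nvars = n,
       Lam = {f \<in> subalgebra {Xpow i 2 |i. i \<in> {1..n}}. is_symmetric n f},
       shift = (\<lambda>\<kappa> i. of_nat (\<kappa> i) + of_nat (n - i) * \<tau> + \<alpha>),
       nrm = (\<lambda>x. \<Sum>i = 1..n. (x i)\<^sup>2),
       degfac = 2 \<rparr>)"

definition AM :: "nat \<Rightarrow> rat poly poly fract interp_family" where
  "AM n = (let q = to_fract [:[:0, 1:]:]; t = to_fract [:0, 1:] in
     \<lparr> nvars = n,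
       Lam = {f \<in> subalgebra {Xpow i 1 |i. i \<in> {1..n}}. is_symmetric n f},
       shift = (\<lambda>\<kappa> i. q ^ \<kappa> i * t ^ (n - i)),
       nrm = (\<lambda>x. \<Sum>i = 1..n. x i),
       degfac = 1 \<rparr>)"

definition BM :: "nat \<Rightarrow> rat poly poly poly fract interp_family" where
  "BM n = (let q = to_fract [:[:[:0, 1:]:]:]; t = to_fract [:[:0, 1:]:]; a = to_fract [:0, 1:] in
     \<lparr> nvars = n,
       Lam = {f \<in> subalgebra {Xpow i 1 + Xpow i (-1) |i. i \<in> {1..n}}. is_symmetric n f},
       shift = (\<lambda>\<kappa> i. a * q ^ \<kappa> i * t ^ (n - i)),
       nrm = (\<lambda>x. \<Sum>i = 1..n. x i + inverse (x i)),
       degfac = 1 \<rparr>)"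

abbreviation parts :: "'k::field interp_family \<Rightarrow> partition set" where
  "parts F \<equiv> partitions (nvars F)"

abbreviation size_of :: "'k::field interp_family \<Rightarrow> partition \<Rightarrow> nat" where
  "size_of F \<equiv> psize (nvars F)"

abbreviation snorm :: "'k::field interp_family \<Rightarrow> partition \<Rightarrow> 'k" where
  "snorm F \<kappa> \<equiv> nrm F (shift F \<kappa>)"


section \<open>Interpolation polynomials, binomial and structure coefficients\<close>

definition interp_poly :: "'k::field interp_family \<Rightarrow> partition \<Rightarrow> 'k laurent" where
  "interp_poly F \<mu> = (THE h. h \<in> Lam F \<and> ldegree h \<le> degfac F * size_of F \<mu> \<and>
     (\<forall>\<kappa>\<in>parts F. size_of F \<kappa> \<le> size_of F \<mu> \<longrightarrow>
        lpoly_eval h (shift F \<kappa>) = (if \<kappa> = \<mu> then 1 else 0)))"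

definition binom :: "'k::field interp_family \<Rightarrow> partition \<Rightarrow> partition \<Rightarrow> 'k" where
  "binom F \<kappa> \<mu> = lpoly_eval (interp_poly F \<mu>) (shift F \<kappa>)"

definition adj_binom :: "'k::field interp_family \<Rightarrow> partition \<Rightarrow> partition \<Rightarrow> 'k" where
  "adj_binom F \<kappa> \<mu> = (if covers (nvars F) \<kappa> \<mu> then binom F \<kappa> \<mu> else 0)"

text \<open>\<open>structure_coeff F p \<kappa> \<mu>\<close> is the coefficient of the interpolation polynomial of \<open>\<kappa>\<close> in the
  expansion of \<open>p * interp_poly F \<mu>\<close>.\<close>

definition structure_coeff ::
    "'k::field interp_family \<Rightarrow> 'k laurent \<Rightarrow> partition \<Rightarrow> partition \<Rightarrow> 'k" where
  "structure_coeff F p \<kappa> \<mu> =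
     (THE c. finite {\<nu>. c \<nu> \<noteq> 0} \<and> {\<nu>. c \<nu> \<noteq> 0} \<subseteq> parts F \<and>
        p * interp_poly F \<mu> = (\<Sum>\<nu> | c \<nu> \<noteq> 0. Const (c \<nu>) * interp_poly F \<nu>)) \<kappa>"

definition structure_recursion ::
    "'k::field interp_family \<Rightarrow> 'k laurent \<Rightarrow> (partition \<Rightarrow> partition \<Rightarrow> 'k) \<Rightarrow> bool" where
  "structure_recursion F p c \<longleftrightarrow>
     (\<forall>\<kappa>\<in>parts F. c \<kappa> \<kappa> = lpoly_eval p (shift F \<kappa>)) \<and>
     (\<forall>\<kappa>\<in>parts F. \<forall>\<mu>\<in>parts F. size_of F \<kappa> > size_of F \<mu> \<longrightarrow>
        (snorm F \<kappa> - snorm F \<mu>) * c \<kappa> \<mu> =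
          (\<Sum>\<zeta> | \<zeta> \<in> parts F \<and> covers (nvars F) \<zeta> \<mu>.
             c \<kappa> \<zeta> * (snorm F \<zeta> - snorm F \<mu>) * adj_binom F \<zeta> \<mu>)
        - (\<Sum>\<zeta> | \<zeta> \<in> parts F \<and> covers (nvars F) \<kappa> \<zeta>.
             (snorm F \<kappa> - snorm F \<zeta>) * adj_binom F \<kappa> \<zeta> * c \<zeta> \<mu>))"

definition structure_vanishing ::
    "'k::field interp_family \<Rightarrow> (partition \<Rightarrow> partition \<Rightarrow> 'k) \<Rightarrow> bool" where
  "structure_vanishing F c \<longleftrightarrow>
     (\<forall>\<kappa>\<in>parts F. \<forall>\<mu>\<in>parts F. size_of F \<kappa> \<le> size_of F \<mu> \<and> \<kappa> \<noteq> \<mu> \<longrightarrow> c \<kappa> \<mu> = 0)"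


section \<open>Infinite matrices indexed by partitions\<close>

text \<open>A matrix over the index set \<open>parts F\<close> is extended by \<open>0\<close> to all pairs of functions.\<close>

type_synonym 'k pmatrix = "partition \<Rightarrow> partition \<Rightarrow> 'k"

definition pmat :: "'k::field interp_family \<Rightarrow> (partition \<Rightarrow> partition \<Rightarrow> 'k) \<Rightarrow> 'k pmatrix" where
  "pmat F f = (\<lambda>\<kappa> \<mu>. if \<kappa> \<in> parts F \<and> \<mu> \<in> parts F then f \<kappa> \<mu> else 0)"

text \<open>The sum is over the support of the summand, which is finite for all products formed below:
  the left factors are row-finite, being lower triangular with respect to any total order
  compatible with size.\<close>

definition pmat_mult :: "'k::field pmatrix \<Rightarrow> 'k pmatrix \<Rightarrow> 'k pmatrix" (infixl \<open>\<odot>\<close> 70) where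
  "X \<odot> Y = (\<lambda>\<kappa> \<mu>. Sum_any (\<lambda>\<zeta>. X \<kappa> \<zeta> * Y \<zeta> \<mu>))"

definition commutator :: "'k::field pmatrix \<Rightarrow> 'k pmatrix \<Rightarrow> 'k pmatrix" where
  "commutator X Y = (\<lambda>\<kappa> \<mu>. (X \<odot> Y) \<kappa> \<mu> - (Y \<odot> X) \<kappa> \<mu>)"

text \<open>The two-sided inverse in the ring of row-finite matrices, which contains the lower triangular
  ones. Row-finiteness makes multiplication associative and hence the inverse unique.\<close>

definition pmat_inverse :: "'k::field interp_family \<Rightarrow> 'k pmatrix \<Rightarrow> 'k pmatrix" where
  "pmat_inverse F X = (THE Y. pmat F Y = Y \<and> (\<forall>\<kappa>. finite {\<mu>. Y \<kappa> \<mu> \<noteq> 0}) \<and>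
     X \<odot> Y = pmat F (\<lambda>\<kappa> \<mu>. if \<kappa> = \<mu> then 1 else 0) \<and>
     Y \<odot> X = pmat F (\<lambda>\<kappa> \<mu>. if \<kappa> = \<mu> then 1 else 0))"

definition matA :: "'k::field interp_family \<Rightarrow> 'k pmatrix" where
  "matA F = pmat F (adj_binom F)"

definition matB :: "'k::field interp_family \<Rightarrow> 'k pmatrix" where
  "matB F = pmat F (binom F)"

definition matZ :: "'k::field interp_family \<Rightarrow> 'k pmatrix" where
  "matZ F = pmat F (\<lambda>\<kappa> \<mu>. if \<kappa> = \<mu> then snorm F \<mu> else 0)"

definition matC :: "'k::field interp_family \<Rightarrow> 'k laurent \<Rightarrow> 'k pmatrix" where
  "matC F p = pmat F (structure_coeff F p)"

definition matD :: "'k::field interp_family \<Rightarrow> 'k laurent \<Rightarrow> 'k pmatrix" where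
  "matD F p = pmat F (\<lambda>\<kappa> \<mu>. if \<kappa> = \<mu> then lpoly_eval p (shift F \<mu>) else 0)"

definition inv_binom :: "'k::field interp_family \<Rightarrow> partition \<Rightarrow> partition \<Rightarrow> 'k" where
  "inv_binom F = pmat_inverse F (matB F)"

end

theory Submission
  imports Defs
begin

text \<open>
  Everything rests on one vanishing property: if a symmetric polynomial of degree at most \<open>d\<close>, in the
  coordinates of the family, vanishes at all \<open>shift \<nu>\<close> with \<open>\<nu>\<close> strictly contained in \<open>\<kappa>\<close>, and
  \<open>|\<kappa>| > d\<close>, then it vanishes at \<open>shift \<kappa>\<close>. It is proved by induction on \<open>d\<close> with difference
  operators in the style of Knop--Sahi and Rains. Such an operator expresses its value at \<open>shift \<kappa>\<close> by
  the values of the argument at \<open>shift (\<kappa> - e\<^sub>J)\<close>, where the terms with \<open>\<kappa> - e\<^sub>J\<close> not a partition drop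
  out, and a combination of two of them lowers the degree. In the \<open>B\<close> families the operator also
  changes the coordinate (from \<open>x + s/x\<close> to \<open>x + sq/x\<close>, from \<open>x\<^sup>2 - kx\<close> to \<open>x\<^sup>2 - (k+1)x\<close>), so the
  induction runs over all such coordinates, and the \<open>A\<close> families are the degenerate case \<open>s = 0\<close>,
  respectively that of a linear coordinate.

  The vanishing property yields uniqueness of interpolation, hence existence by counting, and the
  extra vanishing \<open>b\<^bsub>\<kappa>\<mu>\<^esub> = 0\<close> unless \<open>\<mu> \<subseteq> \<kappa>\<close>. Multiplying \<open>h\<^sub>\<mu>\<close> by the norm then gives the Pieri formula
  \<open>[Z, B] = B [Z, A]\<close>, while evaluating \<open>p h\<^sub>\<mu>\<close> gives \<open>B C = D B\<close>; together they imply
  \<open>[Z, C] = [C, [Z, A]]\<close>, which is the recursion.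
\<close>

text \<open>No closed formula for \<open>interp_poly\<close> is at hand, so its zeros have to be
  forced by degree alone. The induction on degree works because of a match of two scalars. On the
  leading part, each of the two operators acts by a scalar that depends only on the total degrees of
  the Vandermonde product and of the argument. At a partition \<kappa>, the unshifted terms of the
  two operators have a ratio that is the same expression with the degree \<open>Suc d\<close>
  replaced by |\<kappa>|. The combination that kills degree \<open>Suc d\<close> therefore keeps, up
  to nonzero factors, |\<kappa>| - \<open>Suc d\<close> in the Jack case and q^(-|\<kappa>|) -
  q^(-\<open>Suc d\<close>) in the Macdonald case, and this is nonzero exactly where it has to be.

  The operators shift arguments and divide by differences, so this part of the argument treats
  polynomials as functions and tests identities on infinite grids. The Laurent polynomials return
  later, through evaluation at points with nonzero coordinates.\<close>

section \<open>Polynomial functions with prescribed total degrees\<close>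

text \<open>\<open>S\<close> is the set of total degrees allowed for the monomials:
  \<open>{..d}\<close> is a degree bound, a singleton means homogeneous. Homogeneity is wanted for
  the Vandermonde product, whose exact degree enters the cancellation of leading terms.\<close>

inductive polyfun :: "nat set \<Rightarrow> nat set \<Rightarrow> ((nat \<Rightarrow> 'k::field) \<Rightarrow> 'k) \<Rightarrow> bool"
  for I S where
  monom: "sum e I \<in> S \<Longrightarrow> polyfun I S (\<lambda>x. c * (\<Prod>i\<in>I. x i ^ e i))"
| add: "polyfun I S f \<Longrightarrow> polyfun I S g \<Longrightarrow> polyfun I S (\<lambda>x. f x + g x)"

lemma polyfun_mono: "polyfun I S f \<Longrightarrow> S \<subseteq> T \<Longrightarrow> polyfun I T f"
  by (induction rule: polyfun.induct) (auto intro: polyfun.intros)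

lemma polyfun_mono_atMost: "polyfun I {..d} f \<Longrightarrow> d \<le> e \<Longrightarrow> polyfun I {..e} f"
  by (erule polyfun_mono) auto

lemma polyfun_const: "0 \<in> S \<Longrightarrow> polyfun I S (\<lambda>x. c)"
  using polyfun.monom[of "\<lambda>_. 0" I S c] by simp

lemma polyfun_mult:
  assumes "polyfun I S f" "polyfun I T g" "\<And>s t. s \<in> S \<Longrightarrow> t \<in> T \<Longrightarrow> s + t \<in> U"
  shows "polyfun I U (\<lambda>x. f x * g x)"
  using assms(1)
proof (induction rule: polyfun.induct)
  case (monom e c)
  from assms(2) show ?case
  proof (induction rule: polyfun.induct)
    case (monom e' c')
    have "polyfun I U (\<lambda>x. (c * c') * (\<Prod>i\<in>I. x i ^ (e i + e' i)))"
      by (rule polyfun.monom) (use assms(3) \<open>sum e I \<in> S\<close> monom in \<open>simp add: sum.distrib\<close>)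
    then show ?case
      by (simp add: power_add prod.distrib mult_ac)
  next
    case (add f g)
    then show ?case by (simp add: ring_distribs polyfun.add)
  qed
next
  case (add f h)
  then show ?case by (simp add: ring_distribs polyfun.add)
qed

lemma polyfun_mult_atMost:
  "polyfun I {..d} f \<Longrightarrow> polyfun I {..e} g \<Longrightarrow> polyfun I {..d + e} (\<lambda>x. f x * g x)"
  by (rule polyfun_mult) auto

lemma polyfun_cmult: "polyfun I S f \<Longrightarrow> polyfun I S (\<lambda>x. c * f x)"
  by (rule polyfun_mult[of I "{0}" _ S]) (auto intro: polyfun_const)

lemma polyfun_uminus: "polyfun I S f \<Longrightarrow> polyfun I S (\<lambda>x. - f x)"
  using polyfun_cmult[of I S f "-1"] by simp

lemma polyfun_diff: "polyfun I S f \<Longrightarrow> polyfun I S g \<Longrightarrow> polyfun I S (\<lambda>x. f x - g x)"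
  using polyfun.add[OF _ polyfun_uminus, of I S f g] by simp

lemma polyfun_zero: "polyfun I {..d} (\<lambda>x. 0)"
  by (rule polyfun_const) simp

lemma polyfun_sum:
  "(\<And>a. a \<in> A \<Longrightarrow> polyfun I {..d} (f a)) \<Longrightarrow> polyfun I {..d} (\<lambda>x. \<Sum>a\<in>A. f a x)"
  by (induction A rule: infinite_finite_induct) (auto intro: polyfun_zero polyfun.add)

lemma polyfun_var:
  assumes "finite I" "i \<in> I" "1 \<in> S"
  shows "polyfun I S (\<lambda>x::nat \<Rightarrow> 'k::field. x i)"
proof -
  have "(\<Prod>j\<in>I. x j ^ (if j = i then 1 else 0)) = x i" for x :: "nat \<Rightarrow> 'k"
    using assms by (simp add: if_distrib cong: if_cong)
  moreover have "polyfun I S (\<lambda>x::nat \<Rightarrow> 'k. 1 * (\<Prod>j\<in>I. x j ^ (if j = i then 1 else 0)))"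
    by (rule polyfun.monom) (use assms in simp)
  ultimately show ?thesis by (simp only: mult_1_left)
qed

lemma polyfun_prod:
  assumes "finite A" "\<And>a. a \<in> A \<Longrightarrow> polyfun I {..d a} (f a)"
  shows "polyfun I {..sum d A} (\<lambda>x. \<Prod>a\<in>A. f a x)"
  using assms
  by (induction A rule: finite_induct) (auto intro: polyfun_const polyfun_mult_atMost)

lemma polyfun_power: "polyfun I {..d} f \<Longrightarrow> polyfun I {..m * d} (\<lambda>x. f x ^ m)"
  by (induction m) (auto intro: polyfun_const polyfun_mult_atMost)

lemma polyfun_power_linear: "polyfun I {..1} f \<Longrightarrow> polyfun I {..m} (\<lambda>x. f x ^ m)"
  using polyfun_power[of I 1 f m] by simp

lemma polyfun_compose:
  assumes "finite I" "polyfun I {..d} f" "\<And>i. i \<in> I \<Longrightarrow> polyfun J {..1} (\<lambda>x. h x i)"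
  shows "polyfun J {..d} (\<lambda>x. f (h x))"
  using assms(2)
proof (induction rule: polyfun.induct)
  case (monom e c)
  have "polyfun J {..\<Sum>i\<in>I. e i} (\<lambda>x. \<Prod>i\<in>I. h x i ^ e i)"
    by (intro polyfun_prod polyfun_power_linear assms)
  then have "polyfun J {..d} (\<lambda>x. \<Prod>i\<in>I. h x i ^ e i)"
    by (rule polyfun_mono) (use monom in auto)
  then show ?case by (rule polyfun_cmult)
next
  case (add f g)
  then show ?case by (simp add: polyfun.add)
qed

lemma polyfun_cong_arg:
  "polyfun I S f \<Longrightarrow> (\<And>i. i \<in> I \<Longrightarrow> x i = y i) \<Longrightarrow> f x = f y"
  by (induction rule: polyfun.induct) (auto cong: prod.cong)

lemma polyfun_degree_0:
  assumes "finite I" "polyfun I {..0} f"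
  shows "f x = f y"
  using assms(2)
proof (induction rule: polyfun.induct)
  case (monom e c)
  then have "\<forall>i\<in>I. e i = 0" using assms(1) by simp
  then show ?case by simp
qed auto

lemma polyfun_line:
  assumes "polyfun I S f"
  shows "\<exists>p. \<forall>z. f (\<lambda>i. x i + z * v i) = poly p z"
  using assms
proof (induction rule: polyfun.induct)
  case (monom e c)
  show ?case
    by (rule exI[of _ "smult c (\<Prod>i\<in>I. [:x i, v i:] ^ e i)"]) (simp add: poly_prod)
next
  case (add f g)
  then obtain p q where "\<forall>z. f (\<lambda>i. x i + z * v i) = poly p z" "\<forall>z. g (\<lambda>i. x i + z * v i) = poly q z"
    by blast
  then show ?case by (intro exI[of _ "p + q"]) simp
qed

lemma polyfun_coordinate:
  assumes "polyfun I S f"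
  shows "\<exists>p. \<forall>z. f (x(j := z)) = poly p z"
proof -
  obtain p where "\<forall>z. f (\<lambda>i. (x(j := 0)) i + z * (if i = j then 1 else 0)) = poly p z"
    using polyfun_line[OF assms, where x = "x(j := 0)" and v = "\<lambda>i. if i = j then 1 else 0"] by blast
  moreover have "(\<lambda>i. (x(j := 0)) i + z * (if i = j then 1 else 0)) = x(j := z)" for z
    by auto
  ultimately show ?thesis by auto
qed

lemma polyfun_coordinate_eq_0:
  assumes "polyfun I S f" "infinite Z" "\<And>z. z \<in> Z \<Longrightarrow> f (x(j := z)) = 0"
  shows "f (x(j := z)) = 0"
proof -
  obtain p where p: "\<And>z. f (x(j := z)) = poly p z"
    using polyfun_coordinate[OF assms(1)] by blast
  have "Z \<subseteq> {z. poly p z = 0}" using assms(3) p by auto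
  then have "p = 0" using assms(2) poly_roots_finite finite_subset by blast
  then show ?thesis using p by simp
qed

text \<open>A univariate polynomial with infinitely many zeros vanishes, so the coordinates can be
  released from the grid one after another.\<close>

lemma polyfun_grid:
  assumes "finite I" "polyfun I S f" "\<And>i. i \<in> I \<Longrightarrow> infinite (Z i)"
    and "\<And>x. (\<And>i. i \<in> I \<Longrightarrow> x i \<in> Z i) \<Longrightarrow> f x = 0"
  shows "f x = 0"
proof -
  \<comment> \<open>\<open>J\<close> holds the coordinates already released.\<close>
  have "J \<subseteq> I \<Longrightarrow> (\<And>i. i \<in> I - J \<Longrightarrow> x i \<in> Z i) \<Longrightarrow> f x = 0" if "finite J" for J x
    using that
  proof (induction J arbitrary: x rule: finite_induct)
    case empty
    then show ?case using assms(4) by simp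
  next
    case (insert j J)
    have "f (x(j := x j)) = 0"
    proof (rule polyfun_coordinate_eq_0[OF assms(2), of "Z j"])
      show "infinite (Z j)" using insert assms(3) by simp
      show "f (x(j := z)) = 0" if "z \<in> Z j" for z
        using insert that by (intro insert.IH) auto
    qed
    then show ?case by simp
  qed
  from this[OF assms(1)] show ?thesis by simp
qed

text \<open>On the line through \<open>x\<close> and \<open>y\<close> both functions become
  univariate polynomials with product zero; the first is nonzero at parameter 1, so the second is
  zero, in particular at parameter 0.\<close>

lemma polyfun_domain:
  fixes f g :: "(nat \<Rightarrow> 'k::field_char_0) \<Rightarrow> 'k"
  assumes "polyfun I S f" "polyfun I T g" "\<And>x. f x * g x = 0" "f y \<noteq> 0"
  shows "g x = 0"
proof -
  obtain p where p: "\<And>z. f (\<lambda>i. x i + z * (y i - x i)) = poly p z"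
    using polyfun_line[OF assms(1), where x = x and v = "\<lambda>i. y i - x i"] by blast
  obtain q where q: "\<And>z. g (\<lambda>i. x i + z * (y i - x i)) = poly q z"
    using polyfun_line[OF assms(2), where x = x and v = "\<lambda>i. y i - x i"] by blast
  have "poly (p * q) z = 0" for z using assms(3) p q by (metis poly_mult)
  then have "p * q = 0" using poly_all_0_iff_0 by blast
  moreover have "p \<noteq> 0" using p[of 1] assms(4) by auto
  ultimately have "q = 0" by simp
  then show ?thesis using q[of 0] by simp
qed

text \<open>Monomial by monomial this is the factorization of a difference of powers. The clause for
  \<open>d = 0\<close> makes up for the truncated subtraction in \<open>d - 1\<close>.\<close>

lemma polyfun_difference_quotient:
  assumes "finite I" "polyfun I {..d} f" "i \<in> I" "j \<in> I" "i \<noteq> j"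
  shows "\<exists>q. polyfun I {..d - 1} q \<and> (d = 0 \<longrightarrow> q = (\<lambda>x. 0)) \<and>
           (\<forall>x. f x - f (x(i := x j)) = (x i - x j) * q x)"
  using assms(2)
proof (induction rule: polyfun.induct)
  case (monom e c)
  define R where "R = (\<lambda>x::nat \<Rightarrow> 'a. c * (\<Prod>k\<in>I-{i}. x k ^ e k))"
  define q where "q = (\<lambda>x. R x * (\<Sum>l<e i. x j ^ (e i - Suc l) * x i ^ l))"
  have R: "polyfun I {..sum e (I - {i})} R"
  proof -
    have "polyfun I {..\<Sum>k\<in>I-{i}. e k} (\<lambda>x::nat \<Rightarrow> 'a. \<Prod>k\<in>I-{i}. x k ^ e k)"
      using assms by (intro polyfun_prod polyfun_power_linear polyfun_var) auto
    then show ?thesis unfolding R_def by (simp add: polyfun_cmult)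
  qed
  have d: "e i + sum e (I - {i}) \<le> d"
    using monom assms by (simp add: sum.remove)
  have "polyfun I {..d - 1} q"
  proof (cases "e i = 0")
    case True
    then show ?thesis by (simp add: q_def polyfun_zero)
  next
    case False
    have "polyfun I {..(e i - Suc l) + l} (\<lambda>x::nat \<Rightarrow> 'a. x j ^ (e i - Suc l) * x i ^ l)" for l
      using assms by (intro polyfun_mult_atMost polyfun_power_linear polyfun_var) auto
    then have "polyfun I {..e i - 1} (\<lambda>x::nat \<Rightarrow> 'a. x j ^ (e i - Suc l) * x i ^ l)" if "l < e i" for l
      using that by (intro polyfun_mono[OF \<open>polyfun I {..(e i - Suc l) + l} _\<close>]) auto
    then have "polyfun I {..sum e (I - {i}) + (e i - 1)} q"
      unfolding q_def by (intro polyfun_mult_atMost[OF R] polyfun_sum) auto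
    then show ?thesis by (rule polyfun_mono) (use d False in auto)
  qed
  moreover have "d = 0 \<longrightarrow> q = (\<lambda>x. 0)" using d by (auto simp: q_def)
  moreover have "c * (\<Prod>k\<in>I. x k ^ e k) - c * (\<Prod>k\<in>I. (x(i := x j)) k ^ e k) = (x i - x j) * q x" for x
  proof -
    have 1: "c * (\<Prod>k\<in>I. x k ^ e k) = R x * x i ^ e i"
      unfolding R_def by (subst prod.remove[OF assms(1,3)]) simp
    have "(\<Prod>k\<in>I-{i}. (x(i := x j)) k ^ e k) = (\<Prod>k\<in>I-{i}. x k ^ e k)"
      by (intro prod.cong) auto
    then have 2: "c * (\<Prod>k\<in>I. (x(i := x j)) k ^ e k) = R x * x j ^ e i"
      unfolding R_def by (subst prod.remove[OF assms(1,3)]) simp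
    have "x i ^ e i - x j ^ e i = (x i - x j) * (\<Sum>l<e i. x j ^ (e i - Suc l) * x i ^ l)"
      by (rule power_diff_sumr2)
    then have "R x * x i ^ e i - R x * x j ^ e i
        = R x * ((x i - x j) * (\<Sum>l<e i. x j ^ (e i - Suc l) * x i ^ l))"
      by (simp only: right_diff_distrib[symmetric])
    then show ?thesis unfolding 1 2 q_def by (simp only: mult.left_commute)
  qed
  ultimately show ?case by blast
next
  case (add f g)
  then obtain q r where
    "polyfun I {..d - 1} q" "d = 0 \<longrightarrow> q = (\<lambda>x. 0)" "\<And>x. f x - f (x(i := x j)) = (x i - x j) * q x"
    "polyfun I {..d - 1} r" "d = 0 \<longrightarrow> r = (\<lambda>x. 0)" "\<And>x. g x - g (x(i := x j)) = (x i - x j) * r x"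
    by blast
  moreover from this have "f x + g x - (f (x(i := x j)) + g (x(i := x j))) = (x i - x j) * (q x + r x)" for x
    by (simp only: add_diff_add distrib_left)
  ultimately show ?case
    by (intro exI[of _ "\<lambda>x. q x + r x"]) (auto intro: polyfun.add simp: fun_upd_def)
qed

text \<open>The linear factors are split off one at a time. The quotient by one factor still
  vanishes on the other hyperplanes, because that factor does not vanish identically on any of
  them.\<close>

lemma polyfun_divide_differences:
  fixes G :: "(nat \<Rightarrow> 'k::field_char_0) \<Rightarrow> 'k"
  assumes "finite I" "finite T" "\<And>i j. (i, j) \<in> T \<Longrightarrow> i \<in> I \<and> j \<in> I \<and> i < j"
    and "polyfun I {..card T + m} G"
    and "\<And>i j x. (i, j) \<in> T \<Longrightarrow> x i = x j \<Longrightarrow> G x = 0"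
  shows "\<exists>g. polyfun I {..m} g \<and> (\<forall>x. G x = (\<Prod>(i, j)\<in>T. x i - x j) * g x)"
  using assms(2-5)
proof (induction T arbitrary: G rule: finite_induct)
  case empty
  then show ?case by auto
next
  case (insert p T)
  obtain i j where p: "p = (i, j)" by (cases p)
  then have ij: "i \<in> I" "j \<in> I" "i < j" using insert.prems(1) by auto
  obtain q where q: "polyfun I {..card (insert p T) + m - 1} q"
      "\<And>x. G x - G (x(i := x j)) = (x i - x j) * q x"
    using polyfun_difference_quotient[OF assms(1) insert.prems(2) ij(1,2) less_imp_neq[OF ij(3)]] by blast
  have "G (x(i := x j)) = 0" for x by (rule insert.prems(3)[of i j]) (use p ij in auto)
  then have Gq: "G x = (x i - x j) * q x" for x using q(2)[of x] by simp
  have q1: "polyfun I {..card T + m} q" using q(1) insert by simp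
  have "q x = 0" if kl: "(k, l) \<in> T" and xkl: "x k = x l" for k l x
  proof -
    have kl': "k \<in> I" "l \<in> I" "k < l" using insert.prems(1)[of k l] kl by auto
    have ne: "(i, j) \<noteq> (k, l)" using kl insert p by auto
    \<comment> \<open>\<open>h\<close> maps onto the hyperplane where the coordinates
      \<open>k\<close> and \<open>l\<close> agree, which turns vanishing on it into vanishing
      everywhere of a composite.\<close>
    define h where "h = (\<lambda>x::nat \<Rightarrow> 'k. x(l := x k))"
    have h: "polyfun I {..1} (\<lambda>x::nat \<Rightarrow> 'k. h x a)" if "a \<in> I" for a
    proof (cases "a = l")
      case True
      then show ?thesis by (simp add: h_def polyfun_var[OF assms(1) kl'(1)])
    next
      case False
      then show ?thesis by (simp add: h_def polyfun_var[OF assms(1) that])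
    qed
    have "q (h x) = 0"
    proof (rule polyfun_domain[where f = "\<lambda>x. h x i - h x j" and g = "\<lambda>x. q (h x)" and y = of_nat])
      show "polyfun I {..1} (\<lambda>x. h x i - h x j)" using h ij by (intro polyfun_diff)
      show "polyfun I {..card T + m} (\<lambda>x. q (h x))"
        by (rule polyfun_compose[OF assms(1) q1 h])
      show "(h x i - h x j) * q (h x) = 0" for x
      proof -
        have "h x k = h x l" using kl' by (simp add: h_def)
        then have "G (h x) = 0" by (rule insert.prems(3)[rotated]) (use kl in simp)
        then show ?thesis by (simp only: Gq)
      qed
      \<comment> \<open>The point with coordinates 1, 2, 3, ... is moved by \<open>h\<close> only in
        coordinate \<open>l\<close>, which becomes equal to coordinate \<open>k\<close> and to no
        other.\<close>
      show "h of_nat i - h of_nat j \<noteq> 0" using ne ij kl' by (auto simp: h_def)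
    qed
    moreover have "h x = x" using xkl by (auto simp: h_def)
    ultimately show ?thesis by simp
  qed
  with insert.IH[OF _ q1] insert.prems(1) obtain g
    where "polyfun I {..m} g" "\<And>x. q x = (\<Prod>(i, j)\<in>T. x i - x j) * g x" by blast
  then show ?case using insert(1,2) Gq p by (intro exI[of _ g]) (simp add: mult_ac)
qed

section \<open>The Vandermonde product\<close>

definition pairs :: "nat \<Rightarrow> (nat \<times> nat) set" where
  "pairs n = (SIGMA i:{1..n}. {i<..n})"

definition vand :: "nat \<Rightarrow> (nat \<Rightarrow> 'k::field) \<Rightarrow> 'k" where
  "vand n x = (\<Prod>(i, j)\<in>pairs n. x i - x j)"

lemma finite_pairs [simp]: "finite (pairs n)"
  by (simp add: pairs_def)

lemma mem_pairs [simp]: "(i, j) \<in> pairs n \<longleftrightarrow> 1 \<le> i \<and> i < j \<and> j \<le> n"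
  by (auto simp: pairs_def)

lemma card_pairs: "card (pairs n) = (\<Sum>i = 1..n. n - i)"
  by (simp add: pairs_def card_SigmaI)

lemma vand_eq_0_iff: "vand n x = 0 \<longleftrightarrow> (\<exists>i j. 1 \<le> i \<and> i < j \<and> j \<le> n \<and> x i = x j)"
proof
  assume "vand n x = 0"
  then obtain p where "p \<in> pairs n" "(case p of (i, j) \<Rightarrow> x i - x j) = 0"
    unfolding vand_def by (auto simp del: mem_pairs)
  then show "\<exists>i j. 1 \<le> i \<and> i < j \<and> j \<le> n \<and> x i = x j"
    by (cases p) auto
next
  assume "\<exists>i j. 1 \<le> i \<and> i < j \<and> j \<le> n \<and> x i = x j"
  then obtain i j where "(i, j) \<in> pairs n" "(case (i, j) of (i, j) \<Rightarrow> x i - x j) = 0"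
    by auto
  then show "vand n x = 0"
    unfolding vand_def by (intro prod_zero bexI[of _ "(i, j)"]) auto
qed

lemma polyfun_vand: "polyfun {1..n} {card (pairs n)} (vand n :: (nat \<Rightarrow> 'k::field) \<Rightarrow> 'k)"
proof -
  have "polyfun {1..n} {card T} (\<lambda>x::nat \<Rightarrow> 'k. \<Prod>(i, j)\<in>T. x i - x j)" if "finite T" "T \<subseteq> pairs n" for T
    using that
  proof (induction T rule: finite_induct)
    case empty
    then show ?case by (simp add: polyfun_const)
  next
    case (insert p T)
    obtain i j where p: "p = (i, j)" by (cases p)
    have "polyfun {1..n} {1} (\<lambda>x::nat \<Rightarrow> 'k. x i - x j)"
      using insert.prems p by (intro polyfun_diff polyfun_var) auto
    then have "polyfun {1..n} {Suc (card T)} (\<lambda>x::nat \<Rightarrow> 'k. (x i - x j) * (\<Prod>(i, j)\<in>T. x i - x j))"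
      using insert by (intro polyfun_mult[of _ "{1}" _ "{card T}"]) auto
    then show ?case using insert p by simp
  qed
  then show ?thesis unfolding vand_def[abs_def] by simp
qed

definition inversions :: "nat \<Rightarrow> (nat \<Rightarrow> nat) \<Rightarrow> (nat \<times> nat) set" where
  "inversions n \<sigma> = {(i, j) \<in> pairs n. \<sigma> j < \<sigma> i}"

text \<open>A permutation, followed by sorting each image pair, permutes the set of pairs, and each
  inversion costs one sign.\<close>

lemma vand_permute:
  assumes "\<sigma> permutes {1..n}"
  shows "vand n (x \<circ> \<sigma>) = (- 1) ^ card (inversions n \<sigma>) * vand n x"
proof -
  define \<phi> where "\<phi> = (\<lambda>(i, j). (min (\<sigma> i) (\<sigma> j), max (\<sigma> i) (\<sigma> j)))"
  have inj: "\<sigma> i = \<sigma> j \<longleftrightarrow> i = j" for i j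
    using permutes_inj[OF assms] by (auto dest: injD)
  have ran: "\<sigma> i \<in> {1..n} \<longleftrightarrow> i \<in> {1..n}" for i
    using permutes_in_image[OF assms] .
  have inj_phi: "inj_on \<phi> (pairs n)"
  proof (rule inj_onI, clarify)
    fix i j k l
    assume *: "(i, j) \<in> pairs n" "(k, l) \<in> pairs n" "\<phi> (i, j) = \<phi> (k, l)"
    then have "{\<sigma> i, \<sigma> j} = {\<sigma> k, \<sigma> l}"
      unfolding \<phi>_def by (auto simp: min_def max_def split: if_splits)
    then have "{i, j} = {k, l}"
      by (auto simp: doubleton_eq_iff inj)
    then show "i = k \<and> j = l"
      using * by (auto simp: doubleton_eq_iff)
  qed
  have "\<phi> p \<in> pairs n" if "p \<in> pairs n" for p
    using that ran[of "fst p"] ran[of "snd p"] inj[of "fst p" "snd p"]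
    by (cases p) (auto simp: \<phi>_def min_def max_def)
  then have "\<phi> ` pairs n = pairs n"
    using inj_phi by (intro endo_inj_surj) auto
  then have bij: "bij_betw \<phi> (pairs n) (pairs n)"
    using inj_phi by (simp add: bij_betw_def)
  have "vand n (x \<circ> \<sigma>) = (\<Prod>p\<in>pairs n. (if p \<in> inversions n \<sigma> then - 1 else 1)
      * (case \<phi> p of (i, j) \<Rightarrow> x i - x j))"
    unfolding vand_def
  proof (rule prod.cong[OF refl])
    fix p assume "p \<in> pairs n"
    then show "(case p of (i, j) \<Rightarrow> (x \<circ> \<sigma>) i - (x \<circ> \<sigma>) j) =
        (if p \<in> inversions n \<sigma> then - 1 else 1) * (case \<phi> p of (i, j) \<Rightarrow> x i - x j)"
      by (cases p) (auto simp: inversions_def \<phi>_def min_def max_def)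
  qed
  also have "\<dots> = (\<Prod>p\<in>pairs n. if p \<in> inversions n \<sigma> then - 1 else 1)
      * (\<Prod>p\<in>pairs n. case \<phi> p of (i, j) \<Rightarrow> x i - x j)"
    by (rule prod.distrib)
  also have "(\<Prod>p\<in>pairs n. if p \<in> inversions n \<sigma> then - 1 else 1 :: 'a)
      = (- 1) ^ card (pairs n \<inter> inversions n \<sigma>)"
    by (subst prod.inter_restrict[symmetric]) auto
  also have "pairs n \<inter> inversions n \<sigma> = inversions n \<sigma>"
    by (auto simp: inversions_def)
  also have "(\<Prod>p\<in>pairs n. case \<phi> p of (i, j) \<Rightarrow> x i - x j) = vand n x"
    unfolding vand_def by (rule prod.reindex_bij_betw[OF bij])
  finally show ?thesis .
qed

text \<open>Besides \<open>(a, b)\<close>, every index strictly between \<open>a\<close> and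
  \<open>b\<close> contributes exactly two inversions.\<close>

lemma odd_card_inversions_transpose:
  assumes "1 \<le> a" "a < b" "b \<le> n"
  shows "odd (card (inversions n (Transposition.transpose a b)))"
proof -
  have "inversions n (Transposition.transpose a b)
      = insert (a, b) (Pair a ` {a<..<b} \<union> (\<lambda>i. (i, b)) ` {a<..<b})" (is "_ = insert _ (?A \<union> ?B)")
    using assms by (auto simp: inversions_def transpose_def split: if_splits)
  moreover have "card (?A \<union> ?B) = card ?A + card ?B"
    by (rule card_Un_disjoint) auto
  moreover have "card ?A = card {a<..<b}" "card ?B = card {a<..<b}"
    by (rule card_image, simp add: inj_on_def)+
  moreover have "finite (?A \<union> ?B)" "(a, b) \<notin> ?A \<union> ?B" by auto
  ultimately show ?thesis by (simp only: card_insert_disjoint) simp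
qed

lemma vand_transpose:
  assumes "1 \<le> a" "a < b" "b \<le> n"
  shows "vand n (x \<circ> Transposition.transpose a b) = - vand n x"
proof -
  have "Transposition.transpose a b permutes {1..n}"
    using assms by (intro permutes_swap_id) auto
  from vand_permute[OF this] odd_card_inversions_transpose[OF assms] show ?thesis by simp
qed

section \<open>Products of univariate polynomials\<close>

text \<open>For one branch \<open>f\<close> and one branch \<open>g\<close> per variable,
  \<open>J\<close> is the set of variables in the branch \<open>g\<close>.\<close>

lemma prod_add_Pow:
  fixes f g :: "'a \<Rightarrow> 'b::comm_semiring_1"
  assumes "finite A"
  shows "(\<Prod>i\<in>A. f i + g i) = (\<Sum>J\<in>Pow A. \<Prod>i\<in>A. if i \<in> J then g i else f i)"
proof -
  have "(\<Prod>i\<in>A. f i + g i) = (\<Sum>J\<in>Pow A. (\<Prod>i\<in>J. g i) * (\<Prod>i\<in>A - J. f i))"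
    using prod_add[OF assms, of g f] by (simp add: add.commute)
  also have "\<dots> = (\<Sum>J\<in>Pow A. \<Prod>i\<in>A. if i \<in> J then g i else f i)"
  proof (rule sum.cong[OF refl])
    fix J assume "J \<in> Pow A"
    then have "A \<inter> {i. i \<in> J} = J" "A \<inter> - {i. i \<in> J} = A - J" by auto
    then show "(\<Prod>i\<in>J. g i) * (\<Prod>i\<in>A - J. f i) = (\<Prod>i\<in>A. if i \<in> J then g i else f i)"
      using prod.If_cases[OF assms, of "\<lambda>i. i \<in> J" g f] by simp
  qed
  finally show ?thesis .
qed

lemma polyfun_poly:
  assumes "finite I" "i \<in> I" "degree Q \<le> m"
  shows "polyfun I {..m} (\<lambda>x. poly Q (x i))"
proof -
  have "polyfun I {..m} (\<lambda>x. \<Sum>k\<le>degree Q. coeff Q k * x i ^ k)"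
  proof (intro polyfun_sum polyfun_cmult)
    fix k assume "k \<in> {..degree Q}"
    have "polyfun I {..k} (\<lambda>x::nat \<Rightarrow> 'a. x i ^ k)"
      by (intro polyfun_power_linear polyfun_var) (use assms in auto)
    then show "polyfun I {..m} (\<lambda>x::nat \<Rightarrow> 'a. x i ^ k)"
      by (rule polyfun_mono) (use \<open>k \<in> _\<close> assms in auto)
  qed
  then show ?thesis by (simp add: poly_altdef)
qed

text \<open>The disjunction expresses degree less than \<open>m\<close>: under truncated
  subtraction, \<open>m = 0\<close> has to mean the zero function.\<close>

lemma polyfun_pred_add:
  assumes "(\<forall>x. f x = 0) \<or> 0 < m \<and> polyfun I {..m - 1} f"
    and "(\<forall>x. g x = 0) \<or> 0 < m \<and> polyfun I {..m - 1} g"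
  shows "(\<forall>x. f x + g x = 0) \<or> 0 < m \<and> polyfun I {..m - 1} (\<lambda>x. f x + g x)"
proof (cases "\<forall>x. f x = 0")
  case True
  then show ?thesis using assms(2) by simp
next
  case f: False
  show ?thesis
  proof (cases "\<forall>x. g x = 0")
    case True
    then show ?thesis using assms(1) by simp
  next
    case False
    then show ?thesis using assms f polyfun.add by blast
  qed
qed

text \<open>The factors are replaced by their leading monomials one at a time. The
  \<open>m i\<close> are formal degrees, so the coefficients at them may be zero.\<close>

lemma polyfun_prod_poly_lead:
  assumes "finite I" "A \<subseteq> I" "\<And>i. i \<in> A \<Longrightarrow> degree (Q i) \<le> m i"
  defines "L \<equiv> \<lambda>x. (\<Prod>i\<in>A. poly (Q i) (x i)) - (\<Prod>i\<in>A. coeff (Q i) (m i)) * (\<Prod>i\<in>A. x i ^ m i)"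
  shows "(\<forall>x. L x = 0) \<or> 0 < sum m A \<and> polyfun I {..sum m A - 1} L"
proof -
  have "finite A" using assms finite_subset by blast
  from this assms(2,3) show ?thesis unfolding L_def
  proof (induction A rule: finite_induct)
    case empty
    then show ?case by simp
  next
    case (insert j A)
    define R where "R = Q j - monom (coeff (Q j) (m j)) (m j)"
    define P where "P = (\<lambda>x. \<Prod>i\<in>A. poly (Q i) (x i))"
    define M where "M = (\<lambda>x. (\<Prod>i\<in>A. coeff (Q i) (m i)) * (\<Prod>i\<in>A. x i ^ m i))"
    define T where "T = (\<lambda>x. coeff (Q j) (m j) * x j ^ m j)"
    have P: "polyfun I {..sum m A} P"
      unfolding P_def using insert.prems insert.hyps assms(1) by (intro polyfun_prod polyfun_poly) auto
    have T: "polyfun I {..m j} T"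
      unfolding T_def using insert.prems assms(1)
      by (intro polyfun_cmult polyfun_power_linear polyfun_var) auto
    \<comment> \<open>The error splits into the lower part \<open>R\<close> of the new factor times
      the old product, and the new leading monomial times the old error.\<close>
    have L: "(\<Prod>i\<in>insert j A. poly (Q i) (x i)) -
        (\<Prod>i\<in>insert j A. coeff (Q i) (m i)) * (\<Prod>i\<in>insert j A. x i ^ m i)
        = poly R (x j) * P x + T x * (P x - M x)" for x
      using insert.hyps by (simp add: R_def P_def M_def T_def poly_monom algebra_simps)
    have IH: "(\<forall>x. P x - M x = 0) \<or> 0 < sum m A \<and> polyfun I {..sum m A - 1} (\<lambda>x. P x - M x)"
      using insert.IH insert.prems unfolding P_def M_def by auto
    have 2: "(\<forall>x. T x * (P x - M x) = 0) \<or>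
        0 < m j + sum m A \<and> polyfun I {..m j + sum m A - 1} (\<lambda>x. T x * (P x - M x))"
    proof (cases "\<forall>x. P x - M x = 0")
      case False
      with IH have "0 < sum m A" "polyfun I {..sum m A - 1} (\<lambda>x. P x - M x)" by auto
      with polyfun_mult_atMost[OF T this(2)] show ?thesis by simp
    qed simp
    have "coeff R k = 0" if "k > m j - 1 \<or> m j = 0" for k
      using that insert.prems(2)[of j] by (cases "k = m j") (auto simp: R_def coeff_eq_0)
    then have R: "R = 0 \<or> 0 < m j \<and> degree R \<le> m j - 1"
      by (metis degree_le gr0I poly_eqI coeff_0)
    have 1: "(\<forall>x. poly R (x j) * P x = 0) \<or>
        0 < m j + sum m A \<and> polyfun I {..m j + sum m A - 1} (\<lambda>x. poly R (x j) * P x)"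
    proof (cases "R = 0")
      case False
      with R have *: "0 < m j" "degree R \<le> m j - 1" by auto
      have "polyfun I {..m j - 1} (\<lambda>x. poly R (x j))"
        using insert.prems assms(1) * by (intro polyfun_poly) auto
      from polyfun_mult_atMost[OF this P] * show ?thesis by simp
    qed simp
    show ?case
      unfolding L sum.insert[OF insert.hyps] using 1 2
      by (rule polyfun_pred_add)
  qed
qed

section \<open>The vanishing property\<close>

definition symfun :: "nat \<Rightarrow> ((nat \<Rightarrow> 'k) \<Rightarrow> 'k) \<Rightarrow> bool" where
  "symfun n F \<longleftrightarrow> (\<forall>\<sigma>. \<sigma> permutes {1..n} \<longrightarrow> (\<forall>x. F (x \<circ> \<sigma>) = F x))"

text \<open>The zeros are required at the partitions inside \<kappa>, not at all smaller sizes: this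
  set is stable under the moves to \<kappa> - e_J made by the operators, and it is what later gives
  the extra vanishing.\<close>

definition vanishing :: "nat \<Rightarrow> (nat \<Rightarrow> nat \<Rightarrow> 'k::field) \<Rightarrow> ('k \<Rightarrow> 'k) \<Rightarrow> nat \<Rightarrow> bool" where
  "vanishing n pt y d \<longleftrightarrow> (\<forall>F. polyfun {1..n} {..d} F \<longrightarrow> symfun n F \<longrightarrow>
     (\<forall>\<kappa>\<in>partitions n. d < psize n \<kappa> \<longrightarrow>
        (\<forall>\<nu>\<in>partitions n. \<nu> \<le> \<kappa> \<longrightarrow> \<nu> \<noteq> \<kappa> \<longrightarrow> F (\<lambda>i. y (pt i (\<nu> i))) = 0) \<longrightarrow>
        F (\<lambda>i. y (pt i (\<kappa> i))) = 0))"

text \<open>The two conditions on \<open>J\<close> are those whose failure makes a term of the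
  operator vanish: a failure at rows \<open>i\<close>, \<open>Suc i\<close> produces equal nodes, a
  failure at row \<open>n\<close> a zero coefficient.\<close>

lemma partitions_decrease:
  assumes "\<nu> \<in> partitions n" "J \<subseteq> {1..n}" "\<And>i. i \<in> J \<Longrightarrow> i < n \<Longrightarrow> \<nu> i = \<nu> (Suc i) \<Longrightarrow> Suc i \<in> J"
    and "n \<in> J \<Longrightarrow> \<nu> n \<noteq> 0"
  shows "(\<lambda>i. if i \<in> J then \<nu> i - 1 else \<nu> i) \<in> partitions n" and "\<And>i. i \<in> J \<Longrightarrow> 0 < \<nu> i"
proof -
  have anti: "\<And>i j. 1 \<le> i \<Longrightarrow> i \<le> j \<Longrightarrow> j \<le> n \<Longrightarrow> \<nu> j \<le> \<nu> i"
    using assms(1) by (auto simp: partitions_def)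
  \<comment> \<open>A block of equal rows is entered from below: with a row, \<open>J\<close>
    contains all later rows of the same length.\<close>
  have chain: "j \<in> J" if "i \<in> J" "i \<le> j" "j \<le> n" "\<nu> i = \<nu> j" for i j
    using that(2,3,4)
  proof (induction j rule: dec_induct)
    case base
    then show ?case using that by simp
  next
    case (step k)
    have "\<nu> (Suc k) \<le> \<nu> k" "\<nu> k \<le> \<nu> i"
      using anti[of k "Suc k"] anti[of i k] step that assms(2) by auto
    then have "\<nu> k = \<nu> i" "\<nu> k = \<nu> (Suc k)" using step by auto
    then show ?case using step assms(3)[of k] by auto
  qed
  show pos: "0 < \<nu> i" if "i \<in> J" for i
  proof (rule ccontr)
    assume "\<not> 0 < \<nu> i"
    moreover have "\<nu> n \<le> \<nu> i" using anti[of i n] that assms(2) by auto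
    ultimately show False using chain[of i n] assms(2,4) that by auto
  qed
  have "\<nu> j - (if j \<in> J then 1 else 0) \<le> \<nu> i - (if i \<in> J then 1 else 0)"
    if "1 \<le> i" "i \<le> j" "j \<le> n" for i j
    using anti[OF that] chain[of i j] that pos[of i] by (cases "\<nu> i = \<nu> j") auto
  then have mono: "(if j \<in> J then \<nu> j - 1 else \<nu> j) \<le> (if i \<in> J then \<nu> i - 1 else \<nu> i)"
    if "1 \<le> i" "i \<le> j" "j \<le> n" for i j
    using that by (smt (verit, best) diff_zero)
  have "(if i \<in> J then \<nu> i - 1 else \<nu> i) = 0" if "i \<notin> {1..n}" for i
  proof -
    have "\<nu> i = 0" using assms(1) that by (simp add: partitions_def)
    then show ?thesis by simp
  qed
  with mono show "(\<lambda>i. if i \<in> J then \<nu> i - 1 else \<nu> i) \<in> partitions n"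
    unfolding partitions_def by blast
qed

lemma vanishing_0: "vanishing n pt y 0"
  unfolding vanishing_def
proof (intro allI impI ballI)
  fix F :: "(nat \<Rightarrow> 'a) \<Rightarrow> 'a" and \<kappa>
  assume F: "polyfun {1..n} {..0} F" and "\<kappa> \<in> partitions n" "0 < psize n \<kappa>"
    and *: "\<forall>\<nu>\<in>partitions n. \<nu> \<le> \<kappa> \<longrightarrow> \<nu> \<noteq> \<kappa> \<longrightarrow> F (\<lambda>i. y (pt i (\<nu> i))) = 0"
  have "(\<lambda>_. 0) \<in> partitions n" "(\<lambda>_. 0) \<le> \<kappa>" "(\<lambda>_. 0) \<noteq> \<kappa>"
    using \<open>0 < psize n \<kappa>\<close> by (auto simp: partitions_def le_fun_def psize_def)
  then have "F (\<lambda>i. y (pt i 0)) = 0" using * by blast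
  then show "F (\<lambda>i. y (pt i (\<kappa> i))) = 0"
    using polyfun_degree_0[OF _ F] by (metis finite_atLeastAtMost)
qed

text \<open>
  One step of the degree induction. A symmetric function \<open>F\<close> of the coordinates \<open>y (x i)\<close> is
  transformed into one of the coordinates \<open>y' (x i)\<close> by an operator with two branches per variable:
  the unshifted branch has coefficient \<open>\<alpha>\<close> and node \<open>p\<close>, the branch shifted by \<open>dn\<close> has coefficient
  \<open>\<beta>\<close> and node \<open>r\<close>, and the Vandermonde product of the nodes is divided by that of the \<open>y' (x i)\<close>.
  Two such operators, distinguished by a boolean in every variable, are combined with the weights \<open>w\<close>
  so that the leading terms \<open>\<theta>\<close> cancel and the degree drops.
\<close>

locale lowering_step =
  fixes n d :: nat and y y' dn :: "'k::field_char_0 \<Rightarrow> 'k"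
    and \<alpha> \<beta> :: "bool \<Rightarrow> 'k \<Rightarrow> 'k" and p r :: "'k \<Rightarrow> 'k"
    and \<theta> :: "bool \<Rightarrow> nat \<Rightarrow> nat \<Rightarrow> 'k" and D :: "'k set"
    and pt :: "nat \<Rightarrow> nat \<Rightarrow> 'k" and w :: "nat \<Rightarrow> 'k"
  assumes row: "\<And>c j b. \<exists>Q. degree Q \<le> j + b \<and> coeff Q (j + b) = \<theta> c j b \<and>
      (\<forall>x\<in>D. \<alpha> c x * (p x ^ j * y x ^ b) + \<beta> c x * (r x ^ j * y (dn x) ^ b) = poly Q (y' x))"
    and inf: "infinite (y' ` D)"
    and cancel: "\<And>j b. sum j {1..n} = card (pairs n) \<Longrightarrow> sum b {1..n} = Suc d \<Longrightarrow>
      (\<Sum>R\<in>Pow {1..n}. w (card R) * (\<Prod>i\<in>{1..n}. \<theta> (i \<in> R) (j i) (b i))) = 0"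
    and pt_D: "\<And>i m. i \<in> {1..n} \<Longrightarrow> pt i m \<in> D"
    and pt_dn: "\<And>i m. i \<in> {1..n} \<Longrightarrow> dn (pt i (Suc m)) = pt i m"
    and wall: "\<And>i m. i \<in> {1..n} \<Longrightarrow> i < n \<Longrightarrow> r (pt i m) = p (pt (Suc i) m)"
    and bottom: "\<And>c. \<beta> c (pt n 0) = 0"
    and y'_sep: "\<And>i j l m. 1 \<le> i \<Longrightarrow> i < j \<Longrightarrow> j \<le> n \<Longrightarrow> l \<le> m \<Longrightarrow> y' (pt i m) \<noteq> y' (pt j l)"
    and p_sep: "\<And>i j l m. 1 \<le> i \<Longrightarrow> i < j \<Longrightarrow> j \<le> n \<Longrightarrow> l \<le> m \<Longrightarrow> p (pt i m) \<noteq> p (pt j l)"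
    and diag: "\<And>\<kappa>. \<kappa> \<in> partitions n \<Longrightarrow> Suc d < psize n \<kappa> \<Longrightarrow>
      (\<Sum>R\<in>Pow {1..n}. w (card R) * (\<Prod>i\<in>{1..n}. \<alpha> (i \<in> R) (pt i (\<kappa> i)))) \<noteq> 0"
begin

section \<open>The two-branch operator\<close>

definition coef :: "nat set \<Rightarrow> nat set \<Rightarrow> (nat \<Rightarrow> 'k) \<Rightarrow> 'k" where
  "coef R J x = (\<Prod>i\<in>{1..n}. if i \<in> J then \<beta> (i \<in> R) (x i) else \<alpha> (i \<in> R) (x i))"

definition node :: "nat set \<Rightarrow> (nat \<Rightarrow> 'k) \<Rightarrow> nat \<Rightarrow> 'k" where
  "node J x i = (if i \<in> J then r (x i) else p (x i))"

definition arg :: "nat set \<Rightarrow> (nat \<Rightarrow> 'k) \<Rightarrow> nat \<Rightarrow> 'k" where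
  "arg J x i = (if i \<in> J then y (dn (x i)) else y (x i))"

text \<open>\<open>f\<close> will be the Vandermonde product. It is kept as an argument so that, by
  bilinearity, everything can be computed on pairs of monomials; the division by the Vandermonde
  product in y' is carried out afterwards.\<close>

definition oper :: "((nat \<Rightarrow> 'k) \<Rightarrow> 'k) \<Rightarrow> ((nat \<Rightarrow> 'k) \<Rightarrow> 'k) \<Rightarrow> (nat \<Rightarrow> 'k) \<Rightarrow> 'k" where
  "oper f h x = (\<Sum>R\<in>Pow {1..n}. w (card R) *
     (\<Sum>J\<in>Pow {1..n}. coef R J x * (f (node J x) * h (arg J x))))"

text \<open>On monomials the sum over \<open>J\<close> factorizes over the variables, which is why
  \<open>row\<close> is a condition in one variable.\<close>

lemma oper_monom:
  "oper (\<lambda>x. c * (\<Prod>i\<in>{1..n}. x i ^ e i)) (\<lambda>x. c' * (\<Prod>i\<in>{1..n}. x i ^ e' i)) x =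
   c * c' * (\<Sum>R\<in>Pow {1..n}. w (card R) * (\<Prod>i\<in>{1..n}.
     \<alpha> (i \<in> R) (x i) * (p (x i) ^ e i * y (x i) ^ e' i) +
     \<beta> (i \<in> R) (x i) * (r (x i) ^ e i * y (dn (x i)) ^ e' i)))"
proof -
  have "coef R J x * ((c * (\<Prod>i\<in>{1..n}. node J x i ^ e i)) * (c' * (\<Prod>i\<in>{1..n}. arg J x i ^ e' i)))
     = c * c' * (\<Prod>i\<in>{1..n}. if i \<in> J then \<beta> (i \<in> R) (x i) * (r (x i) ^ e i * y (dn (x i)) ^ e' i)
         else \<alpha> (i \<in> R) (x i) * (p (x i) ^ e i * y (x i) ^ e' i))" for R J
  proof -
    have "coef R J x * ((\<Prod>i\<in>{1..n}. node J x i ^ e i) * (\<Prod>i\<in>{1..n}. arg J x i ^ e' i))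
     = (\<Prod>i\<in>{1..n}. if i \<in> J then \<beta> (i \<in> R) (x i) * (r (x i) ^ e i * y (dn (x i)) ^ e' i)
         else \<alpha> (i \<in> R) (x i) * (p (x i) ^ e i * y (x i) ^ e' i))"
      unfolding coef_def node_def arg_def prod.distrib[symmetric]
      by (rule prod.cong) auto
    then show ?thesis by (simp only: mult_ac)
  qed
  then have inner: "(\<Sum>J\<in>Pow {1..n}. coef R J x *
      ((c * (\<Prod>i\<in>{1..n}. node J x i ^ e i)) * (c' * (\<Prod>i\<in>{1..n}. arg J x i ^ e' i))))
    = c * c' * (\<Prod>i\<in>{1..n}. \<alpha> (i \<in> R) (x i) * (p (x i) ^ e i * y (x i) ^ e' i) +
        \<beta> (i \<in> R) (x i) * (r (x i) ^ e i * y (dn (x i)) ^ e' i))" for R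
    by (simp only: prod_add_Pow[OF finite_atLeastAtMost] sum_distrib_left)
  show ?thesis
    unfolding oper_def inner sum_distrib_left by (simp only: mult_ac)
qed

lemma oper_add_left: "oper (\<lambda>x. f x + g x) h x = oper f h x + oper g h x"
  unfolding oper_def by (simp only: distrib_left distrib_right sum.distrib)

lemma oper_add_right: "oper f (\<lambda>x. g x + h x) x = oper f g x + oper f h x"
  unfolding oper_def by (simp only: distrib_left distrib_right sum.distrib)

text \<open>Termwise the degree could reach \<open>card (pairs n) + Suc d\<close>; the monomials of
  that degree cancel by \<open>cancel\<close>, which is the gain of one degree.\<close>

lemma oper_polyfun:
  assumes "polyfun {1..n} {card (pairs n)} f" "polyfun {1..n} {..Suc d} h"
  shows "\<exists>G. polyfun {1..n} {..card (pairs n) + d} G \<and>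
    (\<forall>x. (\<forall>i\<in>{1..n}. x i \<in> D) \<longrightarrow> oper f h x = G (\<lambda>i. y' (x i)))"
  using assms(1)
proof (induction rule: polyfun.induct)
  case (monom e c)
  from assms(2) show ?case
  proof (induction rule: polyfun.induct)
    case (monom e' c')
    define Q where "Q = (\<lambda>c j b. SOME Q. degree Q \<le> j + b \<and> coeff Q (j + b) = \<theta> c j b \<and>
      (\<forall>x\<in>D. \<alpha> c x * (p x ^ j * y x ^ b) + \<beta> c x * (r x ^ j * y (dn x) ^ b) = poly Q (y' x)))"
    have Q: "degree (Q c j b) \<le> j + b" "coeff (Q c j b) (j + b) = \<theta> c j b"
      "x \<in> D \<Longrightarrow> \<alpha> c x * (p x ^ j * y x ^ b) + \<beta> c x * (r x ^ j * y (dn x) ^ b) = poly (Q c j b) (y' x)"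
      for c j b x
      using someI_ex[OF row[of j b c]] unfolding Q_def by blast+
    define N where "N = (\<Sum>i\<in>{1..n}. e i + e' i)"
    define G where "G = (\<lambda>Y. \<Sum>R\<in>Pow {1..n}. w (card R) * (\<Prod>i\<in>{1..n}. poly (Q (i \<in> R) (e i) (e' i)) (Y i)))"
    have "polyfun {1..n} {..card (pairs n) + d} G"
    proof (cases "sum e' {1..n} \<le> d")
      case True
      have "polyfun {1..n} {..N} G"
        unfolding G_def N_def by (intro polyfun_sum polyfun_cmult polyfun_prod polyfun_poly Q) auto
      then show ?thesis
        by (rule polyfun_mono) (use True monom \<open>sum e _ \<in> _\<close> in \<open>auto simp: N_def sum.distrib\<close>)
    next
      case False
      then have N: "N = Suc (card (pairs n) + d)" and e': "sum e' {1..n} = Suc d"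
        using monom \<open>sum e _ \<in> _\<close> by (auto simp: N_def sum.distrib)
      \<comment> \<open>What remains of each product after removal of the monomial of top
        degree.\<close>
      define L where "L = (\<lambda>R Y. (\<Prod>i\<in>{1..n}. poly (Q (i \<in> R) (e i) (e' i)) (Y i)) -
        (\<Prod>i\<in>{1..n}. \<theta> (i \<in> R) (e i) (e' i)) * (\<Prod>i\<in>{1..n}. Y i ^ (e i + e' i)))"
      have L: "polyfun {1..n} {..card (pairs n) + d} (L R)" for R
      proof -
        have "(\<forall>x. L R x = 0) \<or> 0 < N \<and> polyfun {1..n} {..N - 1} (L R)"
          using polyfun_prod_poly_lead[of "{1..n}" "{1..n}" "\<lambda>i. Q (i \<in> R) (e i) (e' i)" "\<lambda>i. e i + e' i"] Q
          by (simp add: L_def N_def)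
        then show ?thesis using N polyfun_zero[of "{1..n}"] by (metis diff_Suc_1 ext)
      qed
      have "G Y = (\<Sum>R\<in>Pow {1..n}. w (card R) * L R Y)" for Y
      proof -
        \<comment> \<open>The removed monomials do not depend on \<open>R\<close>, so their total
          coefficient is the sum in \<open>cancel\<close>.\<close>
        have "(\<Sum>R\<in>Pow {1..n}. w (card R) * L R Y) = G Y -
            (\<Sum>R\<in>Pow {1..n}. w (card R) * (\<Prod>i\<in>{1..n}. \<theta> (i \<in> R) (e i) (e' i))) * (\<Prod>i\<in>{1..n}. Y i ^ (e i + e' i))"
          unfolding L_def G_def by (simp add: right_diff_distrib sum_subtractf sum_distrib_right mult.assoc)
        then show ?thesis using cancel[of e e'] e' \<open>sum e _ \<in> _\<close> by simp
      qed
      moreover have "polyfun {1..n} {..card (pairs n) + d} (\<lambda>Y. \<Sum>R\<in>Pow {1..n}. w (card R) * L R Y)"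
        by (intro polyfun_sum polyfun_cmult L)
      ultimately show ?thesis by presburger
    qed
    then have "polyfun {1..n} {..card (pairs n) + d} (\<lambda>Y. c * c' * G Y)"
      by (rule polyfun_cmult)
    moreover have "oper (\<lambda>x. c * (\<Prod>i\<in>{1..n}. x i ^ e i)) (\<lambda>x. c' * (\<Prod>i\<in>{1..n}. x i ^ e' i)) x
        = c * c' * G (\<lambda>i. y' (x i))" if "\<forall>i\<in>{1..n}. x i \<in> D" for x
      unfolding oper_monom G_def using that Q(3) by simp
    ultimately show ?case by blast
  next
    case (add g h)
    then obtain G H where
      "polyfun {1..n} {..card (pairs n) + d} G" "polyfun {1..n} {..card (pairs n) + d} H"
      "\<forall>x. (\<forall>i\<in>{1..n}. x i \<in> D) \<longrightarrow> oper (\<lambda>x. c * (\<Prod>i\<in>{1..n}. x i ^ e i)) g x = G (\<lambda>i. y' (x i))"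
      "\<forall>x. (\<forall>i\<in>{1..n}. x i \<in> D) \<longrightarrow> oper (\<lambda>x. c * (\<Prod>i\<in>{1..n}. x i ^ e i)) h x = H (\<lambda>i. y' (x i))"
      by blast
    then show ?case
      by (intro exI[of _ "\<lambda>x. G x + H x"]) (auto simp: oper_add_right intro: polyfun.add)
  qed
next
  case (add f g)
  then obtain G H where
    "polyfun {1..n} {..card (pairs n) + d} G" "polyfun {1..n} {..card (pairs n) + d} H"
    "\<forall>x. (\<forall>i\<in>{1..n}. x i \<in> D) \<longrightarrow> oper f h x = G (\<lambda>i. y' (x i))"
    "\<forall>x. (\<forall>i\<in>{1..n}. x i \<in> D) \<longrightarrow> oper g h x = H (\<lambda>i. y' (x i))"
    by blast
  then show ?case
    by (intro exI[of _ "\<lambda>x. G x + H x"]) (auto simp: oper_add_left intro: polyfun.add)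
qed

text \<open>All variables are treated alike and the weights see only the cardinality of
  \<open>R\<close>, so a permutation just relabels \<open>R\<close> and \<open>J\<close>; the factor
  \<open>s\<close> comes from the Vandermonde product alone.\<close>

lemma oper_permute:
  assumes "\<sigma> permutes {1..n}" "symfun n F"
    and V: "\<And>\<xi>. vand n (\<xi> \<circ> \<sigma>) = s * vand n \<xi>"
  shows "oper (vand n) F (x \<circ> \<sigma>) = s * oper (vand n) F x"
proof -
  have inj: "\<sigma> i \<in> \<sigma> ` J \<longleftrightarrow> i \<in> J" for i J
    using permutes_inj[OF assms(1)] by (auto dest: injD)
  have bij: "bij_betw ((`) \<sigma>) (Pow {1..n}) (Pow {1..n})"
    using bij_betw_Pow[OF permutes_imp_bij[OF assms(1)]] .
  define T where "T = (\<lambda>R J. w (card R) * (coef R J x * (vand n (node J x) * F (arg J x))))"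
  have coef: "coef R J (x \<circ> \<sigma>) = coef (\<sigma> ` R) (\<sigma> ` J) x" for R J
  proof -
    have "coef R J (x \<circ> \<sigma>) = (\<Prod>i\<in>{1..n}. (\<lambda>k. if k \<in> \<sigma> ` J then \<beta> (k \<in> \<sigma> ` R) (x k)
        else \<alpha> (k \<in> \<sigma> ` R) (x k)) (\<sigma> i))"
      unfolding coef_def by (intro prod.cong refl) (simp add: inj)
    also have "\<dots> = coef (\<sigma> ` R) (\<sigma> ` J) x"
      unfolding coef_def by (rule prod.reindex_bij_betw[OF permutes_imp_bij[OF assms(1)]])
    finally show ?thesis .
  qed
  have node: "node J (x \<circ> \<sigma>) = node (\<sigma> ` J) x \<circ> \<sigma>" and arg: "arg J (x \<circ> \<sigma>) = arg (\<sigma> ` J) x \<circ> \<sigma>" for J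
    by (auto simp: node_def arg_def inj)
  have card: "card (\<sigma> ` R) = card R" for R
    by (rule card_image) (rule inj_on_subset[OF permutes_inj[OF assms(1)] subset_UNIV])
  have "oper (vand n) F (x \<circ> \<sigma>) = (\<Sum>R\<in>Pow {1..n}. \<Sum>J\<in>Pow {1..n}. s * T (\<sigma> ` R) (\<sigma> ` J))"
    unfolding oper_def T_def coef node arg V card
    using assms(1,2) by (simp add: symfun_def sum_distrib_left mult_ac)
  also have "\<dots> = (\<Sum>R\<in>Pow {1..n}. \<Sum>J\<in>Pow {1..n}. s * T (\<sigma> ` R) J)"
    by (intro sum.cong refl sum.reindex_bij_betw[OF bij])
  also have "\<dots> = (\<Sum>R\<in>Pow {1..n}. \<Sum>J\<in>Pow {1..n}. s * T R J)"
    by (rule sum.reindex_bij_betw[OF bij])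
  also have "\<dots> = s * oper (vand n) F x"
    unfolding oper_def T_def by (simp add: sum_distrib_left)
  finally show ?thesis .
qed

text \<open>Every term with nonempty \<open>J\<close> vanishes: if \<nu> - e_J is not a partition,
  through two equal nodes (\<open>wall\<close>) or a zero coefficient (\<open>bottom\<close>), and
  otherwise because \<open>F\<close> vanishes at that smaller partition.\<close>

lemma oper_partition:
  assumes "\<nu> \<in> partitions n"
    and F: "polyfun {1..n} {..m} F"
    and 0: "\<And>\<mu>. \<mu> \<in> partitions n \<Longrightarrow> \<mu> \<le> \<nu> \<Longrightarrow> \<mu> \<noteq> \<nu> \<Longrightarrow> F (\<lambda>i. y (pt i (\<mu> i))) = 0"
  shows "oper (vand n) F (\<lambda>i. pt i (\<nu> i)) =
    (\<Sum>R\<in>Pow {1..n}. w (card R) * (\<Prod>i\<in>{1..n}. \<alpha> (i \<in> R) (pt i (\<nu> i)))) *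
    (vand n (\<lambda>i. p (pt i (\<nu> i))) * F (\<lambda>i. y (pt i (\<nu> i))))"
proof -
  define x where "x = (\<lambda>i. pt i (\<nu> i))"
  have zero: "coef R J x * (vand n (node J x) * F (arg J x)) = 0"
    if J: "J \<in> Pow {1..n}" "J \<noteq> {}" for R J
  proof (cases "(\<exists>i\<in>J. i < n \<and> \<nu> i = \<nu> (Suc i) \<and> Suc i \<notin> J) \<or> (n \<in> J \<and> \<nu> n = 0)")
    case True
    then show ?thesis
    proof
      assume "\<exists>i\<in>J. i < n \<and> \<nu> i = \<nu> (Suc i) \<and> Suc i \<notin> J"
      then obtain i where i: "i \<in> J" "i < n" "\<nu> i = \<nu> (Suc i)" "Suc i \<notin> J" by blast
      then have "node J x i = node J x (Suc i)"
        using wall[of i "\<nu> i"] J by (auto simp: node_def x_def)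
      then have "vand n (node J x) = 0"
        unfolding vand_eq_0_iff using i J by (intro exI[of _ i] exI[of _ "Suc i"]) auto
      then show ?thesis by simp
    next
      assume "n \<in> J \<and> \<nu> n = 0"
      then have "coef R J x = 0"
        unfolding coef_def using J bottom by (intro prod_zero bexI[of _ n]) (auto simp: x_def)
      then show ?thesis by simp
    qed
  next
    case False
    \<comment> \<open>Neither obstruction occurs, so these are the hypotheses of
      \<open>partitions_decrease\<close>.\<close>
    define \<mu> where "\<mu> = (\<lambda>i. if i \<in> J then \<nu> i - 1 else \<nu> i)"
    have \<mu>: "\<mu> \<in> partitions n" and pos: "\<And>i. i \<in> J \<Longrightarrow> 0 < \<nu> i"
      unfolding \<mu>_def using partitions_decrease[OF assms(1), of J] J False by auto
    have "\<mu> \<le> \<nu>" by (auto simp: le_fun_def \<mu>_def)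
    moreover have "\<mu> \<noteq> \<nu>"
    proof -
      obtain i where "i \<in> J" using J by auto
      then have "\<mu> i \<noteq> \<nu> i" using pos[of i] by (simp add: \<mu>_def)
      then show ?thesis by auto
    qed
    moreover have "F (arg J x) = F (\<lambda>i. y (pt i (\<mu> i)))"
    proof (rule polyfun_cong_arg[OF F])
      fix i assume "i \<in> {1..n}"
      then show "arg J x i = y (pt i (\<mu> i))"
        using pt_dn[of i "\<nu> i - 1"] pos[of i] by (auto simp: arg_def x_def \<mu>_def)
    qed
    ultimately show ?thesis using 0[OF \<mu>] by simp
  qed
  have "(\<Sum>J\<in>Pow {1..n}. coef R J x * (vand n (node J x) * F (arg J x))) =
      coef R {} x * (vand n (node {} x) * F (arg {} x))" for R
    by (rule sum.mono_neutral_left[symmetric, of _ "{{}}", simplified]) (use zero in auto)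
  then have "oper (vand n) F x = (\<Sum>R\<in>Pow {1..n}. w (card R) * coef R {} x) *
      (vand n (node {} x) * F (arg {} x))"
    unfolding oper_def by (simp only: sum_distrib_right mult.assoc)
  then show ?thesis
    unfolding x_def by (simp add: coef_def node_def[abs_def] arg_def[abs_def])
qed

text \<open>The operator turns \<open>F\<close> into an antisymmetric polynomial in y', and division
  by the Vandermonde product leaves a symmetric \<open>g\<close> of degree at most \<open>d\<close>.
  The zeros of \<open>F\<close> below \<kappa> pass to \<open>g\<close>, the assumption then gives a
  zero of \<open>g\<close> at \<kappa>, and \<open>diag\<close> carries it back to
  \<open>F\<close>.\<close>

lemma vanishing_Suc:
  assumes "vanishing n pt y' d"
  shows "vanishing n pt y (Suc d)"
  unfolding vanishing_def
proof (intro allI impI ballI)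
  fix F \<kappa>
  assume F: "polyfun {1..n} {..Suc d} F" "symfun n F" and \<kappa>: "\<kappa> \<in> partitions n" "Suc d < psize n \<kappa>"
    and F0: "\<forall>\<nu>\<in>partitions n. \<nu> \<le> \<kappa> \<longrightarrow> \<nu> \<noteq> \<kappa> \<longrightarrow> F (\<lambda>i. y (pt i (\<nu> i))) = 0"
  define \<Phi> where "\<Phi> = oper (vand n) F"
  obtain G where G: "polyfun {1..n} {..card (pairs n) + d} G"
    "\<And>x. (\<forall>i\<in>{1..n}. x i \<in> D) \<Longrightarrow> \<Phi> x = G (\<lambda>i. y' (x i))"
  proof -
    from oper_polyfun[OF polyfun_vand F(1)] obtain G where
      "polyfun {1..n} {..card (pairs n) + d} G"
      "\<forall>x. (\<forall>i\<in>{1..n}. x i \<in> D) \<longrightarrow> oper (vand n) F x = G (\<lambda>i. y' (x i))"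
      by (elim exE conjE)
    then show ?thesis by (intro that[of G]) (simp_all add: \<Phi>_def)
  qed
  \<comment> \<open>\<open>\<Phi>\<close> is known to be polynomial in y' only for arguments in
    \<open>D\<close>; this is enough, the image of \<open>D\<close> being infinite.\<close>
  have grid: "H Y = 0" if H: "polyfun {1..n} {..m} H"
    and H0: "\<And>x. (\<forall>i\<in>{1..n}. x i \<in> D) \<Longrightarrow> H (\<lambda>i. y' (x i)) = 0" for H :: "(nat \<Rightarrow> 'k) \<Rightarrow> 'k" and m Y
  proof (rule polyfun_grid[OF _ H, of "\<lambda>_. y' ` D"])
    fix Y assume "\<And>i. i \<in> {1..n} \<Longrightarrow> Y i \<in> y' ` D"
    then have "\<forall>i\<in>{1..n}. \<exists>x. x \<in> D \<and> Y i = y' x" by blast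
    then obtain x where "\<forall>i\<in>{1..n}. x i \<in> D \<and> Y i = y' (x i)" by metis
    then show "H Y = 0" using H0[of x] polyfun_cong_arg[OF H, of Y "\<lambda>i. y' (x i)"] by simp
  qed (use inf in auto)
  have G_eq_0: "G Y = 0" if ij: "(i, j) \<in> pairs n" and Y: "Y i = Y j" for i j Y
  proof -
    define h where "h = (\<lambda>Y::nat \<Rightarrow> 'k. Y(j := Y i))"
    have h: "polyfun {1..n} {..1} (\<lambda>Y. h Y a)" if "a \<in> {1..n}" for a
    proof (cases "a = j")
      case True
      then show ?thesis using ij by (simp add: h_def polyfun_var)
    next
      case False
      then show ?thesis using that by (simp add: h_def polyfun_var)
    qed
    have "G (h Y) = 0"
    proof (rule grid[of _ "\<lambda>Y. G (h Y)"])
      show "polyfun {1..n} {..card (pairs n) + d} (\<lambda>Y. G (h Y))"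
        by (rule polyfun_compose[OF _ G(1) h]) auto
      fix x assume x: "\<forall>i\<in>{1..n}. x i \<in> D"
      \<comment> \<open>Equating the coordinates of \<open>x\<close> rather than those of y' gives a
        point fixed by the transposition, where antisymmetry forces the value 0.\<close>
      define x' where "x' = x(j := x i)"
      have "x' \<circ> Transposition.transpose i j = x'"
        by (auto simp: x'_def transpose_def)
      moreover have "\<Phi> (x' \<circ> Transposition.transpose i j) = - 1 * \<Phi> x'"
        unfolding \<Phi>_def
        by (rule oper_permute[OF _ F(2)]) (use ij in \<open>auto simp: vand_transpose intro!: permutes_swap_id\<close>)
      ultimately have "\<Phi> x' = 0" by simp
      moreover have "\<Phi> x' = G (\<lambda>i. y' (x' i))"
        by (rule G(2)) (use x ij in \<open>auto simp: x'_def\<close>)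
      moreover have "(\<lambda>i. y' (x' i)) = h (\<lambda>i. y' (x i))"
        by (auto simp: x'_def h_def)
      ultimately show "G (h (\<lambda>i. y' (x i))) = 0" by simp
    qed
    moreover have "h Y = Y" using Y by (auto simp: h_def)
    ultimately show ?thesis by simp
  qed
  obtain g where g: "polyfun {1..n} {..d} g" "\<And>Y. G Y = vand n Y * g Y"
    using polyfun_divide_differences[of "{1..n}" "pairs n" d G] G(1) G_eq_0
    unfolding vand_def by auto
  \<comment> \<open>\<open>G\<close> and the Vandermonde product acquire the same sign, so their
    quotient is symmetric.\<close>
  have "g (Y \<circ> \<sigma>) = g Y" if \<sigma>: "\<sigma> permutes {1..n}" for \<sigma> Y
  proof -
    define s :: 'k where "s = (- 1) ^ card (inversions n \<sigma>)"
    have s: "s \<noteq> 0" "vand n (\<xi> \<circ> \<sigma>) = s * vand n \<xi>" for \<xi> :: "nat \<Rightarrow> 'k"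
      using vand_permute[OF \<sigma>] by (auto simp: s_def)
    have comp: "polyfun {1..n} {..m} (\<lambda>Y. H (Y \<circ> \<sigma>))" if "polyfun {1..n} {..m} H" for H :: "(nat \<Rightarrow> 'k) \<Rightarrow> 'k" and m
    proof (rule polyfun_compose[OF _ that])
      fix i assume "i \<in> {1..n}"
      then have "\<sigma> i \<in> {1..n}" using permutes_in_image[OF \<sigma>] by blast
      then show "polyfun {1..n} {..1} (\<lambda>Y::nat \<Rightarrow> 'k. (Y \<circ> \<sigma>) i)"
        unfolding o_def by (intro polyfun_var) auto
    qed simp
    have *: "G (Y \<circ> \<sigma>) - s * G Y = 0" for Y
    proof (rule grid[of _ "\<lambda>Y. G (Y \<circ> \<sigma>) - s * G Y"])
      show "polyfun {1..n} {..card (pairs n) + d} (\<lambda>Y. G (Y \<circ> \<sigma>) - s * G Y)"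
        by (intro polyfun_diff polyfun_cmult comp G)
      fix x assume x: "\<forall>i\<in>{1..n}. x i \<in> D"
      have "\<Phi> (x \<circ> \<sigma>) = G (\<lambda>i. y' ((x \<circ> \<sigma>) i))"
        by (rule G(2)) (use x permutes_in_image[OF \<sigma>] in \<open>metis comp_apply\<close>)
      moreover have "\<Phi> (x \<circ> \<sigma>) = s * \<Phi> x"
        unfolding \<Phi>_def using oper_permute[OF \<sigma> F(2)] s by blast
      moreover have "(\<lambda>i. y' ((x \<circ> \<sigma>) i)) = (\<lambda>i. y' (x i)) \<circ> \<sigma>" by auto
      ultimately show "G ((\<lambda>i. y' (x i)) \<circ> \<sigma>) - s * G (\<lambda>i. y' (x i)) = 0"
        using G(2)[OF x] by simp
    qed
    have "g (Y \<circ> \<sigma>) - g Y = 0"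
    proof (rule polyfun_domain[where f = "vand n" and g = "\<lambda>Y. g (Y \<circ> \<sigma>) - g Y" and y = of_nat])
      show "polyfun {1..n} {card (pairs n)} (vand n :: (nat \<Rightarrow> 'k) \<Rightarrow> 'k)" by (rule polyfun_vand)
      show "polyfun {1..n} {..d} (\<lambda>Y. g (Y \<circ> \<sigma>) - g Y)" by (intro polyfun_diff comp g)
      show "vand n Y * (g (Y \<circ> \<sigma>) - g Y) = 0" for Y
        using *[of Y] s unfolding g(2) by (simp add: algebra_simps)
      show "vand n of_nat \<noteq> (0::'k)" by (auto simp: vand_eq_0_iff)
    qed
    then show ?thesis by simp
  qed
  then have gsym: "symfun n g" by (simp add: symfun_def)
  have \<Phi>: "\<Phi> (\<lambda>i. pt i (\<nu> i)) = vand n (\<lambda>i. y' (pt i (\<nu> i))) * g (\<lambda>i. y' (pt i (\<nu> i)))" for \<nu>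
    using G(2)[of "\<lambda>i. pt i (\<nu> i)"] pt_D g(2) by simp
  have anti: "\<nu> j \<le> \<nu> i" if "\<nu> \<in> partitions n" "1 \<le> i" "i < j" "j \<le> n" for \<nu> i j
    using that by (auto simp: partitions_def)
  have y'_ne: "vand n (\<lambda>i. y' (pt i (\<nu> i))) \<noteq> 0" if "\<nu> \<in> partitions n" for \<nu>
    using anti[OF that] y'_sep by (auto simp: vand_eq_0_iff)
  have p_ne: "vand n (\<lambda>i. p (pt i (\<nu> i))) \<noteq> 0" if "\<nu> \<in> partitions n" for \<nu>
    using anti[OF that] p_sep by (auto simp: vand_eq_0_iff)
  have "g (\<lambda>i. y' (pt i (\<nu> i))) = 0" if \<nu>: "\<nu> \<in> partitions n" "\<nu> \<le> \<kappa>" "\<nu> \<noteq> \<kappa>" for \<nu>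
  proof -
    have "\<Phi> (\<lambda>i. pt i (\<nu> i)) = 0"
      unfolding \<Phi>_def
      by (subst oper_partition[OF \<nu>(1) F(1)]) (use F0 \<nu> in \<open>auto intro: order_trans dest: antisym\<close>)
    then show ?thesis using \<Phi> y'_ne[OF \<nu>(1)] by simp
  qed
  then have "g (\<lambda>i. y' (pt i (\<kappa> i))) = 0"
    using assms g(1) gsym \<kappa> unfolding vanishing_def by auto
  \<comment> \<open>At \<kappa> only the unshifted term survives, and its factor in front of
    \<open>F\<close> is nonzero by \<open>diag\<close> and \<open>p_sep\<close>.\<close>
  then have "\<Phi> (\<lambda>i. pt i (\<kappa> i)) = 0" using \<Phi> by simp
  then show "F (\<lambda>i. y (pt i (\<kappa> i))) = 0"
    unfolding \<Phi>_def using F0 diag[OF \<kappa>] p_ne[OF \<kappa>(1)]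
    by (subst (asm) oper_partition[OF \<kappa>(1) F(1)]) auto
qed

end

section \<open>The row operators\<close>

text \<open>
  The two branches are conjugate over the field of functions of \<open>y'\<close>: \<open>X\<close> and \<open>Y\<close> are the roots of
  a quadratic polynomial with coefficients affine in \<open>y'\<close>, and each row operator sends \<open>P + Q X\<close> to \<open>Q\<close>.
\<close>

locale conjugate_branches =
  fixes D :: "'k::field_char_0 set" and X Y y' :: "'k \<Rightarrow> 'k" and s\<^sub>0 s\<^sub>1 p\<^sub>0 p\<^sub>1 :: 'k
  assumes sum_XY: "\<And>x. x \<in> D \<Longrightarrow> X x + Y x = s\<^sub>0 + s\<^sub>1 * y' x"
    and prod_XY: "\<And>x. x \<in> D \<Longrightarrow> X x * Y x = p\<^sub>0 + p\<^sub>1 * y' x"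
    and neq_XY: "\<And>x. x \<in> D \<Longrightarrow> X x \<noteq> Y x"
begin

text \<open>A pair of conjugate elements P + Q X and P + Q Y. \<open>X\<close> is counted as having
  degree one in y', hence the bound for \<open>P\<close> is one higher than for \<open>Q\<close>;
  \<pi> and \<rho> are the two coefficients in top degree.\<close>

definition rep :: "nat \<Rightarrow> 'k \<Rightarrow> 'k \<Rightarrow> ('k \<Rightarrow> 'k) \<Rightarrow> ('k \<Rightarrow> 'k) \<Rightarrow> bool" where
  "rep m \<pi> \<rho> E E' \<longleftrightarrow> (\<exists>P Q. degree P \<le> Suc m \<and> coeff P (Suc m) = \<pi> \<and> degree Q \<le> m \<and> coeff Q m = \<rho> \<and>
     (\<forall>x\<in>D. E x = poly P (y' x) + poly Q (y' x) * X x \<and> E' x = poly P (y' x) + poly Q (y' x) * Y x))"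

lemma rep_0:
  assumes "\<And>x. x \<in> D \<Longrightarrow> E x = \<delta> + \<pi> * y' x + \<rho> * X x" "\<And>x. x \<in> D \<Longrightarrow> E' x = \<delta> + \<pi> * y' x + \<rho> * Y x"
  shows "rep 0 \<pi> \<rho> E E'"
  unfolding rep_def
  by (intro exI[of _ "[:\<delta>, \<pi>:]"] exI[of _ "[:\<rho>:]"]) (auto simp: assms mult.commute)

lemma rep_cong:
  "rep m \<pi> \<rho> E E' \<Longrightarrow> m = m' \<Longrightarrow> \<pi> = \<pi>' \<Longrightarrow> \<rho> = \<rho>' \<Longrightarrow> (\<And>x. E x = F x) \<Longrightarrow> (\<And>x. E' x = F' x) \<Longrightarrow>
    rep m' \<pi>' \<rho>' F F'"
  by (simp add: rep_def)

text \<open>The square of \<open>X\<close> is reduced by the quadratic equation. Its constant term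
  is only affine in y', so it stays below the top degree of \<open>P\<close>, whereas its linear
  term contributes \<open>\<open_s>\<close> to the top of \<open>Q\<close>.\<close>

lemma rep_mult:
  assumes "rep m \<pi> \<rho> E E'"
    and f: "\<And>x. x \<in> D \<Longrightarrow> f x = \<gamma> * y' x + \<delta> + c * X x" "\<And>x. x \<in> D \<Longrightarrow> f' x = \<gamma> * y' x + \<delta> + c * Y x"
  shows "rep (Suc m) (\<gamma> * \<pi>) (\<gamma> * \<rho> + c * (\<pi> + s\<^sub>1 * \<rho>)) (\<lambda>x. E x * f x) (\<lambda>x. E' x * f' x)"
proof -
  obtain P Q where PQ: "degree P \<le> Suc m" "coeff P (Suc m) = \<pi>" "degree Q \<le> m" "coeff Q m = \<rho>"
    "\<And>x. x \<in> D \<Longrightarrow> E x = poly P (y' x) + poly Q (y' x) * X x"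
    "\<And>x. x \<in> D \<Longrightarrow> E' x = poly P (y' x) + poly Q (y' x) * Y x"
    using assms(1) unfolding rep_def by blast
  \<comment> \<open>The components of (\<gamma> y' + \<delta> + c X)(P + Q X) after this
    reduction.\<close>
  define P' where "P' = [:\<delta>, \<gamma>:] * P - smult c ([:p\<^sub>0, p\<^sub>1:] * Q)"
  define Q' where "Q' = [:\<delta>, \<gamma>:] * Q + smult c P + smult c ([:s\<^sub>0, s\<^sub>1:] * Q)"
  have z: "coeff P k = 0" if "k > Suc m" for k using PQ(1) that by (simp add: coeff_eq_0)
  have z': "coeff Q k = 0" if "k > m" for k using PQ(3) that by (simp add: coeff_eq_0)
  have coeffP: "coeff P' (Suc k) = \<delta> * coeff P (Suc k) + \<gamma> * coeff P k - c * (p\<^sub>0 * coeff Q (Suc k) + p\<^sub>1 * coeff Q k)" for k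
    by (simp add: P'_def)
  have coeffQ: "coeff Q' (Suc k) = \<delta> * coeff Q (Suc k) + \<gamma> * coeff Q k + c * coeff P (Suc k)
      + c * (s\<^sub>0 * coeff Q (Suc k) + s\<^sub>1 * coeff Q k)" for k
    by (simp add: Q'_def)
  have "degree P' \<le> Suc (Suc m)"
  proof (rule degree_le, intro allI impI)
    fix i assume "Suc (Suc m) < i"
    then obtain k where "i = Suc k" "Suc m < k" by (metis Suc_lessE)
    then show "coeff P' i = 0" by (simp add: coeffP z z')
  qed
  moreover have "degree Q' \<le> Suc m"
  proof (rule degree_le, intro allI impI)
    fix i assume "Suc m < i"
    then obtain k where "i = Suc k" "m < k" by (metis Suc_lessE)
    then show "coeff Q' i = 0" by (simp add: coeffQ z z')
  qed
  moreover have "coeff P' (Suc (Suc m)) = \<gamma> * \<pi>" by (simp add: coeffP z z' PQ)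
  moreover have "coeff Q' (Suc m) = \<gamma> * \<rho> + c * (\<pi> + s\<^sub>1 * \<rho>)"
    by (simp add: coeffQ z z' PQ algebra_simps)
  moreover have "E x * f x = poly P' (y' x) + poly Q' (y' x) * X x \<and>
      E' x * f' x = poly P' (y' x) + poly Q' (y' x) * Y x" if "x \<in> D" for x
  proof -
    define v A B where "v = y' x" and "A = poly P v" and "B = poly Q v"
    have *: "X x * X x = (s\<^sub>0 + s\<^sub>1 * v) * X x - (p\<^sub>0 + p\<^sub>1 * v)" "Y x * Y x = (s\<^sub>0 + s\<^sub>1 * v) * Y x - (p\<^sub>0 + p\<^sub>1 * v)"
      using sum_XY[OF that] prod_XY[OF that] unfolding v_def by algebra+
    have "poly P' v = (\<delta> + \<gamma> * v) * A - c * ((p\<^sub>0 + p\<^sub>1 * v) * B)"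
      "poly Q' v = (\<delta> + \<gamma> * v) * B + c * A + c * ((s\<^sub>0 + s\<^sub>1 * v) * B)"
      by (simp_all add: P'_def Q'_def A_def B_def algebra_simps)
    then show ?thesis
      unfolding f[OF that] PQ(5,6)[OF that] v_def[symmetric] A_def[symmetric] B_def[symmetric]
      using * by algebra
  qed
  ultimately show ?thesis unfolding rep_def by blast
qed

text \<open>The divided difference of the two conjugates cancels \<open>P\<close> and isolates
  \<open>Q\<close>, whose leading coefficient is the \<theta> of the operator.\<close>

lemma rep_row:
  assumes "rep m \<pi> \<rho> E E'"
  shows "\<exists>Q. degree Q \<le> m \<and> coeff Q m = \<rho> \<and> (\<forall>x\<in>D. (E x - E' x) / (X x - Y x) = poly Q (y' x))"
proof -
  obtain P Q where PQ: "degree Q \<le> m" "coeff Q m = \<rho>"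
    "\<And>x. x \<in> D \<Longrightarrow> E x = poly P (y' x) + poly Q (y' x) * X x"
    "\<And>x. x \<in> D \<Longrightarrow> E' x = poly P (y' x) + poly Q (y' x) * Y x"
    using assms(1) unfolding rep_def by blast
  have "(E x - E' x) / (X x - Y x) = poly Q (y' x)" if "x \<in> D" for x
    using neq_XY[OF that] by (simp add: PQ(3,4)[OF that] field_simps)
  then show ?thesis using PQ by blast
qed

end

lemma infinite_image_finite_fibers:
  assumes "infinite A" "\<And>v. finite {x \<in> A. f x = v}"
  shows "infinite (f ` A)"
proof
  assume "finite (f ` A)"
  then have "finite (\<Union>v\<in>f ` A. {x \<in> A. f x = v})" using assms(2) by blast
  moreover have "A \<subseteq> (\<Union>v\<in>f ` A. {x \<in> A. f x = v})" by auto
  ultimately show False using assms(1) finite_subset by blast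
qed

lemma finite_poly_fiber:
  fixes P :: "'k::idom poly"
  assumes "P \<noteq> 0" "A \<subseteq> {x. poly P x = 0}"
  shows "finite A"
  using assms poly_roots_finite finite_subset by blast

section \<open>The Jack families\<close>

lemma sum_Pow_card_le_1:
  fixes f :: "'a set \<Rightarrow> 'b::comm_ring_1"
  assumes "finite A"
  shows "(\<Sum>R\<in>Pow A. (if card R = 0 then - e else if card R = 1 then 1 else 0) * f R) =
    (\<Sum>k\<in>A. f {k}) - e * f {}"
proof -
  have "(\<Sum>R\<in>Pow A. (if card R = 0 then - e else if card R = 1 then 1 else 0) * f R)
      = (\<Sum>R\<in>insert {} ((\<lambda>k. {k}) ` A). (if card R = 0 then - e else if card R = 1 then 1 else 0) * f R)"
  proof (rule sum.mono_neutral_right)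
    show "\<forall>R\<in>Pow A - insert {} ((\<lambda>k. {k}) ` A).
        (if card R = 0 then - e else if card R = 1 then 1 else 0) * f R = 0"
    proof
      fix R assume R: "R \<in> Pow A - insert {} ((\<lambda>k. {k}) ` A)"
      then have "finite R" using assms finite_subset by auto
      then have "card R \<noteq> 0" "card R \<noteq> 1" using R by (auto simp: card_1_singleton_iff)
      then show "(if card R = 0 then - e else if card R = 1 then 1 else 0) * f R = 0" by simp
    qed
  qed (use assms in auto)
  also have "\<dots> = (\<Sum>k\<in>A. f {k}) - e * f {}"
    using assms by (subst sum.insert) (auto simp: sum.reindex inj_on_def)
  finally show ?thesis .
qed

lemma prod_one_factor:
  fixes f g :: "'a \<Rightarrow> 'b::comm_ring_1"
  assumes "finite A" "k \<in> A"
  shows "(\<Prod>i\<in>A. (if i \<in> {k} then g i else 1) * f i) = g k * prod f A"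
  using assms by (simp add: prod.distrib)

text \<open>
  The coordinate is \<open>\<kappa>\<^sub>0 x - \<sigma> x\<^sup>2\<close>: the family \<open>AJ\<close> has \<open>(\<sigma>, \<kappa>\<^sub>0, a) = (0, 1, 0)\<close>, and \<open>BJ\<close> has
  \<open>(\<sigma>, \<kappa>\<^sub>0, a) = (-1, 0, \<alpha>)\<close>.
\<close>

locale jack =
  fixes n :: nat and \<tau> a \<sigma> \<kappa>\<^sub>0 :: "'k::field_char_0"
  assumes \<tau>_generic: "\<And>m v. (m, v) \<noteq> (0, 0) \<Longrightarrow> of_nat m + of_nat v * \<tau> \<noteq> 0"
    and cases: "(\<sigma> = 0 \<and> \<kappa>\<^sub>0 = 1) \<or>
      (\<sigma> = - 1 \<and> \<kappa>\<^sub>0 = 0 \<and> (\<forall>u v. 2 * a + of_int u + of_nat v * \<tau> \<noteq> 0))"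
begin

definition pt :: "nat \<Rightarrow> nat \<Rightarrow> 'k" where
  "pt i m = of_nat m + of_nat (n - i) * \<tau> + a"

definition y :: "nat \<Rightarrow> 'k \<Rightarrow> 'k" where
  "y k x = (\<kappa>\<^sub>0 + of_nat k * \<sigma>) * x - \<sigma> * x\<^sup>2"

text \<open>All genericity of the parameter \<open>a\<close> enters here: the separation conditions
  reduce to this affine expression, usually after a difference of points is factored out.\<close>

lemma affine_neq_0: "\<kappa>\<^sub>0 + of_nat k * \<sigma> - \<sigma> * (2 * a + of_nat u + of_nat v * \<tau>) \<noteq> 0"
  using cases
proof
  assume \<sigma>: "\<sigma> = - 1 \<and> \<kappa>\<^sub>0 = 0 \<and> (\<forall>u v. 2 * a + of_int u + of_nat v * \<tau> \<noteq> 0)"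
  then have "2 * a + of_int (int u - int k) + of_nat v * \<tau> \<noteq> 0" by blast
  then show ?thesis using \<sigma> by (simp add: algebra_simps)
qed simp

lemma pt_neq:
  assumes "1 \<le> i" "i < j" "j \<le> n" "l \<le> m"
  shows "pt i m \<noteq> pt j l"
proof -
  have "pt i m - pt j l = of_nat (m - l) + of_nat (j - i) * \<tau>"
    using assms by (simp add: pt_def of_nat_diff algebra_simps)
  moreover have "of_nat (m - l) + of_nat (j - i) * \<tau> \<noteq> 0"
    using assms by (intro \<tau>_generic) auto
  ultimately show ?thesis by auto
qed

context
  fixes k :: nat
begin

text \<open>\<open>X\<close> and \<open>Y\<close> are the amounts by which \<open>y k x\<close> and
  \<open>y k (x - 1)\<close> fall short of \<open>y (Suc k) x\<close>. For nonzero \<sigma>, the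
  reflection that fixes \<open>y (Suc k)\<close> exchanges them.\<close>

definition X :: "'k \<Rightarrow> 'k" where "X x = \<sigma> * x"
definition Y :: "'k \<Rightarrow> 'k" where "Y x = \<kappa>\<^sub>0 + of_nat (Suc k) * \<sigma> - \<sigma> * x"
text \<open>Numerators of the unshifted branch, with \<open>u'\<close> obtained by exchanging
  \<open>X\<close> and \<open>Y\<close>. The constants are chosen so that \<open>u'\<close> vanishes
  at \<open>x = a\<close>, which is \<open>pt n 0\<close>: no box can be removed from an empty last
  row.\<close>

definition u :: "bool \<Rightarrow> 'k \<Rightarrow> 'k" where
  "u c x = (if c then a * X x - y (Suc k) x else \<sigma> * a - Y x)"
definition u' :: "bool \<Rightarrow> 'k \<Rightarrow> 'k" where
  "u' c x = (if c then a * Y x - y (Suc k) x else \<sigma> * a - X x)"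

lemma y_eq: "y k x = y (Suc k) x - X x" "y k (x - 1) = y (Suc k) x - Y x"
  by (simp_all add: y_def X_def Y_def power2_eq_square algebra_simps)

lemma y_Suc: "y (Suc k) x = x * Y x"
  by (simp add: y_def Y_def power2_eq_square algebra_simps)

interpretation conjugate_branches "{x. X x \<noteq> Y x}" X Y "y (Suc k)"
  "\<kappa>\<^sub>0 + of_nat (Suc k) * \<sigma>" 0 0 \<sigma>
  by unfold_locales (auto simp: X_def Y_def y_Suc mult_ac simp del: of_nat_Suc)

text \<open>A node factor leaves \<pi> alone and lowers \<rho> by \<tau> \<pi>; a factor
  \<open>y k\<close> lowers \<rho> by \<pi>. The leading coefficient is thus affine in the
  exponents.\<close>

lemma rep_power:
  assumes "rep 0 \<pi> \<rho> E E'"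
  shows "rep (j + b) \<pi> (\<rho> - (of_nat j * \<tau> + of_nat b) * \<pi>)
    (\<lambda>x. E x * ((y (Suc k) x + \<tau> * Y x) ^ j * y k x ^ b))
    (\<lambda>x. E' x * ((y (Suc k) x + \<tau> * X x) ^ j * y k (x - 1) ^ b))"
proof (induction b)
  case 0
  show ?case
  proof (induction j)
    case 0
    then show ?case using assms by simp
  next
    case (Suc j)
    have "rep (Suc (j + 0)) (1 * \<pi>) (1 * (\<rho> - (of_nat j * \<tau> + of_nat 0) * \<pi>) +
        - \<tau> * (\<pi> + 0 * (\<rho> - (of_nat j * \<tau> + of_nat 0) * \<pi>)))
      (\<lambda>x. E x * ((y (Suc k) x + \<tau> * Y x) ^ j * y k x ^ 0) * (y (Suc k) x + \<tau> * Y x))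
      (\<lambda>x. E' x * ((y (Suc k) x + \<tau> * X x) ^ j * y k (x - 1) ^ 0) * (y (Suc k) x + \<tau> * X x))"
      by (rule rep_mult[OF Suc, of _ _ "\<tau> * (\<kappa>\<^sub>0 + of_nat (Suc k) * \<sigma>)"])
        (simp_all add: X_def Y_def algebra_simps)
    then show ?case
    proof (rule rep_cong)
      show "1 * (\<rho> - (of_nat j * \<tau> + of_nat 0) * \<pi>) + - \<tau> * (\<pi> + 0 * (\<rho> - (of_nat j * \<tau> + of_nat 0) * \<pi>))
        = \<rho> - (of_nat (Suc j) * \<tau> + of_nat 0) * \<pi>" by (simp add: algebra_simps)
    qed (simp_all add: mult_ac)
  qed
next
  case (Suc b)
  have "rep (Suc (j + b)) (1 * \<pi>) (1 * (\<rho> - (of_nat j * \<tau> + of_nat b) * \<pi>) +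
      - 1 * (\<pi> + 0 * (\<rho> - (of_nat j * \<tau> + of_nat b) * \<pi>)))
    (\<lambda>x. E x * ((y (Suc k) x + \<tau> * Y x) ^ j * y k x ^ b) * y k x)
    (\<lambda>x. E' x * ((y (Suc k) x + \<tau> * X x) ^ j * y k (x - 1) ^ b) * y k (x - 1))"
    by (rule rep_mult[OF Suc, of _ _ 0]) (subst y_eq(1), simp, subst y_eq(2), simp)
  then show ?case
  proof (rule rep_cong)
    show "1 * (\<rho> - (of_nat j * \<tau> + of_nat b) * \<pi>) + - 1 * (\<pi> + 0 * (\<rho> - (of_nat j * \<tau> + of_nat b) * \<pi>))
      = \<rho> - (of_nat j * \<tau> + of_nat (Suc b)) * \<pi>" by (simp add: algebra_simps)
  qed (simp_all add: mult_ac)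
qed

lemma rep_u: "rep 0 (if c then - 1 else 0) (if c then a else 1) (u c) (u' c)"
proof (cases c)
  case True
  then show ?thesis by (intro rep_0[of _ 0]) (auto simp: u_def u'_def)
next
  case False
  then show ?thesis
    by (intro rep_0[of _ "\<sigma> * a - (\<kappa>\<^sub>0 + of_nat (Suc k) * \<sigma>)"]) (auto simp: u_def u'_def X_def Y_def)
qed

lemma row:
  "\<exists>Q. degree Q \<le> j + b \<and> coeff Q (j + b) = (if c then a + of_nat j * \<tau> + of_nat b else 1) \<and>
    (\<forall>x\<in>{x. X x \<noteq> Y x}. u c x / (X x - Y x) * ((y (Suc k) x + \<tau> * Y x) ^ j * y k x ^ b)
      + - (u' c x / (X x - Y x)) * ((y (Suc k) x + \<tau> * X x) ^ j * y k (x - 1) ^ b) = poly Q (y (Suc k) x))"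
proof -
  have "rep (j + b) (if c then - 1 else 0) (if c then a + of_nat j * \<tau> + of_nat b else 1)
    (\<lambda>x. u c x * ((y (Suc k) x + \<tau> * Y x) ^ j * y k x ^ b))
    (\<lambda>x. u' c x * ((y (Suc k) x + \<tau> * X x) ^ j * y k (x - 1) ^ b))"
    by (rule rep_cong[OF rep_power[OF rep_u]]) auto
  from rep_row[OF this] show ?thesis by (simp add: diff_divide_distrib)
qed

lemma infinite_level: "infinite (y (Suc k) ` {x. X x \<noteq> Y x})"
proof -
  have ne: "\<kappa>\<^sub>0 + of_nat (Suc k) * \<sigma> \<noteq> 0 \<or> \<sigma> \<noteq> 0" using cases by auto
  have "finite (- {x. X x \<noteq> Y x})"
  proof (rule finite_poly_fiber)
    show "[:- (\<kappa>\<^sub>0 + of_nat (Suc k) * \<sigma>), 2 * \<sigma>:] \<noteq> 0" using ne by auto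
  qed (auto simp: X_def Y_def algebra_simps)
  then have "infinite {x. X x \<noteq> Y x}"
    using infinite_UNIV_char_0 by (metis finite_compl)
  then show ?thesis
  proof (rule infinite_image_finite_fibers)
    fix v
    show "finite {x \<in> {x. X x \<noteq> Y x}. y (Suc k) x = v}"
    proof (rule finite_poly_fiber)
      show "[:- v, \<kappa>\<^sub>0 + of_nat (Suc k) * \<sigma>, - \<sigma>:] \<noteq> 0" using ne by auto
    qed (auto simp: y_def power2_eq_square algebra_simps)
  qed
qed

lemma XY_pt: "X (pt i m) \<noteq> Y (pt i m)"
proof -
  have "Y (pt i m) - X (pt i m) =
      \<kappa>\<^sub>0 + of_nat (Suc k) * \<sigma> - \<sigma> * (2 * a + of_nat (2 * m) + of_nat (2 * (n - i)) * \<tau>)"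
    unfolding X_def Y_def pt_def of_nat_mult by (simp add: algebra_simps)
  then show ?thesis using affine_neq_0 by (metis eq_iff_diff_eq_0)
qed

lemma u_pt: "u False (pt i m) \<noteq> 0"
proof -
  have "- u False (pt i m) = \<kappa>\<^sub>0 + of_nat (Suc k) * \<sigma> - \<sigma> * (2 * a + of_nat m + of_nat (n - i) * \<tau>)"
    unfolding u_def Y_def pt_def by (simp add: algebra_simps)
  then show ?thesis using affine_neq_0 by (metis neg_equal_0_iff_equal)
qed

text \<open>The operators are the one with \<open>R\<close> empty and the sum of those with
  \<open>R\<close> a singleton; the weight of the former is minus the scalar by which the latter
  acts on the leading part.\<close>

lemma lowering:
  assumes "n \<ge> 1"
  shows "lowering_step n d (y k) (y (Suc k)) (\<lambda>x. x - 1)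
    (\<lambda>c x. u c x / (X x - Y x)) (\<lambda>c x. - (u' c x / (X x - Y x)))
    (\<lambda>x. y (Suc k) x + \<tau> * Y x) (\<lambda>x. y (Suc k) x + \<tau> * X x)
    (\<lambda>c j b. if c then a + of_nat j * \<tau> + of_nat b else 1) {x. X x \<noteq> Y x} pt
    (\<lambda>m. if m = 0 then - (of_nat n * a + of_nat (card (pairs n)) * \<tau> + of_nat (Suc d))
         else if m = 1 then 1 else 0)"
proof
  fix j b :: "nat \<Rightarrow> nat"
  assume j: "sum j {1..n} = card (pairs n)" and b: "sum b {1..n} = Suc d"
  \<comment> \<open>The coefficients are affine, so their sum sees only the totals of the exponents;
    this is the scalar in the weight.\<close>
  have "(\<Sum>i\<in>{1..n}. a + of_nat (j i) * \<tau> + of_nat (b i)) =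
      of_nat n * a + of_nat (card (pairs n)) * \<tau> + of_nat (Suc d)"
    by (simp add: sum.distrib j[symmetric] b[symmetric] sum_distrib_right)
  moreover have "(\<Prod>i\<in>{1..n}. if i \<in> {l} then a + of_nat (j i) * \<tau> + of_nat (b i) else 1)
      = a + of_nat (j l) * \<tau> + of_nat (b l)" if "l \<in> {1..n}" for l
    using prod_one_factor[of "{1..n}" l "\<lambda>i. a + of_nat (j i) * \<tau> + of_nat (b i)" "\<lambda>_. 1"] that by simp
  ultimately show "(\<Sum>R\<in>Pow {1..n}. (if card R = 0 then - (of_nat n * a + of_nat (card (pairs n)) * \<tau> + of_nat (Suc d))
         else if card R = 1 then 1 else 0) *
      (\<Prod>i\<in>{1..n}. if i \<in> R then a + of_nat (j i) * \<tau> + of_nat (b i) else 1)) = 0"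
    by (subst sum_Pow_card_le_1) simp_all
next
  fix \<kappa> assume \<kappa>: "\<kappa> \<in> partitions n" "Suc d < psize n \<kappa>"
  let ?\<alpha> = "\<lambda>c i. u c (pt i (\<kappa> i)) / (X (pt i (\<kappa> i)) - Y (pt i (\<kappa> i)))"
  define P where "P = (\<Prod>i\<in>{1..n}. ?\<alpha> False i)"
  \<comment> \<open>Since \<open>y (Suc k) x = x * Y x\<close>, the numerators differ by the factor
    \<open>x\<close>, and the diagonal becomes a sum of coordinates.\<close>
  have "?\<alpha> True i = pt i (\<kappa> i) * ?\<alpha> False i" for i
    by (simp add: u_def y_Suc X_def algebra_simps)
  then have 1: "(\<Prod>i\<in>{1..n}. ?\<alpha> (i \<in> {l}) i) = pt l (\<kappa> l) * P" if "l \<in> {1..n}" for l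
    unfolding P_def by (subst prod_one_factor[symmetric, OF _ that]) (auto intro!: prod.cong)
  have 2: "(\<Sum>i\<in>{1..n}. pt i (\<kappa> i)) = of_nat n * a + of_nat (card (pairs n)) * \<tau> + of_nat (psize n \<kappa>)"
    unfolding pt_def card_pairs psize_def by (simp add: sum.distrib sum_distrib_right)
  have "P \<noteq> 0" unfolding P_def using u_pt XY_pt by simp
  have "(\<Sum>R\<in>Pow {1..n}. (if card R = 0 then - (of_nat n * a + of_nat (card (pairs n)) * \<tau> + of_nat (Suc d))
         else if card R = 1 then 1 else 0) * (\<Prod>i\<in>{1..n}. ?\<alpha> (i \<in> R) i))
     = (\<Sum>l\<in>{1..n}. pt l (\<kappa> l) * P) - (of_nat n * a + of_nat (card (pairs n)) * \<tau> + of_nat (Suc d)) * P"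
    by (subst sum_Pow_card_le_1) (simp_all only: 1 finite_atLeastAtMost P_def empty_iff cong: sum.cong)
  also have "\<dots> = (of_nat (psize n \<kappa>) - of_nat (Suc d)) * P"
    unfolding sum_distrib_right[symmetric] 2 by (simp add: algebra_simps)
  also have "\<dots> \<noteq> 0"
    using \<open>P \<noteq> 0\<close> \<kappa>(2) by (metis less_irrefl mult_eq_0_iff of_nat_eq_iff right_minus_eq)
  finally show "(\<Sum>R\<in>Pow {1..n}. (if card R = 0 then - (of_nat n * a + of_nat (card (pairs n)) * \<tau> + of_nat (Suc d))
         else if card R = 1 then 1 else 0) * (\<Prod>i\<in>{1..n}. ?\<alpha> (i \<in> R) i)) \<noteq> 0" .
next
  show "infinite (y (Suc k) ` {x. X x \<noteq> Y x})" by (rule infinite_level)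
  show "pt i m \<in> {x. X x \<noteq> Y x}" for i m using XY_pt by simp
  show "pt i (Suc m) - 1 = pt i m" for i m by (simp add: pt_def)
next
  fix i m assume "i \<in> {1..n}" "i < n"
  then have "n - i = Suc (n - Suc i)" by auto
  \<comment> \<open>The nodes are built for this shift: equal rows in adjacent positions differ by
    \<tau>, and the shifted node of one is the unshifted node of the next.\<close>
  then have "pt i m = pt (Suc i) m + \<tau>" by (simp add: pt_def algebra_simps)
  then show "y (Suc k) (pt i m) + \<tau> * X (pt i m) = y (Suc k) (pt (Suc i) m) + \<tau> * Y (pt (Suc i) m)"
    by (simp add: y_def X_def Y_def power2_eq_square algebra_simps)
next
  show "- (u' c (pt n 0) / (X (pt n 0) - Y (pt n 0))) = 0" for c
    by (simp add: pt_def u'_def y_Suc X_def)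
next
  fix i j l m :: nat assume ij: "1 \<le> i" "i < j" "j \<le> n" "l \<le> m"
  let ?x = "pt i m" and ?z = "pt j l"
  have "y (Suc k) ?x - y (Suc k) ?z = (?x - ?z) *
      (\<kappa>\<^sub>0 + of_nat (Suc k) * \<sigma> - \<sigma> * (2 * a + of_nat (m + l) + of_nat ((n - i) + (n - j)) * \<tau>))"
    by (simp add: y_def pt_def power2_eq_square algebra_simps)
  then show "y (Suc k) ?x \<noteq> y (Suc k) ?z"
    using pt_neq[OF ij] affine_neq_0 by (metis eq_iff_diff_eq_0 mult_eq_0_iff)
  have "(y (Suc k) ?x + \<tau> * Y ?x) - (y (Suc k) ?z + \<tau> * Y ?z) = (?x - ?z) *
      (\<kappa>\<^sub>0 + of_nat (Suc k) * \<sigma> - \<sigma> * (2 * a + of_nat (m + l) + of_nat (Suc ((n - i) + (n - j))) * \<tau>))"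
    by (simp add: y_def Y_def pt_def power2_eq_square algebra_simps)
  then show "y (Suc k) ?x + \<tau> * Y ?x \<noteq> y (Suc k) ?z + \<tau> * Y ?z"
    using pt_neq[OF ij] affine_neq_0 by (metis eq_iff_diff_eq_0 mult_eq_0_iff)
qed (use row in simp)

end

theorem vanishing: "n \<ge> 1 \<Longrightarrow> vanishing n pt (y k) d"
proof (induction d arbitrary: k)
  case 0
  show ?case by (rule vanishing_0)
next
  case (Suc d)
  show ?case
    by (rule lowering_step.vanishing_Suc[OF lowering[where k = k and d = d]]) (use Suc in auto)
qed

end

section \<open>The Macdonald families\<close>

lemma sum_Pow_card_extreme:
  fixes f :: "'a set \<Rightarrow> 'b::comm_ring_1"
  assumes "finite A" "A \<noteq> {}"
  shows "(\<Sum>R\<in>Pow A. (if card R = card A then 1 else if card R = 0 then - e else 0) * f R) =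
    f A - e * f {}"
proof -
  have "(\<Sum>R\<in>Pow A. (if card R = card A then 1 else if card R = 0 then - e else 0) * f R)
      = (\<Sum>R\<in>{{}, A}. (if card R = card A then 1 else if card R = 0 then - e else 0) * f R)"
  proof (rule sum.mono_neutral_right)
    show "\<forall>R\<in>Pow A - {{}, A}. (if card R = card A then 1 else if card R = 0 then - e else 0) * f R = 0"
    proof
      fix R assume R: "R \<in> Pow A - {{}, A}"
      then have "finite R" using assms finite_subset by auto
      moreover have "R \<subset> A" "R \<noteq> {}" using R by auto
      ultimately have "card R \<noteq> 0" "card R \<noteq> card A"
        using psubset_card_mono[OF assms(1)] by (auto simp: less_le)
      then show "(if card R = card A then 1 else if card R = 0 then - e else 0) * f R = 0" by simp
    qed
  qed (use assms in auto)
  also have "\<dots> = f A - e * f {}"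
    using assms by (subst sum.insert) auto
  finally show ?thesis .
qed

text \<open>
  The coordinate is \<open>x + s / x\<close>: the family \<open>AM\<close> has \<open>(a, s) = (1, 0)\<close>, and \<open>BM\<close> has \<open>s = 1\<close>.
\<close>

locale macdonald =
  fixes n :: nat and q t a s :: "'k::field_char_0"
  assumes neq_0: "q \<noteq> 0" "t \<noteq> 0" "a \<noteq> 0"
    and qt_generic: "\<And>m v. (m, v) \<noteq> (0, 0) \<Longrightarrow> q ^ m * t ^ v \<noteq> 1"
    and a_generic: "\<And>m v k. a\<^sup>2 * q ^ m * t ^ v \<noteq> s * q ^ k"
begin

definition pt :: "nat \<Rightarrow> nat \<Rightarrow> 'k" where
  "pt i m = a * q ^ m * t ^ (n - i)"

definition y :: "nat \<Rightarrow> 'k \<Rightarrow> 'k" where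
  "y k x = x + s * q ^ k / x"

lemma pt_neq_0: "pt i m \<noteq> 0"
  using neq_0 by (simp add: pt_def)

lemma pt_neq:
  assumes "1 \<le> i" "i < j" "j \<le> n" "l \<le> m"
  shows "pt i m \<noteq> pt j l"
proof -
  have "m = l + (m - l)" "n - i = (n - j) + (j - i)" using assms by auto
  then have "q ^ m = q ^ l * q ^ (m - l)" "t ^ (n - i) = t ^ (n - j) * t ^ (j - i)"
    by (metis power_add)+
  then have "pt i m = pt j l * (q ^ (m - l) * t ^ (j - i))"
    by (simp add: pt_def)
  moreover have "q ^ (m - l) * t ^ (j - i) \<noteq> 1"
    using assms by (intro qt_generic) auto
  ultimately show ?thesis using pt_neq_0[of j l] by simp
qed

lemma pt_mult_neq: "pt i m * pt j l * t ^ v \<noteq> s * q ^ k"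
proof -
  have "pt i m * pt j l * t ^ v = a\<^sup>2 * q ^ (m + l) * t ^ (n - i + (n - j) + v)"
    by (simp add: pt_def power_add power2_eq_square mult_ac)
  then show ?thesis using a_generic by metis
qed

lemma a_pt_neq: "a * pt i m \<noteq> s * q ^ k"
  using a_generic[of m "n - i" k] by (simp add: pt_def power2_eq_square mult_ac)

context
  fixes k :: nat
begin

text \<open>The conjugate of \<open>x\<close> itself: the two are the roots of the quadratic
  polynomial with sum \<open>y (Suc k) x\<close> and product \<open>s * q ^ Suc k\<close>.\<close>

definition Y :: "'k \<Rightarrow> 'k" where "Y x = s * q ^ Suc k / x"
definition D :: "'k set" where "D = {x. x \<noteq> 0 \<and> x \<noteq> Y x}"
text \<open>As in the Jack case, \<open>u'\<close> arises by exchanging the conjugates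
  \<open>x\<close> and \<open>Y x\<close>, and is arranged to vanish at \<open>a\<close>, which is
  \<open>pt n 0\<close>.\<close>

definition u :: "bool \<Rightarrow> 'k \<Rightarrow> 'k" where
  "u c x = (if c then a - Y x else x - s * q ^ Suc k / a)"
definition u' :: "bool \<Rightarrow> 'k \<Rightarrow> 'k" where
  "u' c x = (if c then a - x else Y x - s * q ^ Suc k / a)"

lemma y_Suc: "y (Suc k) x = x + Y x"
  by (simp add: y_def Y_def)

lemma y_eq: "y k x = x + Y x / q" "y k (x / q) = x / q + Y x"
  using neq_0 by (simp_all add: y_def Y_def)

interpretation conjugate_branches D "\<lambda>x. x" Y "y (Suc k)" 0 1 "s * q ^ Suc k" 0
  by unfold_locales (auto simp: y_Suc D_def, simp add: Y_def)

text \<open>Two starting values suffice, and both are eigenvectors of the update in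
  \<open>rep_mult\<close>. With \<pi> = 0, a node factor multiplies \<rho> by \<open>t\<close> and a
  factor \<open>y k\<close> fixes it; with \<pi> = -\<rho>, a node factor fixes both and a factor
  \<open>y k\<close> divides both by \<open>q\<close>.\<close>

lemma rep_power:
  assumes "rep 0 \<pi> \<rho> E E'"
    and "(\<pi> = 0 \<and> \<rho> = 1 \<and> \<pi>' = 0 \<and> \<rho>' = t ^ j) \<or>
      (\<pi> = - 1 \<and> \<rho> = 1 \<and> \<pi>' = - ((1 / q) ^ b) \<and> \<rho>' = (1 / q) ^ b)"
  shows "rep (j + b) \<pi>' \<rho>'
      (\<lambda>x. E x * ((t * x + Y x) ^ j * y k x ^ b))
      (\<lambda>x. E' x * ((x + t * Y x) ^ j * y k (x / q) ^ b))"
  using assms(2)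
proof (induction b arbitrary: \<pi>' \<rho>')
  case 0
  then show ?case
  proof (induction j arbitrary: \<pi>' \<rho>')
    case 0
    then show ?case using assms(1) by auto
  next
    case (Suc j)
    define \<rho>'' where "\<rho>'' = (if \<pi> = 0 then t ^ j else 1)"
    have "rep (j + 0) \<pi> \<rho>''
      (\<lambda>x. E x * ((t * x + Y x) ^ j * y k x ^ 0))
      (\<lambda>x. E' x * ((x + t * Y x) ^ j * y k (x / q) ^ 0))"
      by (rule Suc.IH) (use Suc.prems in \<open>auto simp: \<rho>''_def\<close>)
    then have "rep (Suc (j + 0)) (1 * \<pi>) (1 * \<rho>'' + (t - 1) * (\<pi> + 1 * \<rho>''))
      (\<lambda>x. E x * ((t * x + Y x) ^ j * y k x ^ 0) * (t * x + Y x))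
      (\<lambda>x. E' x * ((x + t * Y x) ^ j * y k (x / q) ^ 0) * (x + t * Y x))"
      by (rule rep_mult[of _ _ _ _ _ _ _ 0]) (simp_all add: y_Suc algebra_simps)
    then show ?case
    proof (rule rep_cong)
      show "1 * \<pi> = \<pi>'" using Suc.prems by auto
      show "1 * \<rho>'' + (t - 1) * (\<pi> + 1 * \<rho>'') = \<rho>'"
        using Suc.prems by (auto simp: \<rho>''_def algebra_simps)
    qed (simp_all add: mult_ac)
  qed
next
  case (Suc b)
  define \<pi>'' \<rho>'' where "\<pi>'' = (if \<pi> = 0 then 0 else - ((1 / q) ^ b))"
    and "\<rho>'' = (if \<pi> = 0 then t ^ j else (1 / q) ^ b)"
  have "rep (j + b) \<pi>'' \<rho>''
      (\<lambda>x. E x * ((t * x + Y x) ^ j * y k x ^ b))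
      (\<lambda>x. E' x * ((x + t * Y x) ^ j * y k (x / q) ^ b))"
    by (rule Suc.IH) (use Suc.prems in \<open>auto simp: \<pi>''_def \<rho>''_def\<close>)
  then have "rep (Suc (j + b)) (1 / q * \<pi>'') (1 / q * \<rho>'' + (1 - 1 / q) * (\<pi>'' + 1 * \<rho>''))
      (\<lambda>x. E x * ((t * x + Y x) ^ j * y k x ^ b) * y k x)
      (\<lambda>x. E' x * ((x + t * Y x) ^ j * y k (x / q) ^ b) * y k (x / q))"
    by (rule rep_mult[of _ _ _ _ _ _ _ 0]) (subst y_eq(1), simp add: y_Suc algebra_simps add_divide_distrib,
        subst y_eq(2), simp add: y_Suc algebra_simps add_divide_distrib)
  then show ?case
  proof (rule rep_cong)
    show "1 / q * \<pi>'' = \<pi>'" using Suc.prems by (auto simp: \<pi>''_def)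
    show "1 / q * \<rho>'' + (1 - 1 / q) * (\<pi>'' + 1 * \<rho>'') = \<rho>'"
      using Suc.prems neq_0 by (auto simp: \<pi>''_def \<rho>''_def field_simps)
  qed (simp_all add: mult_ac)
qed

lemma rep_u: "rep 0 (if c then - 1 else 0) 1 (u c) (u' c)"
proof (cases c)
  case True
  then show ?thesis by (intro rep_0[of _ a]) (auto simp: u_def u'_def y_Suc)
next
  case False
  then show ?thesis
    by (intro rep_0[of _ "- (s * q ^ Suc k / a)"]) (auto simp: u_def u'_def)
qed

lemma row:
  "\<exists>Q. degree Q \<le> j + b \<and> coeff Q (j + b) = (if c then (1 / q) ^ b else t ^ j) \<and>
    (\<forall>x\<in>D. u c x / (x - Y x) * ((t * x + Y x) ^ j * y k x ^ b)
      + - (u' c x / (x - Y x)) * ((x + t * Y x) ^ j * y k (x / q) ^ b) = poly Q (y (Suc k) x))"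
  using rep_row[OF rep_power[OF rep_u[of c], where j = j and b = b and
      \<pi>' = "if c then - ((1 / q) ^ b) else 0" and \<rho>' = "if c then (1 / q) ^ b else t ^ j"]]
  by (simp add: diff_divide_distrib)

lemma infinite_level: "infinite (y (Suc k) ` D)"
proof -
  have "finite (- D)"
  proof (rule finite_poly_fiber)
    \<comment> \<open>The cubic x (x^2 - s q^(k+1)) covers both exclusions in \<open>D\<close> at
      once.\<close>
    show "[:0, - (s * q ^ Suc k), 0, 1:] \<noteq> 0" by simp
    show "- D \<subseteq> {x. poly [:0, - (s * q ^ Suc k), 0, 1:] x = 0}"
    proof
      fix x assume "x \<in> - D"
      then have "x = 0 \<or> (x \<noteq> 0 \<and> x = s * q ^ Suc k / x)" by (auto simp: D_def Y_def)
      then have "x = 0 \<or> x * x = s * q ^ Suc k" by (metis nonzero_eq_divide_eq)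
      then show "x \<in> {x. poly [:0, - (s * q ^ Suc k), 0, 1:] x = 0}" by auto
    qed
  qed
  then have "infinite D"
    using infinite_UNIV_char_0 by (metis finite_compl)
  then show ?thesis
  proof (rule infinite_image_finite_fibers)
    fix v
    show "finite {x \<in> D. y (Suc k) x = v}"
    proof (rule finite_poly_fiber)
      show "[:s * q ^ Suc k, - v, 1:] \<noteq> 0" by simp
      show "{x \<in> D. y (Suc k) x = v} \<subseteq> {x. poly [:s * q ^ Suc k, - v, 1:] x = 0}"
        by (auto simp: D_def y_def field_simps)
    qed
  qed
qed

lemma pt_D: "pt i m \<in> D"
  using pt_mult_neq[of i m i m 0 "Suc k"] pt_neq_0 by (auto simp: D_def Y_def eq_divide_eq)

lemma u_pt: "u False (pt i m) \<noteq> 0"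
  using a_pt_neq[of i m "Suc k"] neq_0 by (auto simp: u_def eq_divide_eq mult_ac)

text \<open>Here the operators are those with the same boolean in every variable, with leading
  scalars q^(-\<open>Suc d\<close>) and t^\<open>card (pairs n)\<close>; \<open>e\<close> is their
  ratio.\<close>

lemma lowering:
  fixes d :: nat
  assumes "n \<ge> 1"
  defines "e \<equiv> (1 / q) ^ Suc d / t ^ card (pairs n)"
  shows "lowering_step n d (y k) (y (Suc k)) (\<lambda>x. x / q)
    (\<lambda>c x. u c x / (x - Y x)) (\<lambda>c x. - (u' c x / (x - Y x)))
    (\<lambda>x. t * x + Y x) (\<lambda>x. x + t * Y x)
    (\<lambda>c j b. if c then (1 / q) ^ b else t ^ j) D pt
    (\<lambda>m. if m = n then 1 else if m = 0 then - e else 0)"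
proof
  have Pow: "(\<Sum>R\<in>Pow {1..n}. (if card R = n then 1 else if card R = 0 then - e else 0) * f R) =
      f {1..n} - e * f {}" for f :: "nat set \<Rightarrow> 'k"
    using sum_Pow_card_extreme[of "{1..n}" e f] assms(1) by simp
  show "(\<Sum>R\<in>Pow {1..n}. (if card R = n then 1 else if card R = 0 then - e else 0) *
      (\<Prod>i\<in>{1..n}. if i \<in> R then (1 / q) ^ b i else t ^ j i)) = 0"
    if j: "sum j {1..n} = card (pairs n)" and b: "sum b {1..n} = Suc d" for j b
  proof -
    have "(\<Prod>i\<in>{1..n}. t ^ j i) = t ^ card (pairs n)" "(\<Prod>i\<in>{1..n}. (1 / q) ^ b i) = (1 / q) ^ Suc d"
      by (simp_all only: power_sum[symmetric] j b)
    then show ?thesis unfolding Pow using neq_0 by (simp add: e_def)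
  qed
  show "(\<Sum>R\<in>Pow {1..n}. (if card R = n then 1 else if card R = 0 then - e else 0) *
      (\<Prod>i\<in>{1..n}. u (i \<in> R) (pt i (\<kappa> i)) / (pt i (\<kappa> i) - Y (pt i (\<kappa> i))))) \<noteq> 0"
    if \<kappa>: "\<kappa> \<in> partitions n" "Suc d < psize n \<kappa>" for \<kappa>
  proof -
    let ?\<alpha> = "\<lambda>c i. u c (pt i (\<kappa> i)) / (pt i (\<kappa> i) - Y (pt i (\<kappa> i)))"
    define P where "P = (\<Prod>i\<in>{1..n}. ?\<alpha> False i)"
    \<comment> \<open>On the diagonal the ratio of the two operators is the product of all a/x, that
      is, \<open>e\<close> with \<open>Suc d\<close> replaced by the size of \<kappa>.\<close>
    have "u True x = a / x * u False x" if "x \<noteq> 0" for x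
      using that neq_0 by (simp add: u_def Y_def field_simps)
    then have "?\<alpha> True i = a / pt i (\<kappa> i) * ?\<alpha> False i" for i
      using pt_neq_0 by simp
    then have "(\<Prod>i\<in>{1..n}. ?\<alpha> True i) = (\<Prod>i\<in>{1..n}. a / pt i (\<kappa> i)) * P"
      unfolding P_def by (simp only: prod.distrib)
    also have "(\<Prod>i\<in>{1..n}. a / pt i (\<kappa> i)) = (\<Prod>i\<in>{1..n}. (1 / q) ^ \<kappa> i * (1 / t) ^ (n - i))"
      using neq_0 by (intro prod.cong refl) (simp add: pt_def power_divide)
    also have "\<dots> = (1 / q) ^ psize n \<kappa> / t ^ card (pairs n)"
      unfolding psize_def card_pairs power_sum prod.distrib by (simp add: power_divide prod_dividef)
    finally have 1: "(\<Prod>i\<in>{1..n}. ?\<alpha> True i) = (1 / q) ^ psize n \<kappa> / t ^ card (pairs n) * P" .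
    have "P \<noteq> 0" unfolding P_def using u_pt pt_D by (simp add: D_def)
    have "q ^ psize n \<kappa> \<noteq> q ^ Suc d"
    proof
      assume "q ^ psize n \<kappa> = q ^ Suc d"
      moreover have "q ^ psize n \<kappa> = q ^ Suc d * q ^ (psize n \<kappa> - Suc d)"
        using \<kappa>(2) by (simp only: power_add[symmetric]) simp
      ultimately have "q ^ (psize n \<kappa> - Suc d) = 1" using neq_0 by simp
      then show False using qt_generic[of "psize n \<kappa> - Suc d" 0] \<kappa>(2) by simp
    qed
    then have "(1 / q) ^ psize n \<kappa> / t ^ card (pairs n) \<noteq> e"
      using neq_0 by (simp add: e_def power_one_over)
    then have "((1 / q) ^ psize n \<kappa> / t ^ card (pairs n) - e) * P \<noteq> 0"
      using \<open>P \<noteq> 0\<close> by simp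
    then have "(1 / q) ^ psize n \<kappa> / t ^ card (pairs n) * P - e * P \<noteq> 0"
      by (simp only: left_diff_distrib not_False_eq_True)
    moreover have "(\<Prod>i\<in>{1..n}. ?\<alpha> (i \<in> {1..n}) i) = (1 / q) ^ psize n \<kappa> / t ^ card (pairs n) * P"
      unfolding 1[symmetric] by (intro prod.cong refl) simp
    moreover have "(\<Prod>i\<in>{1..n}. ?\<alpha> (i \<in> {}) i) = P"
      by (simp add: P_def)
    ultimately show ?thesis unfolding Pow by (simp only: not_False_eq_True)
  qed
  show "infinite (y (Suc k) ` D)" by (rule infinite_level)
  show "pt i m \<in> D" for i m by (rule pt_D)
  show "pt i (Suc m) / q = pt i m" for i m using neq_0 by (simp add: pt_def)
  show "pt i m + t * Y (pt i m) = t * pt (Suc i) m + Y (pt (Suc i) m)" if "i \<in> {1..n}" "i < n" for i m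
  proof -
    have "n - i = Suc (n - Suc i)" using that by auto
    then have "pt i m = t * pt (Suc i) m" by (simp add: pt_def)
    then show ?thesis using neq_0 by (simp add: Y_def)
  qed
  show "- (u' c (pt n 0) / (pt n 0 - Y (pt n 0))) = 0" for c
    by (simp add: pt_def u'_def Y_def)
  fix i j l m :: nat assume ij: "1 \<le> i" "i < j" "j \<le> n" "l \<le> m"
  let ?x = "pt i m" and ?z = "pt j l"
  have "y (Suc k) ?x - y (Suc k) ?z = (?x - ?z) * (?x * ?z - s * q ^ Suc k) / (?x * ?z)"
    using pt_neq_0 by (simp add: y_def field_simps)
  then show "y (Suc k) ?x \<noteq> y (Suc k) ?z"
    using pt_neq[OF ij] pt_mult_neq[of i m j l 0 "Suc k"] pt_neq_0 by auto
  have "(t * ?x + Y ?x) - (t * ?z + Y ?z) = (?x - ?z) * (?x * ?z * t ^ 1 - s * q ^ Suc k) / (?x * ?z)"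
    using pt_neq_0 by (simp add: Y_def field_simps)
  then show "t * ?x + Y ?x \<noteq> t * ?z + Y ?z"
    using pt_neq[OF ij] pt_mult_neq[of i m j l 1 "Suc k"] pt_neq_0 by auto
qed (use row in simp)

end

theorem vanishing: "n \<ge> 1 \<Longrightarrow> vanishing n pt (y k) d"
proof (induction d arbitrary: k)
  case 0
  show ?case by (rule vanishing_0)
next
  case (Suc d)
  show ?case
    by (rule lowering_step.vanishing_Suc[OF lowering[where k = k and d = d]]) (use Suc in auto)
qed

end

section \<open>Evaluation and degree of Laurent polynomials\<close>

abbreviation "lookup \<equiv> Poly_Mapping.lookup"
abbreviation "keys \<equiv> Poly_Mapping.keys"
abbreviation "single \<equiv> Poly_Mapping.single"
abbreviation "map_key \<equiv> Poly_Mapping.map_key"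

definition meval :: "(nat \<Rightarrow>\<^sub>0 int) \<Rightarrow> (nat \<Rightarrow> 'k::field) \<Rightarrow> 'k" where
  "meval \<alpha> x = (\<Prod>i\<in>keys \<alpha>. x i powi lookup \<alpha> i)"

definition mdegree :: "(nat \<Rightarrow>\<^sub>0 int) \<Rightarrow> nat" where
  "mdegree \<alpha> = (\<Sum>i\<in>keys \<alpha>. nat \<bar>lookup \<alpha> i\<bar>)"

lemma meval_superset:
  assumes "finite A" "keys \<alpha> \<subseteq> A"
  shows "meval \<alpha> x = (\<Prod>i\<in>A. x i powi lookup \<alpha> i)"
  unfolding meval_def using assms
  by (intro prod.mono_neutral_left) (auto simp: in_keys_iff)

lemma mdegree_superset:
  assumes "finite A" "keys \<alpha> \<subseteq> A"
  shows "mdegree \<alpha> = (\<Sum>i\<in>A. nat \<bar>lookup \<alpha> i\<bar>)"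
  unfolding mdegree_def using assms
  by (intro sum.mono_neutral_left) (auto simp: in_keys_iff)

lemma mdegree_add: "mdegree (\<alpha> + \<beta>) \<le> mdegree \<alpha> + mdegree \<beta>"
proof -
  let ?A = "keys \<alpha> \<union> keys \<beta>"
  have "mdegree (\<alpha> + \<beta>) = (\<Sum>i\<in>?A. nat \<bar>lookup (\<alpha> + \<beta>) i\<bar>)"
    by (rule mdegree_superset) (auto dest: subsetD[OF keys_add])
  also have "\<dots> \<le> (\<Sum>i\<in>?A. nat \<bar>lookup \<alpha> i\<bar> + nat \<bar>lookup \<beta> i\<bar>)"
    by (intro sum_mono) (simp add: lookup_add nat_le_iff)
  also have "\<dots> = mdegree \<alpha> + mdegree \<beta>"
    by (simp add: sum.distrib mdegree_superset[of ?A])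
  finally show ?thesis .
qed

text \<open>At a zero coordinate a negative power evaluates to 0, so opposite exponents would cancel
  on the left only; the hypothesis excludes this.\<close>

lemma meval_add:
  assumes "\<And>i. x i \<noteq> 0 \<or> (0 \<le> lookup \<alpha> i \<and> 0 \<le> lookup \<beta> i)"
  shows "meval (\<alpha> + \<beta>) x = meval \<alpha> x * meval \<beta> x"
proof -
  let ?A = "keys \<alpha> \<union> keys \<beta>"
  have "meval (\<alpha> + \<beta>) x = (\<Prod>i\<in>?A. x i powi lookup (\<alpha> + \<beta>) i)"
    by (rule meval_superset) (auto dest: subsetD[OF keys_add])
  also have "\<dots> = (\<Prod>i\<in>?A. x i powi lookup \<alpha> i * x i powi lookup \<beta> i)"
  proof (rule prod.cong[OF refl])
    fix i
    show "x i powi lookup (\<alpha> + \<beta>) i = x i powi lookup \<alpha> i * x i powi lookup \<beta> i"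
    proof (cases "x i \<noteq> 0 \<or> lookup \<alpha> i + lookup \<beta> i \<noteq> 0")
      case True
      then show ?thesis by (simp add: lookup_add power_int_add)
    next
      case False
      then have "lookup \<alpha> i = 0 \<and> lookup \<beta> i = 0" using assms[of i] by auto
      then show ?thesis by (simp add: lookup_add)
    qed
  qed
  also have "\<dots> = meval \<alpha> x * meval \<beta> x"
    by (simp add: prod.distrib meval_superset[of ?A])
  finally show ?thesis .
qed

lemma lpoly_eval_superset:
  assumes "finite A" "keys f \<subseteq> A"
  shows "lpoly_eval f x = (\<Sum>\<alpha>\<in>A. lookup f \<alpha> * meval \<alpha> x)"
  unfolding lpoly_eval_def meval_def using assms
  by (intro sum.mono_neutral_left) (auto simp: in_keys_iff)

lemma lpoly_eval_0 [simp]: "lpoly_eval 0 x = 0"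
  by (simp add: lpoly_eval_def)

lemma lpoly_eval_add: "lpoly_eval (f + g) x = lpoly_eval f x + lpoly_eval g x"
proof -
  let ?A = "keys f \<union> keys g"
  have "keys (f + g) \<subseteq> ?A" by (rule keys_add)
  then show ?thesis
    by (simp add: lpoly_eval_superset[of ?A] lookup_add ring_distribs sum.distrib)
qed

lemma lpoly_eval_sum: "lpoly_eval (\<Sum>a\<in>A. f a) x = (\<Sum>a\<in>A. lpoly_eval (f a) x)"
  by (induction A rule: infinite_finite_induct) (auto simp: lpoly_eval_add)

lemma lpoly_eval_single: "lpoly_eval (single \<alpha> c) x = c * meval \<alpha> x"
  using lpoly_eval_superset[of "{\<alpha>}" "single \<alpha> c" x] by simp

lemma poly_mapping_sum_single:
  "f = (\<Sum>\<alpha>\<in>keys f. single \<alpha> (lookup f \<alpha>))"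
proof (rule poly_mapping_eqI)
  fix \<beta>
  show "lookup f \<beta> =
    lookup (\<Sum>\<alpha>\<in>keys f. single \<alpha> (lookup f \<alpha>)) \<beta>"
    by (simp add: lookup_sum lookup_single when_def in_keys_iff)
qed

text \<open>The condition is put on monomials so as to cover two situations: nonnegative exponents
  at any point, and arbitrary exponents at points without zero coordinates.\<close>

lemma lpoly_eval_mult:
  assumes "\<And>\<alpha> \<beta>. \<alpha> \<in> keys f \<Longrightarrow> \<beta> \<in> keys g \<Longrightarrow>
    meval (\<alpha> + \<beta>) x = meval \<alpha> x * meval \<beta> x"
  shows "lpoly_eval (f * g) x = lpoly_eval f x * lpoly_eval g x"
proof -
  let ?f = "\<lambda>\<alpha>. single \<alpha> (lookup f \<alpha>)"
  let ?g = "\<lambda>\<alpha>. single \<alpha> (lookup g \<alpha>)"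
  have "f * g = (\<Sum>\<alpha>\<in>keys f. \<Sum>\<beta>\<in>keys g. ?f \<alpha> * ?g \<beta>)"
    unfolding sum_product[symmetric] by (simp only: poly_mapping_sum_single[symmetric])
  then have "lpoly_eval (f * g) x = (\<Sum>\<alpha>\<in>keys f. \<Sum>\<beta>\<in>keys g.
      (lookup f \<alpha> * meval \<alpha> x) * (lookup g \<beta> * meval \<beta> x))"
    using assms by (simp add: lpoly_eval_sum mult_single lpoly_eval_single mult_ac)
  also have "\<dots> = lpoly_eval f x * lpoly_eval g x"
    unfolding sum_product[symmetric] by (simp add: lpoly_eval_def meval_def)
  finally show ?thesis .
qed

lemma lpoly_eval_Const: "lpoly_eval (Const c) x = c"
  by (simp add: Const_def lpoly_eval_single meval_def)

lemma keys_Const: "keys (Const c) \<subseteq> {0}"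
  by (simp add: Const_def)

lemma lpoly_eval_Const_mult: "lpoly_eval (Const c * f) x = c * lpoly_eval f x"
proof -
  have "lpoly_eval (Const c * f) x = lpoly_eval (Const c) x * lpoly_eval f x"
  proof (rule lpoly_eval_mult)
    fix \<alpha> \<beta> assume "\<alpha> \<in> keys (Const c)"
    then have "\<alpha> = 0" using keys_Const by blast
    then show "meval (\<alpha> + \<beta>) x = meval \<alpha> x * meval \<beta> x" by (simp add: meval_def)
  qed
  then show ?thesis by (simp add: lpoly_eval_Const)
qed

lemma ldegree_le_iff: "ldegree f \<le> d \<longleftrightarrow> (\<forall>\<alpha>\<in>keys f. mdegree \<alpha> \<le> d)"
  by (simp add: ldegree_def mdegree_def[abs_def])

lemma ldegree_add: "ldegree f \<le> d \<Longrightarrow> ldegree g \<le> d \<Longrightarrow> ldegree (f + g) \<le> d"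
  unfolding ldegree_le_iff using keys_add[of f g] by auto

lemma ldegree_mult: "ldegree f \<le> d \<Longrightarrow> ldegree g \<le> e \<Longrightarrow> ldegree (f * g) \<le> d + e"
  unfolding ldegree_le_iff
proof
  fix \<alpha>
  assume f: "\<forall>\<alpha>\<in>keys f. mdegree \<alpha> \<le> d" and g: "\<forall>\<alpha>\<in>keys g. mdegree \<alpha> \<le> e"
    and "\<alpha> \<in> keys (f * g)"
  then obtain \<beta> \<gamma> where "\<alpha> = \<beta> + \<gamma>" "\<beta> \<in> keys f" "\<gamma> \<in> keys g"
    using keys_mult[of f g] by auto
  then show "mdegree \<alpha> \<le> d + e"
    using f g mdegree_add[of \<beta> \<gamma>] by (metis add_mono order_trans)
qed

lemma ldegree_Const: "ldegree (Const c) = 0"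
proof -
  have "ldegree (Const c) \<le> 0"
    unfolding ldegree_le_iff using keys_Const[of c] by (auto simp: mdegree_def)
  then show ?thesis by simp
qed

lemma ldegree_Const_mult: "ldegree f \<le> d \<Longrightarrow> ldegree (Const c * f) \<le> d"
  using ldegree_mult[of "Const c" 0 f d] by (simp add: ldegree_Const)

lemma ldegree_0 [simp]: "ldegree 0 = 0"
  by (simp add: ldegree_def)

lemma ldegree_sum:
  "(\<And>a. a \<in> A \<Longrightarrow> ldegree (f a) \<le> d) \<Longrightarrow> ldegree (\<Sum>a\<in>A. f a) \<le> d"
  by (induction A rule: infinite_finite_induct) (auto intro: ldegree_add)

lemma ldegree_prod:
  assumes "finite A" "\<And>a. a \<in> A \<Longrightarrow> ldegree (f a) \<le> d a"
  shows "ldegree (\<Prod>a\<in>A. f a) \<le> sum d A"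
  using assms
proof (induction A rule: finite_induct)
  case empty
  then show ?case using ldegree_Const[of 1] by (simp add: Const_def)
qed (auto intro: ldegree_mult)

section \<open>Square linear systems\<close>

text \<open>Gaussian elimination: one unknown is eliminated with one equation, leaving a smaller
  system with the same surplus.\<close>

lemma homogeneous_system:
  fixes g :: "'a \<Rightarrow> 'b \<Rightarrow> 'k::field"
  assumes "finite S" "finite T" "card S < card T"
  shows "\<exists>c. (\<exists>a\<in>T. c a \<noteq> 0) \<and> (\<forall>s\<in>S. (\<Sum>a\<in>T. c a * g a s) = 0)"
  using assms
proof (induction S arbitrary: T g rule: finite_induct)
  case empty
  then have "T \<noteq> {}" by auto
  then show ?case by (intro exI[of _ "\<lambda>_. 1"]) auto
next
  case (insert s S)
  show ?case
  proof (cases "\<forall>a\<in>T. g a s = 0")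
    case True
    have "card S < card T" using insert by simp
    from insert.IH[OF insert.prems(1) this, of g] True show ?thesis by auto
  next
    case False
    then obtain a0 where a0: "a0 \<in> T" "g a0 s \<noteq> 0" by blast
    define g' where "g' = (\<lambda>a r. g a r - g a s / g a0 s * g a0 r)"
    have "card S < card (T - {a0})" using insert a0 by simp
    from insert.IH[OF _ this, of g'] insert.prems(1) obtain c where
      c: "\<exists>a\<in>T - {a0}. c a \<noteq> 0" "\<forall>r\<in>S. (\<Sum>a\<in>T - {a0}. c a * g' a r) = 0" by blast
    \<comment> \<open>The value of the eliminated unknown that solves the equation
      \<open>s\<close>.\<close>
    define z where "z = - (\<Sum>a\<in>T - {a0}. c a * (g a s / g a0 s))"
    have sum: "(\<Sum>a\<in>T. (c(a0 := z)) a * g a r) = (\<Sum>a\<in>T - {a0}. c a * g' a r)" for r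
    proof -
      have "(\<Sum>a\<in>T. (c(a0 := z)) a * g a r) = z * g a0 r + (\<Sum>a\<in>T - {a0}. c a * g a r)"
        using insert.prems(1) a0(1) by (subst sum.remove[of _ a0]) (auto intro!: sum.cong)
      also have "\<dots> = (\<Sum>a\<in>T - {a0}. c a * g' a r)"
        by (simp add: z_def g'_def sum_distrib_right sum_subtractf right_diff_distrib mult.assoc)
      finally show ?thesis .
    qed
    have "g' a s = 0" for a using a0 by (simp add: g'_def)
    then have "(\<Sum>a\<in>T. (c(a0 := z)) a * g a s) = 0" unfolding sum by simp
    moreover have "\<exists>a\<in>T. (c(a0 := z)) a \<noteq> 0" using c(1) by auto
    ultimately show ?thesis
      using c(2) sum by (intro exI[of _ "c(a0 := z)"]) auto
  qed
qed

text \<open>Adding \<open>v\<close> as one more column (\<open>None\<close>) forces a linear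
  dependency; by injectivity the new column takes part in it, so it can be solved for.\<close>

lemma square_system:
  fixes g :: "'a \<Rightarrow> 'a \<Rightarrow> 'k::field"
  assumes "finite S"
    and inj: "\<And>c. (\<forall>s\<in>S. (\<Sum>a\<in>S. c a * g a s) = 0) \<Longrightarrow> (\<forall>a\<in>S. c a = 0)"
  shows "\<exists>c. \<forall>s\<in>S. (\<Sum>a\<in>S. c a * g a s) = v s"
proof -
  let ?T = "insert None (Some ` S)"
  have "card S < card ?T" using assms(1) by (simp add: card_image)
  from homogeneous_system[OF assms(1) _ this, of "\<lambda>a s. case a of None \<Rightarrow> - v s | Some a \<Rightarrow> g a s"] assms(1)
  obtain c where c: "\<exists>a\<in>?T. c a \<noteq> 0"
    "\<forall>s\<in>S. (\<Sum>a\<in>?T. c a * (case a of None \<Rightarrow> - v s | Some a \<Rightarrow> g a s)) = 0" by auto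
  have *: "(\<Sum>a\<in>S. c (Some a) * g a s) = c None * v s" if "s \<in> S" for s
    using c(2)[rule_format, OF that] assms(1) by (simp add: sum.reindex)
  have "c None \<noteq> 0"
  proof
    assume "c None = 0"
    with inj[of "\<lambda>a. c (Some a)"] * have "\<forall>a\<in>S. c (Some a) = 0" by simp
    with c(1) \<open>c None = 0\<close> show False by auto
  qed
  show ?thesis
  proof (intro exI ballI)
    fix s assume "s \<in> S"
    have "(\<Sum>a\<in>S. c (Some a) / c None * g a s) = (\<Sum>a\<in>S. c (Some a) * g a s) / c None"
      by (simp add: sum_divide_distrib)
    then show "(\<Sum>a\<in>S. c (Some a) / c None * g a s) = v s"
      using *[OF \<open>s \<in> S\<close>] \<open>c None \<noteq> 0\<close> by simp
  qed
qed

section \<open>Row-finite matrices\<close>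

lemma finite_partitions_below: "finite {\<mu> \<in> partitions n. \<mu> \<le> \<kappa>}"
proof (rule finite_subset)
  show "{\<mu> \<in> partitions n. \<mu> \<le> \<kappa>} \<subseteq>
    {f. \<forall>i. (i \<in> {1..n} \<longrightarrow> f i \<in> {..Max (\<kappa> ` {1..n})}) \<and> (i \<notin> {1..n} \<longrightarrow> f i = 0)}"
    by (auto simp: partitions_def le_fun_def Max_ge_iff)
  show "finite {f. \<forall>i. (i \<in> {1..n} \<longrightarrow> f i \<in> {..Max (\<kappa> ` {1..n})}) \<and> (i \<notin> {1..n} \<longrightarrow> f i = (0::nat))}"
    by (rule finite_set_of_finite_funs) auto
qed

lemma finite_partitions_size: "finite {\<mu> \<in> partitions n. psize n \<mu> \<le> d}"
proof (rule finite_subset)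
  show "{\<mu> \<in> partitions n. psize n \<mu> \<le> d} \<subseteq> {\<mu> \<in> partitions n. \<mu> \<le> (\<lambda>_. d)}"
  proof
    fix \<mu> assume \<mu>: "\<mu> \<in> {\<mu> \<in> partitions n. psize n \<mu> \<le> d}"
    have "\<mu> i \<le> d" for i
    proof (cases "i \<in> {1..n}")
      case True
      then have "\<mu> i \<le> psize n \<mu>" unfolding psize_def by (intro member_le_sum) auto
      then show ?thesis using \<mu> by simp
    next
      case False
      then show ?thesis using \<mu> by (simp add: partitions_def)
    qed
    then show "\<mu> \<in> {\<mu> \<in> partitions n. \<mu> \<le> (\<lambda>_. d)}" using \<mu> by (simp add: le_fun_def)
  qed
qed (rule finite_partitions_below)

lemma psize_strict_mono:
  assumes "\<mu> \<le> \<kappa>" "\<mu> \<noteq> \<kappa>" "\<mu> \<in> partitions n" "\<kappa> \<in> partitions n"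
  shows "psize n \<mu> < psize n \<kappa>"
proof -
  obtain i where "\<mu> i \<noteq> \<kappa> i" using assms(2) by auto
  moreover have "\<mu> i = 0" "\<kappa> i = 0" if "i \<notin> {1..n}"
    using that assms(3,4) by (simp_all add: partitions_def)
  ultimately have "i \<in> {1..n}" by metis
  have "\<mu> i < \<kappa> i"
    using \<open>\<mu> i \<noteq> \<kappa> i\<close> assms(1) by (simp add: le_fun_def order_less_le)
  with \<open>i \<in> {1..n}\<close> have "\<exists>i\<in>{1..n}. \<mu> i < \<kappa> i" by blast
  then show ?thesis
    unfolding psize_def using assms(1) by (intro sum_strict_mono_ex1) (auto simp: le_fun_def)
qed

definition row_finite :: "'k::field pmatrix \<Rightarrow> bool" where
  "row_finite X \<longleftrightarrow> (\<forall>\<kappa>. finite {\<mu>. X \<kappa> \<mu> \<noteq> 0})"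

lemma pmat_mult_superset:
  assumes "finite A" "\<And>\<zeta>. X \<kappa> \<zeta> * Y \<zeta> \<mu> \<noteq> 0 \<Longrightarrow> \<zeta> \<in> A"
  shows "(X \<odot> Y) \<kappa> \<mu> = (\<Sum>\<zeta>\<in>A. X \<kappa> \<zeta> * Y \<zeta> \<mu>)"
  unfolding pmat_mult_def using assms by (intro Sum_any.expand_superset) auto

lemma row_finite_mult_support:
  "row_finite X \<Longrightarrow> {\<mu>. (X \<odot> Y) \<kappa> \<mu> \<noteq> 0} \<subseteq> (\<Union>\<zeta>\<in>{\<zeta>. X \<kappa> \<zeta> \<noteq> 0}. {\<mu>. Y \<zeta> \<mu> \<noteq> 0})"
proof
  fix \<mu> assume "row_finite X" and \<mu>: "\<mu> \<in> {\<mu>. (X \<odot> Y) \<kappa> \<mu> \<noteq> 0}"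
  then have "(X \<odot> Y) \<kappa> \<mu> = (\<Sum>\<zeta>\<in>{\<zeta>. X \<kappa> \<zeta> \<noteq> 0}. X \<kappa> \<zeta> * Y \<zeta> \<mu>)"
    by (intro pmat_mult_superset) (auto simp: row_finite_def)
  then obtain \<zeta> where "X \<kappa> \<zeta> * Y \<zeta> \<mu> \<noteq> 0" using \<mu> by (metis (mono_tags, lifting) mem_Collect_eq sum.neutral)
  then show "\<mu> \<in> (\<Union>\<zeta>\<in>{\<zeta>. X \<kappa> \<zeta> \<noteq> 0}. {\<mu>. Y \<zeta> \<mu> \<noteq> 0})" by auto
qed

lemma row_finite_mult: "row_finite X \<Longrightarrow> row_finite Y \<Longrightarrow> row_finite (X \<odot> Y)"
  unfolding row_finite_def
  using finite_subset[OF row_finite_mult_support[of X Y]] by (auto simp: row_finite_def)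

text \<open>Finite rows of the first two factors make all sums finite, so they can be interchanged;
  the third factor is arbitrary.\<close>

lemma pmat_mult_assoc:
  assumes "row_finite X" "row_finite Y"
  shows "(X \<odot> Y) \<odot> Z = X \<odot> (Y \<odot> Z)"
proof (intro ext)
  fix \<kappa> \<mu>
  define A where "A = {\<zeta>. X \<kappa> \<zeta> \<noteq> 0}"
  define B where "B = (\<Union>\<zeta>\<in>A. {\<xi>. Y \<zeta> \<xi> \<noteq> 0})"
  have A: "finite A" and B: "finite B" using assms by (auto simp: A_def B_def row_finite_def)
  have XY: "(X \<odot> Y) \<kappa> \<xi> = (\<Sum>\<zeta>\<in>A. X \<kappa> \<zeta> * Y \<zeta> \<xi>)" for \<xi>
    by (rule pmat_mult_superset[OF A]) (auto simp: A_def)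
  have YZ: "(Y \<odot> Z) \<zeta> \<mu> = (\<Sum>\<xi>\<in>B. Y \<zeta> \<xi> * Z \<xi> \<mu>)" if "\<zeta> \<in> A" for \<zeta>
    by (rule pmat_mult_superset[OF B]) (use that in \<open>auto simp: B_def\<close>)
  have "((X \<odot> Y) \<odot> Z) \<kappa> \<mu> = (\<Sum>\<xi>\<in>B. (X \<odot> Y) \<kappa> \<xi> * Z \<xi> \<mu>)"
  proof (rule pmat_mult_superset[OF B])
    fix \<xi> assume "(X \<odot> Y) \<kappa> \<xi> * Z \<xi> \<mu> \<noteq> 0"
    then show "\<xi> \<in> B" using row_finite_mult_support[OF assms(1), of Y \<kappa>] by (auto simp: A_def B_def)
  qed
  also have "\<dots> = (\<Sum>\<xi>\<in>B. \<Sum>\<zeta>\<in>A. X \<kappa> \<zeta> * Y \<zeta> \<xi> * Z \<xi> \<mu>)"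
    by (simp add: XY sum_distrib_right)
  also have "\<dots> = (\<Sum>\<zeta>\<in>A. \<Sum>\<xi>\<in>B. X \<kappa> \<zeta> * Y \<zeta> \<xi> * Z \<xi> \<mu>)"
    by (rule sum.swap)
  also have "\<dots> = (\<Sum>\<zeta>\<in>A. X \<kappa> \<zeta> * (Y \<odot> Z) \<zeta> \<mu>)"
    by (simp add: YZ sum_distrib_left mult.assoc)
  also have "\<dots> = (X \<odot> (Y \<odot> Z)) \<kappa> \<mu>"
    by (rule pmat_mult_superset[OF A, symmetric]) (auto simp: A_def)
  finally show "((X \<odot> Y) \<odot> Z) \<kappa> \<mu> = (X \<odot> (Y \<odot> Z)) \<kappa> \<mu>" .
qed

lemma pmat_mult_diff_right:
  assumes "row_finite X"
  shows "X \<odot> (\<lambda>\<kappa> \<mu>. Y \<kappa> \<mu> - Z \<kappa> \<mu>) = (\<lambda>\<kappa> \<mu>. (X \<odot> Y) \<kappa> \<mu> - (X \<odot> Z) \<kappa> \<mu>)"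
proof (intro ext)
  fix \<kappa> \<mu>
  have "(X \<odot> W) \<kappa> \<mu> = (\<Sum>\<zeta>\<in>{\<zeta>. X \<kappa> \<zeta> \<noteq> 0}. X \<kappa> \<zeta> * W \<zeta> \<mu>)" for W
    using assms by (intro pmat_mult_superset) (auto simp: row_finite_def)
  then show "(X \<odot> (\<lambda>\<kappa> \<mu>. Y \<kappa> \<mu> - Z \<kappa> \<mu>)) \<kappa> \<mu> = (X \<odot> Y) \<kappa> \<mu> - (X \<odot> Z) \<kappa> \<mu>"
    by (simp add: right_diff_distrib sum_subtractf)
qed

lemma pmat_mult_diff_left:
  assumes "row_finite X" "row_finite Y"
  shows "(\<lambda>\<kappa> \<mu>. X \<kappa> \<mu> - Y \<kappa> \<mu>) \<odot> Z = (\<lambda>\<kappa> \<mu>. (X \<odot> Z) \<kappa> \<mu> - (Y \<odot> Z) \<kappa> \<mu>)"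
proof (intro ext)
  fix \<kappa> \<mu>
  let ?A = "{\<zeta>. X \<kappa> \<zeta> \<noteq> 0} \<union> {\<zeta>. Y \<kappa> \<zeta> \<noteq> 0}"
  have A: "finite ?A" using assms by (auto simp: row_finite_def)
  have 1: "(X \<odot> Z) \<kappa> \<mu> = (\<Sum>\<zeta>\<in>?A. X \<kappa> \<zeta> * Z \<zeta> \<mu>)" by (rule pmat_mult_superset[OF A]) auto
  have 2: "(Y \<odot> Z) \<kappa> \<mu> = (\<Sum>\<zeta>\<in>?A. Y \<kappa> \<zeta> * Z \<zeta> \<mu>)" by (rule pmat_mult_superset[OF A]) auto
  have 3: "((\<lambda>\<kappa> \<mu>. X \<kappa> \<mu> - Y \<kappa> \<mu>) \<odot> Z) \<kappa> \<mu> = (\<Sum>\<zeta>\<in>?A. (X \<kappa> \<zeta> - Y \<kappa> \<zeta>) * Z \<zeta> \<mu>)"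
    by (rule pmat_mult_superset[OF A]) auto
  show "((\<lambda>\<kappa> \<mu>. X \<kappa> \<mu> - Y \<kappa> \<mu>) \<odot> Z) \<kappa> \<mu> = (X \<odot> Z) \<kappa> \<mu> - (Y \<odot> Z) \<kappa> \<mu>"
    unfolding 1 2 3 by (simp add: left_diff_distrib sum_subtractf)
qed

section \<open>Triangular matrices and their inverses\<close>

text \<open>Triangularity refers to containment, which is stronger than to a total order compatible
  with size: it makes rows finite and confines products to intervals of partitions.\<close>

definition triangular :: "nat \<Rightarrow> 'k::field pmatrix \<Rightarrow> bool" where
  "triangular n X \<longleftrightarrow> (\<forall>\<kappa> \<mu>. X \<kappa> \<mu> \<noteq> 0 \<longrightarrow> \<kappa> \<in> partitions n \<and> \<mu> \<in> partitions n \<and> \<mu> \<le> \<kappa>)"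

definition ident :: "nat \<Rightarrow> 'k::field pmatrix" where
  "ident n = (\<lambda>\<kappa> \<mu>. if \<kappa> \<in> partitions n \<and> \<kappa> = \<mu> then 1 else 0)"

lemma triangular_row_finite: "triangular n X \<Longrightarrow> row_finite X"
  unfolding row_finite_def triangular_def
  by (intro allI finite_subset[OF _ finite_partitions_below[of n]]) auto

lemma triangular_mult:
  assumes "triangular n X" "triangular n Y"
  shows "triangular n (X \<odot> Y)"
  unfolding triangular_def
proof (intro allI impI)
  fix \<kappa> \<mu> assume "(X \<odot> Y) \<kappa> \<mu> \<noteq> 0"
  then obtain \<zeta> where "X \<kappa> \<zeta> \<noteq> 0" "Y \<zeta> \<mu> \<noteq> 0"
    using row_finite_mult_support[OF triangular_row_finite[OF assms(1)], of Y \<kappa>] by auto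
  then show "\<kappa> \<in> partitions n \<and> \<mu> \<in> partitions n \<and> \<mu> \<le> \<kappa>"
    using assms unfolding triangular_def by (metis order_trans)
qed

lemma ident_mult:
  assumes "\<And>\<kappa> \<mu>. X \<kappa> \<mu> \<noteq> 0 \<Longrightarrow> \<kappa> \<in> partitions n"
  shows "ident n \<odot> X = X"
proof (intro ext)
  fix \<kappa> \<mu>
  have "(ident n \<odot> X) \<kappa> \<mu> = (\<Sum>\<zeta>\<in>{\<kappa>}. ident n \<kappa> \<zeta> * X \<zeta> \<mu>)"
    by (rule pmat_mult_superset) (auto simp: ident_def split: if_splits)
  then show "(ident n \<odot> X) \<kappa> \<mu> = X \<kappa> \<mu>" using assms[of \<kappa> \<mu>] by (auto simp: ident_def)
qed

lemma mult_ident: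
  assumes "\<And>\<kappa> \<mu>. X \<kappa> \<mu> \<noteq> 0 \<Longrightarrow> \<mu> \<in> partitions n"
  shows "X \<odot> ident n = X"
proof (intro ext)
  fix \<kappa> \<mu>
  have "(X \<odot> ident n) \<kappa> \<mu> = (\<Sum>\<zeta>\<in>{\<mu>}. X \<kappa> \<zeta> * ident n \<zeta> \<mu>)"
    by (rule pmat_mult_superset) (auto simp: ident_def split: if_splits)
  then show "(X \<odot> ident n) \<kappa> \<mu> = X \<kappa> \<mu>" using assms[of \<kappa> \<mu>] by (auto simp: ident_def)
qed

text \<open>The equation Y X = 1 solved along a row, for \<open>X\<close> with ones on the diagonal:
  the entry at \<mu> is determined by those at the larger \<zeta> below \<kappa>, and the interval
  above \<mu> shrinks.\<close>

function left_inverse :: "nat \<Rightarrow> 'k::field pmatrix \<Rightarrow> 'k pmatrix" where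
  "left_inverse n X \<kappa> \<mu> = (if \<kappa> = \<mu> then 1 else
     - (\<Sum>\<zeta>\<in>{\<zeta> \<in> partitions n. \<mu> \<le> \<zeta> \<and> \<zeta> \<noteq> \<mu> \<and> \<zeta> \<le> \<kappa>}. left_inverse n X \<kappa> \<zeta> * X \<zeta> \<mu>))"
  by pat_completeness auto
termination
proof (relation "measure (\<lambda>(n, X, \<kappa>, \<mu>). card {\<zeta> \<in> partitions n. \<mu> \<le> \<zeta> \<and> \<zeta> \<noteq> \<mu> \<and> \<zeta> \<le> \<kappa>})")
  fix n and X :: "'k::field pmatrix" and \<kappa> \<mu> \<zeta> :: partition
  assume \<zeta>: "\<zeta> \<in> {\<zeta> \<in> partitions n. \<mu> \<le> \<zeta> \<and> \<zeta> \<noteq> \<mu> \<and> \<zeta> \<le> \<kappa>}"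
  have "{\<xi> \<in> partitions n. \<zeta> \<le> \<xi> \<and> \<xi> \<noteq> \<zeta> \<and> \<xi> \<le> \<kappa>} \<subset> {\<xi> \<in> partitions n. \<mu> \<le> \<xi> \<and> \<xi> \<noteq> \<mu> \<and> \<xi> \<le> \<kappa>}"
    using \<zeta> by (auto intro: order_trans dest: antisym)
  moreover have "finite {\<xi> \<in> partitions n. \<mu> \<le> \<xi> \<and> \<xi> \<noteq> \<mu> \<and> \<xi> \<le> \<kappa>}"
    by (rule finite_subset[OF _ finite_partitions_below[of n \<kappa>]]) auto
  ultimately show "((n, X, \<kappa>, \<zeta>), n, X, \<kappa>, \<mu>) \<in>
      measure (\<lambda>(n, X, \<kappa>, \<mu>). card {\<zeta> \<in> partitions n. \<mu> \<le> \<zeta> \<and> \<zeta> \<noteq> \<mu> \<and> \<zeta> \<le> \<kappa>})"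
    by (simp add: psubset_card_mono)
qed simp

declare left_inverse.simps [simp del]

lemma triangular_left_inverse:
  assumes "triangular n X" "\<And>\<kappa>. \<kappa> \<in> partitions n \<Longrightarrow> X \<kappa> \<kappa> = 1"
  shows "\<exists>Y. triangular n Y \<and> (\<forall>\<kappa>\<in>partitions n. Y \<kappa> \<kappa> = 1) \<and> Y \<odot> X = ident n"
proof -
  define Y where "Y = (\<lambda>\<kappa> \<mu>. if \<kappa> \<in> partitions n \<and> \<mu> \<in> partitions n \<and> \<mu> \<le> \<kappa> then left_inverse n X \<kappa> \<mu> else 0)"
  have Y: "triangular n Y" by (auto simp: triangular_def Y_def)
  have Y1: "Y \<kappa> \<kappa> = 1" if "\<kappa> \<in> partitions n" for \<kappa>
    using that by (simp add: Y_def left_inverse.simps)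
  have "(Y \<odot> X) \<kappa> \<mu> = ident n \<kappa> \<mu>" for \<kappa> \<mu>
  proof (cases "\<kappa> \<in> partitions n \<and> \<mu> \<in> partitions n \<and> \<mu> \<le> \<kappa>")
    case False
    then have "(Y \<odot> X) \<kappa> \<mu> = 0" using triangular_mult[OF Y assms(1)] by (auto simp: triangular_def)
    then show ?thesis using False by (auto simp: ident_def)
  next
    case True
    let ?S = "{\<zeta> \<in> partitions n. \<mu> \<le> \<zeta> \<and> \<zeta> \<noteq> \<mu> \<and> \<zeta> \<le> \<kappa>}"
    have fin: "finite ?S" by (rule finite_subset[OF _ finite_partitions_below[of n \<kappa>]]) auto
    have "(Y \<odot> X) \<kappa> \<mu> = (\<Sum>\<zeta>\<in>insert \<mu> ?S. Y \<kappa> \<zeta> * X \<zeta> \<mu>)"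
      by (rule pmat_mult_superset) (use fin assms(1) Y in \<open>auto simp: triangular_def\<close>)
    also have "\<dots> = Y \<kappa> \<mu> + (\<Sum>\<zeta>\<in>?S. left_inverse n X \<kappa> \<zeta> * X \<zeta> \<mu>)"
    proof -
      have "(\<Sum>\<zeta>\<in>?S. Y \<kappa> \<zeta> * X \<zeta> \<mu>) = (\<Sum>\<zeta>\<in>?S. left_inverse n X \<kappa> \<zeta> * X \<zeta> \<mu>)"
        using True by (intro sum.cong) (auto simp: Y_def)
      then show ?thesis using fin True assms(2) by simp
    qed
    also have "\<dots> = ident n \<kappa> \<mu>"
    proof (cases "\<kappa> = \<mu>")
      case eq: True
      then have "?S = {}" by (auto dest: antisym)
      then have "(\<Sum>\<zeta>\<in>?S. left_inverse n X \<kappa> \<zeta> * X \<zeta> \<mu>) = 0" by (simp only: sum.empty)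
      then show ?thesis using eq True Y1 by (simp add: ident_def)
    next
      case False
      then have "Y \<kappa> \<mu> = - (\<Sum>\<zeta>\<in>?S. left_inverse n X \<kappa> \<zeta> * X \<zeta> \<mu>)"
        using True unfolding Y_def by (subst left_inverse.simps) simp
      then show ?thesis using False by (simp add: ident_def)
    qed
    finally show ?thesis .
  qed
  then show ?thesis using Y Y1 by blast
qed

text \<open>The left inverse \<open>Y\<close> has a left inverse \<open>W\<close> in turn, and
  associativity gives \<open>W = X\<close>, so \<open>Y\<close> is two-sided.\<close>

lemma triangular_inverse:
  assumes "triangular n X" "\<And>\<kappa>. \<kappa> \<in> partitions n \<Longrightarrow> X \<kappa> \<kappa> = 1"
  shows "\<exists>Y. triangular n Y \<and> Y \<odot> X = ident n \<and> X \<odot> Y = ident n"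
proof -
  obtain Y where Y: "triangular n Y" "\<forall>\<kappa>\<in>partitions n. Y \<kappa> \<kappa> = 1" "Y \<odot> X = ident n"
    using triangular_left_inverse[OF assms] by blast
  obtain W where W: "triangular n W" "W \<odot> Y = ident n"
    using triangular_left_inverse[OF Y(1)] Y(2) by blast
  have "W = W \<odot> (Y \<odot> X)"
    unfolding Y(3) by (rule mult_ident[symmetric]) (use W in \<open>auto simp: triangular_def\<close>)
  also have "\<dots> = (W \<odot> Y) \<odot> X"
    using pmat_mult_assoc triangular_row_finite W(1) Y(1) by metis
  also have "\<dots> = X"
    unfolding W(2) by (rule ident_mult) (use assms in \<open>auto simp: triangular_def\<close>)
  finally show ?thesis using Y W by blast
qed

section \<open>Consequences of the vanishing property\<close>

text \<open>The \<open>m \<kappa>\<close> serve the counting: there are as many independent elements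
  of bounded degree as interpolation conditions. \<open>r\<close> realizes the norm as an element of
  the ring of degree one, in units of \<open>degfac F\<close>.\<close>

locale interpolation =
  fixes F :: "'k::field_char_0 interp_family" and m :: "partition \<Rightarrow> 'k laurent" and r :: "'k laurent"
  assumes Lam_Const: "\<And>c. Const c \<in> Lam F"
    and Lam_add: "\<And>f g. f \<in> Lam F \<Longrightarrow> g \<in> Lam F \<Longrightarrow> f + g \<in> Lam F"
    and Lam_mult: "\<And>f g. f \<in> Lam F \<Longrightarrow> g \<in> Lam F \<Longrightarrow> f * g \<in> Lam F"
    and ev_mult: "\<And>f g \<kappa>. f \<in> Lam F \<Longrightarrow> g \<in> Lam F \<Longrightarrow> \<kappa> \<in> parts F \<Longrightarrow>
      lpoly_eval (f * g) (shift F \<kappa>) = lpoly_eval f (shift F \<kappa>) * lpoly_eval g (shift F \<kappa>)"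
    and vanish: "\<And>f d \<kappa>. f \<in> Lam F \<Longrightarrow> ldegree f \<le> degfac F * d \<Longrightarrow> \<kappa> \<in> parts F \<Longrightarrow> d < size_of F \<kappa> \<Longrightarrow>
      (\<And>\<nu>. \<nu> \<in> parts F \<Longrightarrow> \<nu> \<le> \<kappa> \<Longrightarrow> \<nu> \<noteq> \<kappa> \<Longrightarrow> lpoly_eval f (shift F \<nu>) = 0) \<Longrightarrow>
      lpoly_eval f (shift F \<kappa>) = 0"
    and ev_inj: "\<And>f. f \<in> Lam F \<Longrightarrow> (\<And>\<kappa>. \<kappa> \<in> parts F \<Longrightarrow> lpoly_eval f (shift F \<kappa>) = 0) \<Longrightarrow> f = 0"
    and m_Lam: "\<And>\<kappa>. \<kappa> \<in> parts F \<Longrightarrow> m \<kappa> \<in> Lam F"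
    and m_degree: "\<And>\<kappa>. \<kappa> \<in> parts F \<Longrightarrow> ldegree (m \<kappa>) \<le> degfac F * size_of F \<kappa>"
    and m_indep: "\<And>S c. finite S \<Longrightarrow> S \<subseteq> parts F \<Longrightarrow> (\<Sum>\<kappa>\<in>S. Const (c \<kappa>) * m \<kappa>) = 0 \<Longrightarrow> \<forall>\<kappa>\<in>S. c \<kappa> = 0"
    and r_Lam: "r \<in> Lam F" and r_degree: "ldegree r \<le> degfac F"
    and r_ev: "\<And>\<kappa>. \<kappa> \<in> parts F \<Longrightarrow> lpoly_eval r (shift F \<kappa>) = snorm F \<kappa>"
    and snorm_neq: "\<And>\<kappa> \<mu>. \<kappa> \<in> parts F \<Longrightarrow> \<mu> \<in> parts F \<Longrightarrow> size_of F \<mu> < size_of F \<kappa> \<Longrightarrow> snorm F \<kappa> \<noteq> snorm F \<mu>"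
    and degfac_pos: "0 < degfac F"
begin

abbreviation ev :: "'k laurent \<Rightarrow> partition \<Rightarrow> 'k" where
  "ev f \<kappa> \<equiv> lpoly_eval f (shift F \<kappa>)"

abbreviation h :: "partition \<Rightarrow> 'k laurent" where
  "h \<equiv> interp_poly F"

abbreviation ndeg :: "'k laurent \<Rightarrow> nat \<Rightarrow> bool" where
  "ndeg f d \<equiv> ldegree f \<le> degfac F * d"

lemma Lam_0: "0 \<in> Lam F"
  using Lam_Const[of 0] by (simp add: Const_def)

lemma Lam_Const_mult: "f \<in> Lam F \<Longrightarrow> Const c * f \<in> Lam F"
  by (intro Lam_mult Lam_Const)

lemma Lam_sum: "(\<And>a. a \<in> A \<Longrightarrow> f a \<in> Lam F) \<Longrightarrow> (\<Sum>a\<in>A. f a) \<in> Lam F"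
  by (induction A rule: infinite_finite_induct) (auto intro: Lam_0 Lam_add)

lemma Lam_combination: "(\<And>a. a \<in> A \<Longrightarrow> f a \<in> Lam F) \<Longrightarrow> (\<Sum>a\<in>A. Const (c a) * f a) \<in> Lam F"
  by (intro Lam_sum Lam_Const_mult)

lemma degree_combination:
  "(\<And>a. a \<in> A \<Longrightarrow> ldegree (f a) \<le> d) \<Longrightarrow> ldegree (\<Sum>a\<in>A. Const (c a) * f a) \<le> d"
  by (intro ldegree_sum ldegree_Const_mult)

lemma ev_combination: "ev (\<Sum>a\<in>A. Const (c a) * f a) \<kappa> = (\<Sum>a\<in>A. c a * ev (f a) \<kappa>)"
  by (simp add: lpoly_eval_sum lpoly_eval_Const_mult)

lemma minus_eq: "f - g = f + Const (- 1) * (g :: 'k laurent)"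
  by (simp add: Const_def single_uminus)

lemma Lam_diff: "f \<in> Lam F \<Longrightarrow> g \<in> Lam F \<Longrightarrow> f - g \<in> Lam F"
  unfolding minus_eq by (intro Lam_add Lam_Const_mult)

lemma degree_diff: "ldegree f \<le> d \<Longrightarrow> ldegree g \<le> d \<Longrightarrow> ldegree (f - g) \<le> d" for f g :: "'k laurent"
  unfolding minus_eq by (intro ldegree_add ldegree_Const_mult)

lemma ev_diff: "ev (f - g) \<kappa> = ev f \<kappa> - ev g \<kappa>"
  unfolding minus_eq by (simp add: lpoly_eval_add lpoly_eval_Const_mult)

section \<open>Uniqueness and existence of interpolation\<close>

text \<open>Beyond size \<open>d\<close> the zeros propagate upwards by \<open>vanish\<close>, and
  an element that vanishes at every partition is zero.\<close>

lemma eq_0_of_small: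
  assumes "f \<in> Lam F" "ndeg f d" "\<And>\<kappa>. \<kappa> \<in> parts F \<Longrightarrow> size_of F \<kappa> \<le> d \<Longrightarrow> ev f \<kappa> = 0"
  shows "f = 0"
proof (rule ev_inj[OF assms(1)])
  fix \<kappa> assume "\<kappa> \<in> parts F"
  then show "ev f \<kappa> = 0"
  proof (induction "size_of F \<kappa>" arbitrary: \<kappa> rule: less_induct)
    case less
    show ?case
    proof (cases "size_of F \<kappa> \<le> d")
      case True
      then show ?thesis using assms(3) less by blast
    next
      case False
      show ?thesis
      proof (rule vanish[OF assms(1,2) less.prems])
        fix \<nu> assume "\<nu> \<in> parts F" "\<nu> \<le> \<kappa>" "\<nu> \<noteq> \<kappa>"
        then show "ev f \<nu> = 0" using psize_strict_mono[of \<nu> \<kappa>] less by blast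
      qed (use False in simp)
    qed
  qed
qed

lemma eq_of_small:
  assumes "f \<in> Lam F" "ndeg f d" "g \<in> Lam F" "ndeg g d"
    "\<And>\<kappa>. \<kappa> \<in> parts F \<Longrightarrow> size_of F \<kappa> \<le> d \<Longrightarrow> ev f \<kappa> = ev g \<kappa>"
  shows "f = g"
proof -
  have "f - g = 0"
    by (rule eq_0_of_small[of _ d]) (use assms in \<open>auto intro: Lam_diff degree_diff simp: ev_diff\<close>)
  then show ?thesis by simp
qed

text \<open>On the span of the \<open>m \<kappa>\<close> with \<kappa> of size at most
  \<open>d\<close> the conditions form a square system, and uniqueness is its injectivity.\<close>

lemma interpolate:
  "\<exists>f\<in>Lam F. ndeg f d \<and> (\<forall>\<kappa>\<in>parts F. size_of F \<kappa> \<le> d \<longrightarrow> ev f \<kappa> = v \<kappa>)"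
proof -
  define S where "S = {\<kappa> \<in> parts F. size_of F \<kappa> \<le> d}"
  have S: "finite S" "S \<subseteq> parts F" unfolding S_def by (auto intro: finite_partitions_size)
  have mdeg: "ndeg (m \<kappa>) d" if "\<kappa> \<in> S" for \<kappa>
    using m_degree[of \<kappa>] that by (auto simp: S_def intro: order_trans mult_le_mono2)
  have comb: "(\<Sum>\<kappa>\<in>S. Const (c \<kappa>) * m \<kappa>) \<in> Lam F" "ndeg (\<Sum>\<kappa>\<in>S. Const (c \<kappa>) * m \<kappa>) d" for c
    using S m_Lam mdeg by (auto intro!: Lam_combination degree_combination)
  have "\<exists>c. \<forall>\<nu>\<in>S. (\<Sum>\<kappa>\<in>S. c \<kappa> * ev (m \<kappa>) \<nu>) = v \<nu>"
  proof (rule square_system[OF S(1)])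
    fix c assume "\<forall>\<nu>\<in>S. (\<Sum>\<kappa>\<in>S. c \<kappa> * ev (m \<kappa>) \<nu>) = 0"
    then have "(\<Sum>\<kappa>\<in>S. Const (c \<kappa>) * m \<kappa>) = 0"
      by (intro eq_0_of_small[OF comb]) (simp add: ev_combination S_def)
    then show "\<forall>\<kappa>\<in>S. c \<kappa> = 0" using m_indep[OF S] by blast
  qed
  then obtain c where "\<forall>\<nu>\<in>S. (\<Sum>\<kappa>\<in>S. c \<kappa> * ev (m \<kappa>) \<nu>) = v \<nu>" by blast
  then show ?thesis
    using comb by (intro bexI[of _ "\<Sum>\<kappa>\<in>S. Const (c \<kappa>) * m \<kappa>"]) (auto simp: ev_combination S_def)
qed

lemma h_props:
  assumes "\<mu> \<in> parts F"
  shows "h \<mu> \<in> Lam F \<and> ndeg (h \<mu>) (size_of F \<mu>) \<and>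
    (\<forall>\<kappa>\<in>parts F. size_of F \<kappa> \<le> size_of F \<mu> \<longrightarrow> ev (h \<mu>) \<kappa> = (if \<kappa> = \<mu> then 1 else 0))"
  unfolding interp_poly_def
proof (rule theI')
  show "\<exists>!f. f \<in> Lam F \<and> ndeg f (size_of F \<mu>) \<and>
    (\<forall>\<kappa>\<in>parts F. size_of F \<kappa> \<le> size_of F \<mu> \<longrightarrow> ev f \<kappa> = (if \<kappa> = \<mu> then 1 else 0))"
  proof (rule ex_ex1I)
    show "\<exists>f. f \<in> Lam F \<and> ndeg f (size_of F \<mu>) \<and>
      (\<forall>\<kappa>\<in>parts F. size_of F \<kappa> \<le> size_of F \<mu> \<longrightarrow> ev f \<kappa> = (if \<kappa> = \<mu> then 1 else 0))"
      using interpolate[of "size_of F \<mu>" "\<lambda>\<kappa>. if \<kappa> = \<mu> then 1 else 0"] by blast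
  next
    fix f g
    assume "f \<in> Lam F \<and> ndeg f (size_of F \<mu>) \<and>
      (\<forall>\<kappa>\<in>parts F. size_of F \<kappa> \<le> size_of F \<mu> \<longrightarrow> ev f \<kappa> = (if \<kappa> = \<mu> then 1 else 0))"
      "g \<in> Lam F \<and> ndeg g (size_of F \<mu>) \<and>
      (\<forall>\<kappa>\<in>parts F. size_of F \<kappa> \<le> size_of F \<mu> \<longrightarrow> ev g \<kappa> = (if \<kappa> = \<mu> then 1 else 0))"
    then show "f = g" by (intro eq_of_small[of f "size_of F \<mu>" g]) auto
  qed
qed

lemma h_Lam: "\<mu> \<in> parts F \<Longrightarrow> h \<mu> \<in> Lam F"
  and h_degree: "\<mu> \<in> parts F \<Longrightarrow> ndeg (h \<mu>) (size_of F \<mu>)"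
  using h_props by auto

lemma binom_small:
  "\<mu> \<in> parts F \<Longrightarrow> \<kappa> \<in> parts F \<Longrightarrow> size_of F \<kappa> \<le> size_of F \<mu> \<Longrightarrow> binom F \<kappa> \<mu> = (if \<kappa> = \<mu> then 1 else 0)"
  unfolding binom_def using h_props by blast

lemma binom_self: "\<mu> \<in> parts F \<Longrightarrow> binom F \<mu> \<mu> = 1"
  by (simp add: binom_small)

text \<open>If \<kappa> does not contain \<mu>, neither does any partition inside \<kappa>; by
  induction on size \<open>h \<mu>\<close> vanishes at all of these, and \<open>vanish\<close>
  applies at \<kappa>.\<close>

lemma binom_vanish:
  assumes "\<mu> \<in> parts F" "\<kappa> \<in> parts F" "\<not> \<mu> \<le> \<kappa>"
  shows "binom F \<kappa> \<mu> = 0"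
  using assms(2,3)
proof (induction "size_of F \<kappa>" arbitrary: \<kappa> rule: less_induct)
  case less
  show ?case
  proof (cases "size_of F \<kappa> \<le> size_of F \<mu>")
    case True
    then show ?thesis using binom_small[OF assms(1) less.prems(1)] less.prems by auto
  next
    case False
    show ?thesis unfolding binom_def
    proof (rule vanish[OF h_Lam[OF assms(1)] h_degree[OF assms(1)] less.prems(1)])
      fix \<nu> assume \<nu>: "\<nu> \<in> parts F" "\<nu> \<le> \<kappa>" "\<nu> \<noteq> \<kappa>"
      then have "size_of F \<nu> < size_of F \<kappa>" using psize_strict_mono less.prems(1) by blast
      moreover have "\<not> \<mu> \<le> \<nu>" using \<nu>(2) less.prems(2) order_trans by blast
      ultimately show "ev (h \<mu>) \<nu> = 0" using less.hyps \<nu>(1) unfolding binom_def by blast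
    qed (use False in simp)
  qed
qed

section \<open>The binomial matrix and expansions in interpolation polynomials\<close>

abbreviation "B \<equiv> matB F"

lemma triangular_B: "triangular (nvars F) B"
  unfolding triangular_def
proof (intro allI impI)
  fix \<kappa> \<mu> assume "B \<kappa> \<mu> \<noteq> 0"
  then have "\<kappa> \<in> parts F" "\<mu> \<in> parts F" "binom F \<kappa> \<mu> \<noteq> 0"
    by (simp_all add: matB_def pmat_def split: if_splits)
  then show "\<kappa> \<in> parts F \<and> \<mu> \<in> parts F \<and> \<mu> \<le> \<kappa>" using binom_vanish by blast
qed

lemma B_diag: "\<kappa> \<in> parts F \<Longrightarrow> B \<kappa> \<kappa> = 1"
  by (simp add: matB_def pmat_def binom_self)

lemma ident_eq: "ident (nvars F) = pmat F (\<lambda>\<kappa> \<mu>. if \<kappa> = \<mu> then 1 else 0)"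
  by (intro ext) (auto simp: ident_def pmat_def)

lemma inverse_B:
  "triangular (nvars F) (pmat_inverse F B) \<and> pmat_inverse F B \<odot> B = ident (nvars F)
    \<and> B \<odot> pmat_inverse F B = ident (nvars F)"
proof -
  obtain Y where Y: "triangular (nvars F) Y" "Y \<odot> B = ident (nvars F)" "B \<odot> Y = ident (nvars F)"
    using triangular_inverse[OF triangular_B B_diag] by blast
  have "pmat_inverse F B = Y"
    unfolding pmat_inverse_def ident_eq[symmetric] row_finite_def[symmetric]
  proof (rule the_equality)
    show "pmat F Y = Y \<and> row_finite Y \<and> B \<odot> Y = ident (nvars F) \<and> Y \<odot> B = ident (nvars F)"
      using Y triangular_row_finite by (auto simp: pmat_def triangular_def fun_eq_iff)
  next
    \<comment> \<open>The competitor is only row-finite, not triangular; associativity still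
      applies, as \<open>B\<close> is row-finite too.\<close>
    fix Y' assume Y': "pmat F Y' = Y' \<and> row_finite Y' \<and> B \<odot> Y' = ident (nvars F) \<and> Y' \<odot> B = ident (nvars F)"
    have supp: "\<mu> \<in> parts F" if "Y' \<kappa> \<mu> \<noteq> 0" for \<kappa> \<mu>
    proof -
      have "pmat F Y' \<kappa> \<mu> \<noteq> 0" using Y' that by simp
      then show ?thesis by (simp add: pmat_def split: if_splits)
    qed
    have "Y' = Y' \<odot> (B \<odot> Y)" unfolding Y(3) by (rule mult_ident[symmetric]) (use supp in blast)
    also have "\<dots> = (Y' \<odot> B) \<odot> Y"
      using Y' triangular_row_finite[OF triangular_B] by (intro pmat_mult_assoc[symmetric]) auto
    also have "\<dots> = Y"
      using Y' Y by (simp add: ident_mult triangular_def)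
    finally show "Y' = Y" .
  qed
  then show ?thesis using Y by simp
qed

text \<open>Evaluation at \<nu> isolates its coefficient: the terms of smaller size are gone by
  induction, and the other ones vanish at \<nu>.\<close>

lemma h_indep:
  assumes "finite S" "S \<subseteq> parts F" "(\<Sum>\<nu>\<in>S. Const (c \<nu>) * h \<nu>) = 0" "\<nu> \<in> S"
  shows "c \<nu> = 0"
  using assms(4)
proof (induction "size_of F \<nu>" arbitrary: \<nu> rule: less_induct)
  case less
  have "0 = (\<Sum>\<xi>\<in>S. c \<xi> * binom F \<nu> \<xi>)"
    using ev_combination[of c h S \<nu>] assms(3) by (simp add: binom_def)
  also have "\<dots> = c \<nu> * binom F \<nu> \<nu> + (\<Sum>\<xi>\<in>S - {\<nu>}. c \<xi> * binom F \<nu> \<xi>)"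
    using assms(1) less.prems by (rule sum.remove)
  also have "(\<Sum>\<xi>\<in>S - {\<nu>}. c \<xi> * binom F \<nu> \<xi>) = 0"
  proof (rule sum.neutral, rule ballI)
    fix \<xi> assume \<xi>: "\<xi> \<in> S - {\<nu>}"
    then have "\<xi> \<in> parts F" "\<nu> \<in> parts F" using assms(2) less.prems by auto
    show "c \<xi> * binom F \<nu> \<xi> = 0"
    proof (cases "size_of F \<xi> < size_of F \<nu>")
      case True
      then show ?thesis using less.hyps \<xi> by simp
    next
      case False
      then show ?thesis using binom_small[OF \<open>\<xi> \<in> parts F\<close> \<open>\<nu> \<in> parts F\<close>] \<xi> by auto
    qed
  qed
  finally show ?case using binom_self assms(2) less.prems by auto
qed

text \<open>Matching values size by size up to the degree is enough, because an element of degree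
  \<open>d\<close> is determined by its values at sizes at most \<open>d\<close>.\<close>

lemma h_expansion:
  assumes "f \<in> Lam F"
  shows "\<exists>c. finite {\<nu>. c \<nu> \<noteq> 0} \<and> {\<nu>. c \<nu> \<noteq> 0} \<subseteq> parts F \<and>
    f = (\<Sum>\<nu> | c \<nu> \<noteq> 0. Const (c \<nu>) * h \<nu>)"
proof -
  define d where "d = ldegree f"
  have fd: "ndeg f d" using degfac_pos by (simp add: d_def)
  have "\<exists>c. {\<nu>. c \<nu> \<noteq> 0} \<subseteq> {\<nu> \<in> parts F. size_of F \<nu> \<le> d} \<and>
    (\<forall>\<kappa>\<in>parts F. size_of F \<kappa> < k \<longrightarrow> ev f \<kappa> = (\<Sum>\<nu>\<in>{\<nu> \<in> parts F. size_of F \<nu> \<le> d}. c \<nu> * binom F \<kappa> \<nu>))"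
    if "k \<le> Suc d" for k
    using that
  proof (induction k)
    case 0
    then show ?case by (intro exI[of _ "\<lambda>_. 0"]) auto
  next
    case (Suc k)
    let ?S = "{\<nu> \<in> parts F. size_of F \<nu> \<le> d}"
    have S: "finite ?S" by (rule finite_partitions_size)
    from Suc obtain c where c: "{\<nu>. c \<nu> \<noteq> 0} \<subseteq> ?S"
      "\<forall>\<kappa>\<in>parts F. size_of F \<kappa> < k \<longrightarrow> ev f \<kappa> = (\<Sum>\<nu>\<in>?S. c \<nu> * binom F \<kappa> \<nu>)" by auto
    \<comment> \<open>The correction at size \<open>k\<close> disturbs no value at a smaller size,
      and at size \<open>k\<close> the polynomials \<open>h \<nu>\<close> are delta
      functions.\<close>
    define e where "e = (\<lambda>\<nu>. if \<nu> \<in> parts F \<and> size_of F \<nu> = k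
      then ev f \<nu> - (\<Sum>\<xi>\<in>?S. c \<xi> * binom F \<nu> \<xi>) else 0)"
    have e: "(\<Sum>\<nu>\<in>?S. e \<nu> * binom F \<kappa> \<nu>) = e \<kappa>" if \<kappa>: "\<kappa> \<in> parts F" "size_of F \<kappa> < Suc k" for \<kappa>
    proof -
      have "(\<Sum>\<nu>\<in>?S. e \<nu> * binom F \<kappa> \<nu>) = (\<Sum>\<nu>\<in>?S. if \<nu> = \<kappa> then e \<nu> else 0)"
      proof (rule sum.cong[OF refl])
        fix \<nu> assume "\<nu> \<in> ?S"
        then show "e \<nu> * binom F \<kappa> \<nu> = (if \<nu> = \<kappa> then e \<nu> else 0)"
          using binom_small[of \<nu> \<kappa>] \<kappa> by (auto simp: e_def)
      qed
      also have "\<dots> = e \<kappa>" using S \<kappa> Suc.prems by simp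
      finally show ?thesis .
    qed
    show ?case
    proof (intro exI[of _ "\<lambda>\<nu>. c \<nu> + e \<nu>"] conjI ballI impI)
      show "{\<nu>. c \<nu> + e \<nu> \<noteq> 0} \<subseteq> ?S" using c(1) Suc.prems by (auto simp: e_def)
      fix \<kappa> assume \<kappa>: "\<kappa> \<in> parts F" "size_of F \<kappa> < Suc k"
      have "(\<Sum>\<nu>\<in>?S. (c \<nu> + e \<nu>) * binom F \<kappa> \<nu>) = (\<Sum>\<nu>\<in>?S. c \<nu> * binom F \<kappa> \<nu>) + e \<kappa>"
        using e[OF \<kappa>] by (simp add: distrib_right sum.distrib)
      also have "\<dots> = ev f \<kappa>" using c(2) \<kappa> by (auto simp: e_def)
      finally show "ev f \<kappa> = (\<Sum>\<nu>\<in>?S. (c \<nu> + e \<nu>) * binom F \<kappa> \<nu>)" ..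
    qed
  qed
  from this[of "Suc d"] obtain c where c: "{\<nu>. c \<nu> \<noteq> 0} \<subseteq> {\<nu> \<in> parts F. size_of F \<nu> \<le> d}"
    "\<And>\<kappa>. \<kappa> \<in> parts F \<Longrightarrow> size_of F \<kappa> \<le> d \<Longrightarrow>
       ev f \<kappa> = (\<Sum>\<nu>\<in>{\<nu> \<in> parts F. size_of F \<nu> \<le> d}. c \<nu> * binom F \<kappa> \<nu>)"
    by (auto simp: less_Suc_eq_le)
  have fin: "finite {\<nu>. c \<nu> \<noteq> 0}" using c(1) finite_partitions_size finite_subset by blast
  have hd: "ndeg (h \<nu>) d" if "\<nu> \<in> parts F" "size_of F \<nu> \<le> d" for \<nu>
    using h_degree[OF that(1)] that(2) by (auto intro: order_trans mult_le_mono2)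
  have "f = (\<Sum>\<nu> | c \<nu> \<noteq> 0. Const (c \<nu>) * h \<nu>)"
  proof (rule eq_of_small[OF assms fd])
    show "(\<Sum>\<nu> | c \<nu> \<noteq> 0. Const (c \<nu>) * h \<nu>) \<in> Lam F"
      using c(1) h_Lam by (intro Lam_combination) auto
    show "ndeg (\<Sum>\<nu> | c \<nu> \<noteq> 0. Const (c \<nu>) * h \<nu>) d"
      using c(1) hd by (intro degree_combination) auto
    fix \<kappa> assume "\<kappa> \<in> parts F" "size_of F \<kappa> \<le> d"
    then have "ev f \<kappa> = (\<Sum>\<nu>\<in>{\<nu> \<in> parts F. size_of F \<nu> \<le> d}. c \<nu> * binom F \<kappa> \<nu>)" by (rule c(2))
    also have "\<dots> = (\<Sum>\<nu> | c \<nu> \<noteq> 0. c \<nu> * binom F \<kappa> \<nu>)"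
      using c(1) finite_partitions_size by (intro sum.mono_neutral_right) auto
    finally show "ev f \<kappa> = ev (\<Sum>\<nu> | c \<nu> \<noteq> 0. Const (c \<nu>) * h \<nu>) \<kappa>"
      by (simp add: ev_combination binom_def)
  qed
  then show ?thesis using c(1) fin by blast
qed

lemma expansion_unique:
  assumes "finite {\<nu>. c \<nu> \<noteq> 0}" "{\<nu>. c \<nu> \<noteq> 0} \<subseteq> parts F"
    and "finite {\<nu>. e \<nu> \<noteq> 0}" "{\<nu>. e \<nu> \<noteq> 0} \<subseteq> parts F"
    and "(\<Sum>\<nu> | c \<nu> \<noteq> 0. Const (c \<nu>) * h \<nu>) = (\<Sum>\<nu> | e \<nu> \<noteq> 0. Const (e \<nu>) * h \<nu>)"
  shows "c = e"
proof -
  let ?S = "{\<nu>. c \<nu> \<noteq> 0} \<union> {\<nu>. e \<nu> \<noteq> 0}"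
  have C0: "Const 0 = (0 :: 'k laurent)" by (simp add: Const_def)
  have Cd: "Const (x - y) = Const x - (Const y :: 'k laurent)" for x y by (simp add: Const_def single_diff)
  have 1: "(\<Sum>\<nu> | c \<nu> \<noteq> 0. Const (c \<nu>) * h \<nu>) = (\<Sum>\<nu>\<in>?S. Const (c \<nu>) * h \<nu>)"
    using assms by (intro sum.mono_neutral_left) (auto simp: C0)
  have 2: "(\<Sum>\<nu> | e \<nu> \<noteq> 0. Const (e \<nu>) * h \<nu>) = (\<Sum>\<nu>\<in>?S. Const (e \<nu>) * h \<nu>)"
    using assms by (intro sum.mono_neutral_left) (auto simp: C0)
  have "(\<Sum>\<nu>\<in>?S. Const (c \<nu> - e \<nu>) * h \<nu>) = 0"
    using assms(5) unfolding 1 2 by (simp add: Cd left_diff_distrib sum_subtractf)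
  then have "c \<nu> - e \<nu> = 0" if "\<nu> \<in> ?S" for \<nu>
    using h_indep[of ?S "\<lambda>\<nu>. c \<nu> - e \<nu>" \<nu>] assms that by auto
  then show ?thesis by (intro ext) (metis (mono_tags, lifting) UnCI eq_iff_diff_eq_0 mem_Collect_eq)
qed

text \<open>The element (r - norm of \<mu>) \<open>h \<mu>\<close> has degree |\<mu>| + 1, so it is
  determined by values at sizes up to |\<mu>| + 1. These vanish except at the covers of \<mu>: the
  first factor kills the value at \<mu>, and extra vanishing handles the top size.\<close>

lemma pieri:
  assumes "\<kappa> \<in> parts F" "\<mu> \<in> parts F"
  shows "(snorm F \<kappa> - snorm F \<mu>) * binom F \<kappa> \<mu> =
    (\<Sum>\<zeta> | \<zeta> \<in> parts F \<and> covers (nvars F) \<zeta> \<mu>. binom F \<kappa> \<zeta> * ((snorm F \<zeta> - snorm F \<mu>) * adj_binom F \<zeta> \<mu>))"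
proof -
  let ?d = "Suc (size_of F \<mu>)"
  let ?S = "{\<zeta>. \<zeta> \<in> parts F \<and> covers (nvars F) \<zeta> \<mu>}"
  define c where "c = (\<lambda>\<zeta>. (snorm F \<zeta> - snorm F \<mu>) * adj_binom F \<zeta> \<mu>)"
  have S: "finite ?S"
    by (rule finite_subset[OF _ finite_partitions_size[of "nvars F" ?d]]) (auto simp: covers_def)
  define f where "f = (r - Const (snorm F \<mu>)) * h \<mu>"
  have rL: "r - Const (snorm F \<mu>) \<in> Lam F" by (intro Lam_diff r_Lam Lam_Const)
  have f: "f \<in> Lam F" unfolding f_def by (intro Lam_mult rL h_Lam assms)
  have "ldegree f \<le> degfac F + degfac F * size_of F \<mu>"
    unfolding f_def
    by (intro ldegree_mult degree_diff r_degree h_degree assms) (simp add: ldegree_Const)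
  then have fd: "ndeg f ?d" by simp
  have ev_f: "ev f \<nu> = (snorm F \<nu> - snorm F \<mu>) * binom F \<nu> \<mu>" if "\<nu> \<in> parts F" for \<nu>
    unfolding f_def binom_def
    by (simp add: ev_mult[OF rL h_Lam[OF assms(2)] that] ev_diff r_ev[OF that] lpoly_eval_Const)
  have "f = (\<Sum>\<zeta>\<in>?S. Const (c \<zeta>) * h \<zeta>)"
  proof (rule eq_of_small[OF f fd])
    show "(\<Sum>\<zeta>\<in>?S. Const (c \<zeta>) * h \<zeta>) \<in> Lam F"
      using h_Lam by (intro Lam_combination) auto
    show "ndeg (\<Sum>\<zeta>\<in>?S. Const (c \<zeta>) * h \<zeta>) ?d"
    proof (rule degree_combination)
      fix \<zeta> assume "\<zeta> \<in> ?S"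
      then show "ndeg (h \<zeta>) ?d" using h_degree[of \<zeta>] by (simp add: covers_def)
    qed
    fix \<nu> assume \<nu>: "\<nu> \<in> parts F" "size_of F \<nu> \<le> ?d"
    have "ev (\<Sum>\<zeta>\<in>?S. Const (c \<zeta>) * h \<zeta>) \<nu> = (\<Sum>\<zeta>\<in>?S. c \<zeta> * binom F \<nu> \<zeta>)"
      by (simp add: ev_combination binom_def)
    also have "\<dots> = (\<Sum>\<zeta>\<in>?S. if \<zeta> = \<nu> then c \<zeta> else 0)"
      by (rule sum.cong[OF refl]) (use binom_small \<nu> in \<open>auto simp: covers_def\<close>)
    also have "\<dots> = (if \<nu> \<in> ?S then c \<nu> else 0)" using S by simp
    also have "\<dots> = ev f \<nu>"
    proof (cases "\<nu> \<in> ?S")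
      case True
      then show ?thesis by (simp add: ev_f c_def adj_binom_def)
    next
      case False
      have "\<nu> = \<mu> \<or> binom F \<nu> \<mu> = 0"
      proof (cases "size_of F \<nu> \<le> size_of F \<mu>")
        case True
        then show ?thesis using binom_small[OF assms(2) \<nu>(1)] by auto
      next
        case False
        then have "\<not> \<mu> \<le> \<nu>" using \<nu> \<open>\<nu> \<notin> ?S\<close> by (auto simp: covers_def)
        then show ?thesis using binom_vanish assms(2) \<nu>(1) by blast
      qed
      then have "ev f \<nu> = 0" using ev_f \<nu>(1) by auto
      then show ?thesis unfolding if_not_P[OF False] by simp
    qed
    finally show "ev f \<nu> = ev (\<Sum>\<zeta>\<in>?S. Const (c \<zeta>) * h \<zeta>) \<nu>" ..
  qed
  then have "ev f \<kappa> = (\<Sum>\<zeta>\<in>?S. c \<zeta> * binom F \<kappa> \<zeta>)"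
    by (simp only: ev_combination binom_def)
  then show ?thesis unfolding ev_f[OF assms(1)] c_def by (simp add: mult_ac)
qed

section \<open>Structure coefficients and the commutator identity\<close>

context
  fixes p :: "'k laurent"
  assumes p: "p \<in> Lam F"
begin

abbreviation "c \<equiv> structure_coeff F p"
abbreviation "C \<equiv> matC F p"
abbreviation "D \<equiv> matD F p"
abbreviation "Z \<equiv> matZ F"
abbreviation "A \<equiv> matA F"

lemma structure_coeff_props:
  assumes "\<mu> \<in> parts F"
  shows "finite {\<nu>. c \<nu> \<mu> \<noteq> 0} \<and> {\<nu>. c \<nu> \<mu> \<noteq> 0} \<subseteq> parts F \<and>
    p * h \<mu> = (\<Sum>\<nu> | c \<nu> \<mu> \<noteq> 0. Const (c \<nu> \<mu>) * h \<nu>)"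
proof -
  let ?P = "\<lambda>e. finite {\<nu>. e \<nu> \<noteq> 0} \<and> {\<nu>. e \<nu> \<noteq> 0} \<subseteq> parts F \<and>
    p * h \<mu> = (\<Sum>\<nu> | e \<nu> \<noteq> 0. Const (e \<nu>) * h \<nu>)"
  have "?P (THE e. ?P e)"
  proof (rule theI'[of ?P])
    show "\<exists>!e. ?P e"
    proof (rule ex_ex1I)
      show "\<exists>e. ?P e" by (rule h_expansion) (intro Lam_mult p h_Lam assms)
      fix e e' assume "?P e" "?P e'"
      then show "e = e'" by (intro expansion_unique) auto
    qed
  qed
  then show ?thesis unfolding structure_coeff_def .
qed

text \<open>Both sides are the value of \<open>p * h \<mu>\<close> at \<kappa>, once through the
  expansion and once through multiplicativity.\<close>

lemma B_C: "B \<odot> C = D \<odot> B"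
proof (intro ext)
  fix \<kappa> \<mu>
  show "(B \<odot> C) \<kappa> \<mu> = (D \<odot> B) \<kappa> \<mu>"
  proof (cases "\<kappa> \<in> parts F \<and> \<mu> \<in> parts F")
    case True
    have "(B \<odot> C) \<kappa> \<mu> = (\<Sum>\<nu> | c \<nu> \<mu> \<noteq> 0. B \<kappa> \<nu> * C \<nu> \<mu>)"
      by (rule pmat_mult_superset)
        (use structure_coeff_props[of \<mu>] True in \<open>auto simp: matC_def pmat_def split: if_splits\<close>)
    also have "\<dots> = (\<Sum>\<nu> | c \<nu> \<mu> \<noteq> 0. c \<nu> \<mu> * ev (h \<nu>) \<kappa>)"
      using structure_coeff_props[of \<mu>] True
      by (intro sum.cong refl) (auto simp: matC_def matB_def pmat_def binom_def)
    also have "\<dots> = ev (p * h \<mu>) \<kappa>"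
    proof -
      have ph: "p * h \<mu> = (\<Sum>\<nu> | c \<nu> \<mu> \<noteq> 0. Const (c \<nu> \<mu>) * h \<nu>)"
        using structure_coeff_props True by blast
      show ?thesis unfolding ph ev_combination ..
    qed
    also have "\<dots> = ev p \<kappa> * binom F \<kappa> \<mu>"
      using True by (simp add: ev_mult p h_Lam binom_def)
    also have "\<dots> = (\<Sum>\<zeta>\<in>{\<kappa>}. D \<kappa> \<zeta> * B \<zeta> \<mu>)"
      using True by (simp add: matD_def matB_def pmat_def)
    also have "\<dots> = (D \<odot> B) \<kappa> \<mu>"
      by (rule pmat_mult_superset[symmetric]) (auto simp: matD_def pmat_def split: if_splits)
    finally show ?thesis .
  next
    case False
    have "(B \<odot> C) \<kappa> \<mu> = (\<Sum>\<zeta>\<in>{}. B \<kappa> \<zeta> * C \<zeta> \<mu>)"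
      by (rule pmat_mult_superset) (use False in \<open>auto simp: matB_def matC_def pmat_def\<close>)
    moreover have "(D \<odot> B) \<kappa> \<mu> = (\<Sum>\<zeta>\<in>{}. D \<kappa> \<zeta> * B \<zeta> \<mu>)"
      by (rule pmat_mult_superset) (use False in \<open>auto simp: matB_def matD_def pmat_def\<close>)
    ultimately show ?thesis by simp
  qed
qed

lemma triangular_D: "triangular (nvars F) D" and triangular_Z: "triangular (nvars F) Z"
  by (auto simp: triangular_def matD_def matZ_def pmat_def split: if_splits)

lemma triangular_A: "triangular (nvars F) A"
  by (auto simp: triangular_def matA_def pmat_def adj_binom_def covers_def split: if_splits)

lemmas rf = triangular_row_finite

lemma cancel_B:
  assumes "B \<odot> X = B \<odot> Y" "\<And>\<kappa> \<mu>. X \<kappa> \<mu> \<noteq> 0 \<Longrightarrow> \<kappa> \<in> parts F" "\<And>\<kappa> \<mu>. Y \<kappa> \<mu> \<noteq> 0 \<Longrightarrow> \<kappa> \<in> parts F"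
  shows "X = Y"
proof -
  have I: "row_finite (pmat_inverse F B)" "pmat_inverse F B \<odot> B = ident (nvars F)"
    using inverse_B rf by auto
  have "(pmat_inverse F B \<odot> B) \<odot> X = (pmat_inverse F B \<odot> B) \<odot> Y"
    using assms(1) by (simp only: pmat_mult_assoc[OF I(1) rf[OF triangular_B]])
  then show ?thesis unfolding I(2) using ident_mult[of X "nvars F"] ident_mult[of Y "nvars F"] assms(2,3) by metis
qed

lemma C_eq: "C = pmat_inverse F B \<odot> D \<odot> B"
proof -
  have I: "triangular (nvars F) (pmat_inverse F B)" "B \<odot> pmat_inverse F B = ident (nvars F)"
    using inverse_B by auto
  show ?thesis
  proof (rule cancel_B)
    have "B \<odot> (pmat_inverse F B \<odot> D \<odot> B) = (B \<odot> pmat_inverse F B) \<odot> (D \<odot> B)"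
      by (simp add: pmat_mult_assoc row_finite_mult rf[OF I(1)] rf[OF triangular_B] rf[OF triangular_D])
    also have "\<dots> = D \<odot> B"
      unfolding I(2) using triangular_mult[OF triangular_D triangular_B]
      by (intro ident_mult) (auto simp: triangular_def)
    finally show "B \<odot> C = B \<odot> (pmat_inverse F B \<odot> D \<odot> B)" using B_C by simp
    show "C \<kappa> \<mu> \<noteq> 0 \<Longrightarrow> \<kappa> \<in> parts F" for \<kappa> \<mu> by (auto simp: matC_def pmat_def split: if_splits)
    show "(pmat_inverse F B \<odot> D \<odot> B) \<kappa> \<mu> \<noteq> 0 \<Longrightarrow> \<kappa> \<in> parts F" for \<kappa> \<mu>
      using triangular_mult[OF triangular_mult[OF I(1) triangular_D] triangular_B] by (auto simp: triangular_def)
  qed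
qed

text \<open>The support of the structure coefficients is read off from the factorization of
  \<open>C\<close>, not from degrees.\<close>

lemma triangular_C: "triangular (nvars F) C"
  unfolding C_eq using inverse_B triangular_D triangular_B by (intro triangular_mult) auto

lemma C_entry: "\<kappa> \<in> parts F \<Longrightarrow> \<mu> \<in> parts F \<Longrightarrow> C \<kappa> \<mu> = c \<kappa> \<mu>"
  by (simp add: matC_def pmat_def)

lemma C_entry_sum:
  assumes "\<kappa> \<in> parts F" "\<mu> \<in> parts F"
  shows "c \<kappa> \<mu> = (\<Sum>\<zeta> | \<zeta> \<in> parts F \<and> \<mu> \<le> \<zeta> \<and> \<zeta> \<le> \<kappa>. inv_binom F \<kappa> \<zeta> * binom F \<zeta> \<mu> * ev p \<zeta>)"
proof -
  have I: "triangular (nvars F) (inv_binom F)" using inverse_B by (simp add: inv_binom_def)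
  have ID: "(inv_binom F \<odot> D) \<kappa> \<zeta> = inv_binom F \<kappa> \<zeta> * ev p \<zeta>" if "\<zeta> \<in> parts F" for \<zeta>
  proof -
    have "(inv_binom F \<odot> D) \<kappa> \<zeta> = (\<Sum>\<xi>\<in>{\<zeta>}. inv_binom F \<kappa> \<xi> * D \<xi> \<zeta>)"
      by (rule pmat_mult_superset) (auto simp: matD_def pmat_def split: if_splits)
    then show ?thesis using that by (simp add: matD_def pmat_def)
  qed
  have fin: "finite {\<zeta>. \<zeta> \<in> parts F \<and> \<mu> \<le> \<zeta> \<and> \<zeta> \<le> \<kappa>}"
    by (rule finite_subset[OF _ finite_partitions_below[of "nvars F" \<kappa>]]) auto
  have "c \<kappa> \<mu> = (inv_binom F \<odot> D \<odot> B) \<kappa> \<mu>"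
    using C_entry[OF assms] unfolding C_eq inv_binom_def by simp
  also have "\<dots> = (\<Sum>\<zeta> | \<zeta> \<in> parts F \<and> \<mu> \<le> \<zeta> \<and> \<zeta> \<le> \<kappa>. (inv_binom F \<odot> D) \<kappa> \<zeta> * B \<zeta> \<mu>)"
    by (rule pmat_mult_superset[OF fin])
      (use triangular_mult[OF I triangular_D] triangular_B in \<open>auto simp: triangular_def\<close>)
  also have "\<dots> = (\<Sum>\<zeta> | \<zeta> \<in> parts F \<and> \<mu> \<le> \<zeta> \<and> \<zeta> \<le> \<kappa>. inv_binom F \<kappa> \<zeta> * binom F \<zeta> \<mu> * ev p \<zeta>)"
    using assms by (intro sum.cong refl) (simp add: ID matB_def pmat_def)
  finally show ?thesis .
qed

definition M :: "'k pmatrix" where "M = commutator Z A"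

lemma Z_mult: "(Z \<odot> X) \<kappa> \<mu> = (if \<kappa> \<in> parts F then snorm F \<kappa> * X \<kappa> \<mu> else 0)"
proof -
  have "(Z \<odot> X) \<kappa> \<mu> = (\<Sum>\<zeta>\<in>{\<kappa>}. Z \<kappa> \<zeta> * X \<zeta> \<mu>)"
    by (rule pmat_mult_superset) (auto simp: matZ_def pmat_def split: if_splits)
  then show ?thesis by (simp add: matZ_def pmat_def)
qed

lemma mult_Z: "(X \<odot> Z) \<kappa> \<mu> = (if \<mu> \<in> parts F then X \<kappa> \<mu> * snorm F \<mu> else 0)"
proof -
  have "(X \<odot> Z) \<kappa> \<mu> = (\<Sum>\<zeta>\<in>{\<mu>}. X \<kappa> \<zeta> * Z \<zeta> \<mu>)"
    by (rule pmat_mult_superset) (auto simp: matZ_def pmat_def split: if_splits)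
  then show ?thesis by (simp add: matZ_def pmat_def)
qed

lemma commutator_Z:
  assumes "triangular (nvars F) X"
  shows "commutator Z X \<kappa> \<mu> = (if \<kappa> \<in> parts F \<and> \<mu> \<in> parts F then (snorm F \<kappa> - snorm F \<mu>) * X \<kappa> \<mu> else 0)"
  using assms unfolding commutator_def Z_mult mult_Z triangular_def by (auto simp: algebra_simps)

lemma M_entry: "M \<kappa> \<mu> = (if \<kappa> \<in> parts F \<and> \<mu> \<in> parts F then (snorm F \<kappa> - snorm F \<mu>) * adj_binom F \<kappa> \<mu> else 0)"
  unfolding M_def commutator_Z[OF triangular_A] by (simp add: matA_def pmat_def)

lemma triangular_M: "triangular (nvars F) M"
  by (auto simp: triangular_def M_entry adj_binom_def covers_def split: if_splits)

lemma mult_M: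
  "\<mu> \<in> parts F \<Longrightarrow> (X \<odot> M) \<kappa> \<mu> = (\<Sum>\<zeta> | \<zeta> \<in> parts F \<and> covers (nvars F) \<zeta> \<mu>.
    X \<kappa> \<zeta> * ((snorm F \<zeta> - snorm F \<mu>) * adj_binom F \<zeta> \<mu>))"
proof -
  assume \<mu>: "\<mu> \<in> parts F"
  have fin: "finite {\<zeta>. \<zeta> \<in> parts F \<and> covers (nvars F) \<zeta> \<mu>}"
    by (rule finite_subset[OF _ finite_partitions_size[of "nvars F" "Suc (size_of F \<mu>)"]]) (auto simp: covers_def)
  have "(X \<odot> M) \<kappa> \<mu> = (\<Sum>\<zeta> | \<zeta> \<in> parts F \<and> covers (nvars F) \<zeta> \<mu>. X \<kappa> \<zeta> * M \<zeta> \<mu>)"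
    by (rule pmat_mult_superset[OF fin]) (auto simp: M_entry adj_binom_def split: if_splits)
  also have "\<dots> = (\<Sum>\<zeta> | \<zeta> \<in> parts F \<and> covers (nvars F) \<zeta> \<mu>.
    X \<kappa> \<zeta> * ((snorm F \<zeta> - snorm F \<mu>) * adj_binom F \<zeta> \<mu>))"
    using \<mu> by (intro sum.cong refl) (simp add: M_entry)
  finally show ?thesis .
qed

lemma M_mult:
  "\<kappa> \<in> parts F \<Longrightarrow> (M \<odot> X) \<kappa> \<mu> = (\<Sum>\<zeta> | \<zeta> \<in> parts F \<and> covers (nvars F) \<kappa> \<zeta>.
    (snorm F \<kappa> - snorm F \<zeta>) * adj_binom F \<kappa> \<zeta> * X \<zeta> \<mu>)"
proof -
  assume \<kappa>: "\<kappa> \<in> parts F"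
  have fin: "finite {\<zeta>. \<zeta> \<in> parts F \<and> covers (nvars F) \<kappa> \<zeta>}"
    by (rule finite_subset[OF _ finite_partitions_below[of "nvars F" \<kappa>]]) (auto simp: covers_def)
  have "(M \<odot> X) \<kappa> \<mu> = (\<Sum>\<zeta> | \<zeta> \<in> parts F \<and> covers (nvars F) \<kappa> \<zeta>. M \<kappa> \<zeta> * X \<zeta> \<mu>)"
    by (rule pmat_mult_superset[OF fin]) (auto simp: M_entry adj_binom_def split: if_splits)
  also have "\<dots> = (\<Sum>\<zeta> | \<zeta> \<in> parts F \<and> covers (nvars F) \<kappa> \<zeta>.
    (snorm F \<kappa> - snorm F \<zeta>) * adj_binom F \<kappa> \<zeta> * X \<zeta> \<mu>)"
    using \<kappa> by (intro sum.cong refl) (simp add: M_entry)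
  finally show ?thesis .
qed

text \<open>The Pieri formula [Z, B] = B M with M = [Z, A], solved for B Z so that it can be used to
  rewrite.\<close>

lemma pieri_matrix: "B \<odot> Z = (\<lambda>\<kappa> \<mu>. (Z \<odot> B) \<kappa> \<mu> - (B \<odot> M) \<kappa> \<mu>)"
proof (intro ext)
  fix \<kappa> \<mu>
  show "(B \<odot> Z) \<kappa> \<mu> = (Z \<odot> B) \<kappa> \<mu> - (B \<odot> M) \<kappa> \<mu>"
  proof (cases "\<kappa> \<in> parts F \<and> \<mu> \<in> parts F")
    case True
    then have "(B \<odot> M) \<kappa> \<mu> = (snorm F \<kappa> - snorm F \<mu>) * binom F \<kappa> \<mu>"
      by (simp add: mult_M pieri matB_def pmat_def cong: sum.cong_simp)
    then show ?thesis using True by (simp add: Z_mult mult_Z matB_def pmat_def algebra_simps)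
  next
    case False
    moreover have "(B \<odot> M) \<kappa> \<mu> = 0"
      using False triangular_mult[OF triangular_B triangular_M] by (auto simp: triangular_def)
    ultimately show ?thesis by (auto simp: Z_mult mult_Z matB_def pmat_def)
  qed
qed

text \<open>After multiplication by \<open>B\<close>: BZC = ZBC - BMC = DZB - BMC, because
  \<open>Z\<close> and \<open>D\<close> are diagonal and commute, and BCZ = DBZ = DZB - DBM = DZB -
  BCM. The difference is B(CM - MC), and \<open>B\<close> cancels.\<close>

lemma commutator_C: "commutator Z C = commutator C M"
proof (rule cancel_B)
  note T = triangular_B triangular_C triangular_D triangular_Z triangular_M
  note R = T[THEN rf]
  have ZD: "Z \<odot> D = D \<odot> Z"
    by (intro ext) (auto simp: Z_mult mult_Z matD_def pmat_def)
  have "B \<odot> commutator Z C = (\<lambda>\<kappa> \<mu>. (B \<odot> (Z \<odot> C)) \<kappa> \<mu> - (B \<odot> (C \<odot> Z)) \<kappa> \<mu>)"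
    unfolding commutator_def by (rule pmat_mult_diff_right[OF R(1)])
  also have "B \<odot> (Z \<odot> C) = (B \<odot> Z) \<odot> C"
    by (simp add: pmat_mult_assoc R)
  also have "\<dots> = (\<lambda>\<kappa> \<mu>. (Z \<odot> B \<odot> C) \<kappa> \<mu> - (B \<odot> M \<odot> C) \<kappa> \<mu>)"
    unfolding pieri_matrix by (intro pmat_mult_diff_left row_finite_mult R)
  also have "Z \<odot> B \<odot> C = D \<odot> (Z \<odot> B)"
    by (metis B_C ZD pmat_mult_assoc R)
  also have "B \<odot> (C \<odot> Z) = D \<odot> (B \<odot> Z)"
    by (metis B_C pmat_mult_assoc R)
  also have "\<dots> = (\<lambda>\<kappa> \<mu>. (D \<odot> (Z \<odot> B)) \<kappa> \<mu> - (D \<odot> (B \<odot> M)) \<kappa> \<mu>)"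
    unfolding pieri_matrix by (rule pmat_mult_diff_right[OF R(3)])
  also have "D \<odot> (B \<odot> M) = B \<odot> (C \<odot> M)"
    by (metis B_C pmat_mult_assoc R)
  also have "B \<odot> M \<odot> C = B \<odot> (M \<odot> C)"
    by (simp add: pmat_mult_assoc R)
  finally have "B \<odot> commutator Z C = (\<lambda>\<kappa> \<mu>. (B \<odot> (C \<odot> M)) \<kappa> \<mu> - (B \<odot> (M \<odot> C)) \<kappa> \<mu>)"
    by simp
  also have "\<dots> = B \<odot> commutator C M"
    unfolding commutator_def by (rule pmat_mult_diff_right[OF R(1), symmetric])
  finally show "B \<odot> commutator Z C = B \<odot> commutator C M" .
  show "commutator Z C \<kappa> \<mu> \<noteq> 0 \<Longrightarrow> \<kappa> \<in> parts F" for \<kappa> \<mu>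
    by (simp add: commutator_Z[OF triangular_C] split: if_splits)
  show "commutator C M \<kappa> \<mu> \<noteq> 0 \<Longrightarrow> \<kappa> \<in> parts F" for \<kappa> \<mu>
  proof -
    assume "commutator C M \<kappa> \<mu> \<noteq> 0"
    then have "(C \<odot> M) \<kappa> \<mu> \<noteq> 0 \<or> (M \<odot> C) \<kappa> \<mu> \<noteq> 0" by (auto simp: commutator_def)
    then show "\<kappa> \<in> parts F"
      using triangular_mult[OF T(2,5)] triangular_mult[OF T(5,2)] unfolding triangular_def by blast
  qed
qed

lemma structure_coeff_vanishing: "structure_vanishing F c"
  unfolding structure_vanishing_def
proof (intro ballI impI)
  fix \<kappa> \<mu> assume *: "\<kappa> \<in> parts F" "\<mu> \<in> parts F" "size_of F \<kappa> \<le> size_of F \<mu> \<and> \<kappa> \<noteq> \<mu>"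
  then have "\<not> \<mu> \<le> \<kappa>" using psize_strict_mono[of \<mu> \<kappa> "nvars F"] by auto
  then show "c \<kappa> \<mu> = 0" using triangular_C C_entry * unfolding triangular_def by metis
qed

lemma structure_coeff_recursion: "structure_recursion F p c"
  unfolding structure_recursion_def
proof (intro conjI ballI impI)
  fix \<kappa> assume \<kappa>: "\<kappa> \<in> parts F"
  have "ev p \<kappa> = (D \<odot> B) \<kappa> \<kappa>"
  proof -
    have "(D \<odot> B) \<kappa> \<kappa> = (\<Sum>\<zeta>\<in>{\<kappa>}. D \<kappa> \<zeta> * B \<zeta> \<kappa>)"
      by (rule pmat_mult_superset) (auto simp: matD_def pmat_def split: if_splits)
    then show ?thesis using \<kappa> by (simp add: B_diag matD_def pmat_def)
  qed
  also have "\<dots> = (\<Sum>\<zeta>\<in>{\<kappa>}. B \<kappa> \<zeta> * C \<zeta> \<kappa>)"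
    unfolding B_C[symmetric]
    by (rule pmat_mult_superset)
      (use triangular_B triangular_C in \<open>auto simp: triangular_def intro: antisym\<close>)
  also have "\<dots> = c \<kappa> \<kappa>" using \<kappa> by (simp add: B_diag C_entry)
  finally show "c \<kappa> \<kappa> = ev p \<kappa>" ..
next
  fix \<kappa> \<mu> assume \<kappa>\<mu>: "\<kappa> \<in> parts F" "\<mu> \<in> parts F"
  have "(snorm F \<kappa> - snorm F \<mu>) * c \<kappa> \<mu> = commutator Z C \<kappa> \<mu>"
    using \<kappa>\<mu> by (simp add: commutator_Z[OF triangular_C] C_entry)
  also have "\<dots> = (C \<odot> M) \<kappa> \<mu> - (M \<odot> C) \<kappa> \<mu>"
    unfolding commutator_C by (simp add: commutator_def)
  finally show "(snorm F \<kappa> - snorm F \<mu>) * c \<kappa> \<mu> =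
      (\<Sum>\<zeta> | \<zeta> \<in> parts F \<and> covers (nvars F) \<zeta> \<mu>. c \<kappa> \<zeta> * (snorm F \<zeta> - snorm F \<mu>) * adj_binom F \<zeta> \<mu>)
      - (\<Sum>\<zeta> | \<zeta> \<in> parts F \<and> covers (nvars F) \<kappa> \<zeta>. (snorm F \<kappa> - snorm F \<zeta>) * adj_binom F \<kappa> \<zeta> * c \<zeta> \<mu>)"
    using \<kappa>\<mu> by (simp add: mult_M M_mult C_entry mult.assoc cong: sum.cong_simp)
qed

text \<open>Every coefficient on the right of the recursion belongs to a pair whose size difference
  is smaller by one, and the factor on the left is invertible by \<open>snorm_neq\<close>.\<close>

lemma recursion_unique:
  assumes "structure_vanishing F c1" "structure_recursion F p c1"
    and "structure_vanishing F c2" "structure_recursion F p c2"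
    and "\<kappa> \<in> parts F" "\<mu> \<in> parts F"
  shows "c1 \<kappa> \<mu> = c2 \<kappa> \<mu>"
  using assms(5,6)
proof (induction "size_of F \<kappa> - size_of F \<mu>" arbitrary: \<kappa> \<mu> rule: less_induct)
  case less
  show ?case
  proof (cases "size_of F \<mu> < size_of F \<kappa>")
    case True
    have rec: "(snorm F \<kappa> - snorm F \<mu>) * e \<kappa> \<mu> =
          (\<Sum>\<zeta> | \<zeta> \<in> parts F \<and> covers (nvars F) \<zeta> \<mu>. e \<kappa> \<zeta> * (snorm F \<zeta> - snorm F \<mu>) * adj_binom F \<zeta> \<mu>)
        - (\<Sum>\<zeta> | \<zeta> \<in> parts F \<and> covers (nvars F) \<kappa> \<zeta>. (snorm F \<kappa> - snorm F \<zeta>) * adj_binom F \<kappa> \<zeta> * e \<zeta> \<mu>)"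
      if "structure_recursion F p e" for e
      using that True less.prems unfolding structure_recursion_def by blast
    have "c1 \<kappa> \<zeta> = c2 \<kappa> \<zeta>" if "\<zeta> \<in> parts F" "covers (nvars F) \<zeta> \<mu>" for \<zeta>
      by (rule less.hyps) (use that True less.prems in \<open>auto simp: covers_def\<close>)
    moreover have "c1 \<zeta> \<mu> = c2 \<zeta> \<mu>" if "\<zeta> \<in> parts F" "covers (nvars F) \<kappa> \<zeta>" for \<zeta>
      by (rule less.hyps) (use that True less.prems in \<open>auto simp: covers_def\<close>)
    ultimately have "(snorm F \<kappa> - snorm F \<mu>) * c1 \<kappa> \<mu> = (snorm F \<kappa> - snorm F \<mu>) * c2 \<kappa> \<mu>"
      unfolding rec[OF assms(2)] rec[OF assms(4)] by (auto intro!: arg_cong2[where f = "(-)"] sum.cong)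
    then show ?thesis using snorm_neq[OF less.prems True] by simp
  next
    case False
    show ?thesis
    proof (cases "\<kappa> = \<mu>")
      case True
      then show ?thesis using assms(2,4) less.prems unfolding structure_recursion_def by auto
    next
      case neq: False
      then show ?thesis
        using assms(1,3) less.prems False unfolding structure_vanishing_def by (metis not_less)
    qed
  qed
qed

text \<open>Arrays are functions on all pairs, while both predicates see only the entries at
  partitions; uniqueness is meant on those.\<close>

lemma recursion_cong:
  assumes "\<And>\<kappa> \<mu>. \<kappa> \<in> parts F \<Longrightarrow> \<mu> \<in> parts F \<Longrightarrow> c1 \<kappa> \<mu> = c2 \<kappa> \<mu>"
  shows "structure_vanishing F c1 = structure_vanishing F c2"
    and "structure_recursion F p c1 = structure_recursion F p c2"
  unfolding structure_vanishing_def structure_recursion_def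
  using assms by (simp_all cong: sum.cong_simp)

theorem main:
  "(\<forall>e. structure_vanishing F e \<and> structure_recursion F p e \<longleftrightarrow>
      (\<forall>\<kappa>\<in>parts F. \<forall>\<mu>\<in>parts F. e \<kappa> \<mu> = c \<kappa> \<mu>)) \<and>
    C = pmat_inverse F B \<odot> D \<odot> B \<and>
    commutator Z C = commutator C (commutator Z A) \<and>
    (\<forall>\<kappa>\<in>parts F. \<forall>\<mu>\<in>parts F. c \<kappa> \<mu> =
      (\<Sum>\<zeta> | \<zeta> \<in> parts F \<and> \<mu> \<le> \<zeta> \<and> \<zeta> \<le> \<kappa>. inv_binom F \<kappa> \<zeta> * binom F \<zeta> \<mu> * ev p \<zeta>))"
proof (intro conjI allI iffI ballI)
  fix e \<kappa> \<mu> assume "structure_vanishing F e \<and> structure_recursion F p e" "\<kappa> \<in> parts F" "\<mu> \<in> parts F"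
  then show "e \<kappa> \<mu> = c \<kappa> \<mu>"
    using recursion_unique structure_coeff_vanishing structure_coeff_recursion by blast
next
  fix e assume "\<forall>\<kappa>\<in>parts F. \<forall>\<mu>\<in>parts F. e \<kappa> \<mu> = c \<kappa> \<mu>"
  then show "structure_vanishing F e" "structure_recursion F p e"
    using recursion_cong[of e c] structure_coeff_vanishing structure_coeff_recursion by blast+
next
  show "C = pmat_inverse F B \<odot> D \<odot> B" by (rule C_eq)
  show "commutator Z C = commutator C (commutator Z A)" using commutator_C by (simp add: M_def)
qed (rule C_entry_sum)

end

end

section \<open>Laurent polynomials as functions\<close>

lemma meval_mult: "meval \<alpha> (\<lambda>i. x i * y i) = meval \<alpha> x * meval \<alpha> y"
  unfolding meval_def by (simp add: power_int_mult_distrib prod.distrib)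

text \<open>In characteristic 0 the element 2 is no root of unity, so a coordinate equal to 2
  separates exponents.\<close>

lemma two_powi_inj:
  assumes "(2 :: 'k::field_char_0) powi a = 2 powi b"
  shows "a = b"
proof -
  have False if "(2 :: 'k) powi a = 2 powi b" "a < b" for a b
  proof -
    have "(2 :: 'k) powi b = 2 powi a * 2 powi (b - a)"
      by (subst power_int_add[symmetric]) auto
    then have "(2 :: 'k) powi (b - a) = 1" using that(1) by simp
    then have "(2 :: 'k) ^ nat (b - a) = 1" using that(2) by (simp add: power_int_def)
    then have "of_nat (2 ^ nat (b - a)) = (of_nat 1 :: 'k)" by simp
    then have "2 ^ nat (b - a) = (1 :: nat)" by (simp only: of_nat_eq_iff)
    then show False using that(2) by simp
  qed
  from this[of a b] this[of b a] assms show ?thesis by (metis linorder_cases)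
qed

text \<open>Artin's argument for the linear independence of characters.\<close>

lemma meval_independent:
  fixes c :: "(nat \<Rightarrow>\<^sub>0 int) \<Rightarrow> 'k::field_char_0"
  assumes "finite S" "\<And>x. (\<And>i. x i \<noteq> 0) \<Longrightarrow> (\<Sum>\<alpha>\<in>S. c \<alpha> * meval \<alpha> x) = 0" "\<alpha> \<in> S"
  shows "c \<alpha> = 0"
  using assms
proof (induction S arbitrary: c \<alpha> rule: finite_induct)
  case (insert \<alpha>0 S)
  have S0: "c \<alpha>1 = 0" if \<alpha>1: "\<alpha>1 \<in> S" for \<alpha>1
  proof -
    have "\<alpha>1 \<noteq> \<alpha>0" using that insert by auto
    then obtain i where i: "lookup \<alpha>1 i \<noteq> lookup \<alpha>0 i"
      by (metis poly_mapping_eqI)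
    define z where "z = (\<lambda>j. if j = i then 2 else (1::'k))"
    have mz: "meval \<alpha> z = 2 powi lookup \<alpha> i" for \<alpha>
    proof -
      have "meval \<alpha> z = (\<Prod>j\<in>insert i (keys \<alpha>). z j powi lookup \<alpha> j)"
        by (rule meval_superset) auto
      also have "\<dots> = (\<Prod>j\<in>{i}. z j powi lookup \<alpha> j)"
        by (rule prod.mono_neutral_right) (auto simp: z_def)
      finally show ?thesis by (simp add: z_def)
    qed
    have "c \<alpha>1 * (meval \<alpha>1 z - meval \<alpha>0 z) = 0"
    proof (rule insert.IH[of "\<lambda>\<alpha>. c \<alpha> * (meval \<alpha> z - meval \<alpha>0 z)"])
      fix x :: "nat \<Rightarrow> 'k" assume x: "\<And>i. x i \<noteq> 0"
      have "0 = (\<Sum>\<alpha>\<in>insert \<alpha>0 S. c \<alpha> * meval \<alpha> (\<lambda>i. x i * z i))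
          - meval \<alpha>0 z * (\<Sum>\<alpha>\<in>insert \<alpha>0 S. c \<alpha> * meval \<alpha> x)"
        using insert.prems(1)[of x] insert.prems(1)[of "\<lambda>i. x i * z i"] x by (simp add: z_def)
      also have "\<dots> = (\<Sum>\<alpha>\<in>insert \<alpha>0 S. c \<alpha> * (meval \<alpha> z - meval \<alpha>0 z) * meval \<alpha> x)"
        unfolding meval_mult sum_distrib_left sum_subtractf[symmetric]
        by (rule sum.cong[OF refl]) (simp add: algebra_simps)
      also have "\<dots> = (\<Sum>\<alpha>\<in>S. c \<alpha> * (meval \<alpha> z - meval \<alpha>0 z) * meval \<alpha> x)"
        using insert.hyps by simp
      finally show "(\<Sum>\<alpha>\<in>S. c \<alpha> * (meval \<alpha> z - meval \<alpha>0 z) * meval \<alpha> x) = 0" ..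
    qed fact
    moreover have "meval \<alpha>1 z \<noteq> meval \<alpha>0 z" using i two_powi_inj unfolding mz by blast
    ultimately show ?thesis by simp
  qed
  have "0 = (\<Sum>\<alpha>\<in>insert \<alpha>0 S. c \<alpha> * meval \<alpha> (\<lambda>_. 1))" using insert.prems(1)[of "\<lambda>_. 1"] by simp
  also have "\<dots> = c \<alpha>0" using insert.hyps S0 by (simp add: meval_def)
  finally show ?case using S0 insert.prems(2) by auto
qed simp

text \<open>Points without zero coordinates suffice, and at them evaluation is multiplicative even
  for negative exponents.\<close>

lemma lpoly_eqI:
  fixes f g :: "'k::field_char_0 laurent"
  assumes "\<And>x. (\<And>i. x i \<noteq> 0) \<Longrightarrow> lpoly_eval f x = lpoly_eval g x"
  shows "f = g"
proof (rule poly_mapping_eqI)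
  fix \<alpha>
  let ?S = "insert \<alpha> (keys f \<union> keys g)"
  have "lookup f \<alpha> - lookup g \<alpha> = 0"
  proof (rule meval_independent[of ?S "\<lambda>\<alpha>. lookup f \<alpha> - lookup g \<alpha>"])
    fix x :: "nat \<Rightarrow> 'k" assume "\<And>i. x i \<noteq> 0"
    then have "lpoly_eval f x - lpoly_eval g x = 0" using assms by simp
    moreover have "lpoly_eval f x = (\<Sum>\<alpha>\<in>?S. lookup f \<alpha> * meval \<alpha> x)"
      "lpoly_eval g x = (\<Sum>\<alpha>\<in>?S. lookup g \<alpha> * meval \<alpha> x)"
      by (rule lpoly_eval_superset; auto)+
    ultimately show "(\<Sum>\<alpha>\<in>?S. (lookup f \<alpha> - lookup g \<alpha>) * meval \<alpha> x) = 0"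
      by (simp only: left_diff_distrib sum_subtractf)
  qed auto
  then show "lookup f \<alpha> = lookup g \<alpha>" by simp
qed

lemma lookup_map_key_permutes:
  "\<sigma> permutes A \<Longrightarrow> lookup (map_key \<sigma> \<alpha>) i = lookup \<alpha> (\<sigma> i)"
  using map_key.rep_eq[of \<sigma> \<alpha>] by (simp add: permutes_inj)

lemma meval_permute:
  assumes "\<sigma> permutes A"
  shows "meval \<alpha> (x \<circ> \<sigma>) = meval (map_key (inv \<sigma>) \<alpha>) x"
proof -
  have inv: "inv \<sigma> permutes A" by (rule permutes_inv[OF assms])
  have "meval (map_key (inv \<sigma>) \<alpha>) x =
    (\<Prod>j\<in>\<sigma> ` keys \<alpha>. x j powi lookup (map_key (inv \<sigma>) \<alpha>) j)"
  proof (rule meval_superset)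
    show "keys (map_key (inv \<sigma>) \<alpha>) \<subseteq> \<sigma> ` keys \<alpha>"
    proof
      fix j assume "j \<in> keys (map_key (inv \<sigma>) \<alpha>)"
      then have "inv \<sigma> j \<in> keys \<alpha>"
        by (simp add: in_keys_iff lookup_map_key_permutes[OF inv])
      then show "j \<in> \<sigma> ` keys \<alpha>"
        using permutes_inverses(1)[OF assms, of j] by (metis imageI)
    qed
  qed simp
  also have "\<dots> = (\<Prod>i\<in>keys \<alpha>. x (\<sigma> i) powi lookup \<alpha> i)"
    by (subst prod.reindex)
      (simp_all add: lookup_map_key_permutes[OF inv] permutes_inverses(2)[OF assms]
        inj_on_subset[OF permutes_inj[OF assms]])
  finally show ?thesis by (simp add: meval_def)
qed

lemma map_key_inverse:
  assumes "\<sigma> permutes A"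
  shows "map_key \<sigma> (map_key (inv \<sigma>) \<alpha>) = \<alpha>"
    and "map_key (inv \<sigma>) (map_key \<sigma> \<alpha>) = \<alpha>"
  by (rule poly_mapping_eqI,
      simp add: lookup_map_key_permutes[OF assms] lookup_map_key_permutes[OF permutes_inv[OF assms]]
        permutes_inverses[OF assms])+

text \<open>Symmetry of coefficients is traded for symmetry of values, from which closure under
  products follows at once.\<close>

lemma is_symmetric_iff:
  fixes f :: "'k::field_char_0 laurent"
  shows "is_symmetric n f \<longleftrightarrow>
    (\<forall>\<sigma>. \<sigma> permutes {1..n} \<longrightarrow> (\<forall>x. (\<forall>i. x i \<noteq> 0) \<longrightarrow> lpoly_eval f (x \<circ> \<sigma>) = lpoly_eval f x))"
proof (intro iffI allI impI)
  fix \<sigma> and x :: "nat \<Rightarrow> 'k"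
  assume f: "is_symmetric n f" and \<sigma>: "\<sigma> permutes {1..n}"
  let ?m = "map_key (inv \<sigma>)"
  have sym: "lookup f (?m \<alpha>) = lookup f \<alpha>" for \<alpha>
    using f permutes_inv[OF \<sigma>] unfolding is_symmetric_def by blast
  have bij: "bij_betw ?m (keys f) (keys f)"
  proof (rule bij_betwI)
    show "?m \<in> keys f \<rightarrow> keys f" by (auto simp: in_keys_iff sym)
    show "map_key \<sigma> \<in> keys f \<rightarrow> keys f"
      using f \<sigma> by (auto simp: in_keys_iff is_symmetric_def)
  qed (auto simp: map_key_inverse[OF \<sigma>])
  have "lpoly_eval f (x \<circ> \<sigma>) = (\<Sum>\<alpha>\<in>keys f. lookup f (?m \<alpha>) * meval (?m \<alpha>) x)"
    by (simp add: lpoly_eval_superset[OF finite_keys subset_refl] meval_permute[OF \<sigma>] sym)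
  also have "\<dots> = (\<Sum>\<alpha>\<in>keys f. lookup f \<alpha> * meval \<alpha> x)"
    by (rule sum.reindex_bij_betw[OF bij])
  also have "\<dots> = lpoly_eval f x" by (simp add: lpoly_eval_superset[OF finite_keys subset_refl])
  finally show "lpoly_eval f (x \<circ> \<sigma>) = lpoly_eval f x" .
next
  assume ev: "\<forall>\<sigma>. \<sigma> permutes {1..n} \<longrightarrow>
    (\<forall>x. (\<forall>i. x i \<noteq> 0) \<longrightarrow> lpoly_eval f (x \<circ> \<sigma>) = lpoly_eval f x)"
  show "is_symmetric n f"
    unfolding is_symmetric_def
  proof (intro allI impI)
    fix \<sigma> \<alpha> assume \<sigma>: "\<sigma> permutes {1..n}"
    have inv: "inv \<sigma> permutes {1..n}" by (rule permutes_inv[OF \<sigma>])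
    let ?m = "map_key \<sigma> :: (nat \<Rightarrow>\<^sub>0 int) \<Rightarrow> _"
    \<comment> \<open>The polynomial with permuted exponents; it takes the values of
      \<open>f\<close> at permuted points.\<close>
    define g where "g = (\<Sum>\<beta>\<in>keys f. single (?m \<beta>) (lookup f \<beta>))"
    have "f = g"
    proof (rule lpoly_eqI)
      fix x :: "nat \<Rightarrow> 'k" assume x: "\<And>i. x i \<noteq> 0"
      have "lpoly_eval g x = lpoly_eval f (x \<circ> inv \<sigma>)"
        unfolding g_def
        by (simp add: lpoly_eval_sum lpoly_eval_single meval_permute[OF inv] permutes_inv_inv[OF \<sigma>]
          lpoly_eval_superset[of "keys f" f])
      also have "\<dots> = lpoly_eval f x" using ev inv x by blast
      finally show "lpoly_eval f x = lpoly_eval g x" ..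
    qed
    have "?m \<beta> = ?m \<alpha> \<longleftrightarrow> \<beta> = \<alpha>" for \<beta>
      using map_key_inverse(2)[OF \<sigma>] by metis
    then have "lookup g (?m \<alpha>) = lookup f \<alpha>"
      unfolding g_def by (simp add: lookup_sum lookup_single when_def in_keys_iff)
    then show "lookup f (?m \<alpha>) = lookup f \<alpha>"
      unfolding \<open>f = g\<close>[symmetric] .
  qed
qed

section \<open>Partitions are determined by their orbit\<close>

text \<open>Pigeonhole: if \<mu> exceeded \<kappa> in row \<open>i\<close>, \<sigma> would map
  \<open>{1..i}\<close> injectively into \<open>{1..<i}\<close>. The opposite inequality follows
  from the inverse permutation.\<close>

lemma partition_permute_eq:
  assumes "\<kappa> \<in> partitions n" "\<mu> \<in> partitions n" "\<sigma> permutes {1..n}" "\<And>i. i \<in> {1..n} \<Longrightarrow> \<kappa> (\<sigma> i) = \<mu> i"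
  shows "\<kappa> = \<mu>"
proof -
  have le: "\<mu> i \<le> \<kappa> i"
    if \<kappa>: "\<kappa> \<in> partitions n" and \<mu>: "\<mu> \<in> partitions n" and \<sigma>: "\<sigma> permutes {1..n}"
      and eq: "\<And>i. i \<in> {1..n} \<Longrightarrow> \<kappa> (\<sigma> i) = \<mu> i" and i: "i \<in> {1..n}" for \<kappa> \<mu> \<sigma> i
  proof (rule ccontr)
    assume less: "\<not> \<mu> i \<le> \<kappa> i"
    have "\<sigma> j \<in> {1..<i}" if j: "j \<in> {1..i}" for j
    proof -
      have \<sigma>j: "\<sigma> j \<in> {1..n}" using permutes_in_image[OF \<sigma>] j i by auto
      moreover have "\<sigma> j < i"
      proof (rule ccontr)
        assume "\<not> \<sigma> j < i"
        then have "\<kappa> (\<sigma> j) \<le> \<kappa> i" using \<kappa> i \<sigma>j by (auto simp: partitions_def)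
        moreover have "\<mu> i \<le> \<mu> j" using \<mu> i j by (auto simp: partitions_def)
        moreover have "\<kappa> (\<sigma> j) = \<mu> j" using eq i j by simp
        ultimately show False using less by simp
      qed
      ultimately show ?thesis by simp
    qed
    then have "\<sigma> ` {1..i} \<subseteq> {1..<i}" by auto
    then have "card (\<sigma> ` {1..i}) \<le> card {1..<i}" by (rule card_mono[rotated]) simp
    moreover have "card (\<sigma> ` {1..i}) = card {1..i}"
      by (rule card_image) (rule inj_on_subset[OF permutes_inj[OF \<sigma>]], simp)
    ultimately show False using i by (simp, arith)
  qed
  show ?thesis
  proof
    fix i
    show "\<kappa> i = \<mu> i"
    proof (cases "i \<in> {1..n}")
      case True
      have "\<mu> (inv \<sigma> j) = \<kappa> j" if "j \<in> {1..n}" for j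
        using assms(4)[of "inv \<sigma> j"] that permutes_in_image[OF permutes_inv[OF assms(3)]]
        by (simp add: permutes_inverses(1)[OF assms(3)])
      then have "\<kappa> i \<le> \<mu> i" using le[OF assms(2,1) permutes_inv[OF assms(3)]] True by blast
      moreover have "\<mu> i \<le> \<kappa> i" using le[OF assms(1-4)] True by blast
      ultimately show ?thesis by simp
    next
      case False
      then show ?thesis using assms(1,2) by (simp add: partitions_def)
    qed
  qed
qed

section \<open>From the vanishing property to the interpolation locale\<close>

text \<open>\<open>good\<close> holds the coordinate values at which evaluation is multiplicative
  and polynomial in \<open>y\<close>: everything for generators that are powers, the nonzero
  elements when inverses occur. \<open>polyfun_ev\<close> converts degree
  \<open>degfac F * d\<close> in \<open>x\<close> into degree \<open>d\<close> in
  \<open>y\<close>.\<close>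

locale family =
  fixes F :: "'k::field_char_0 interp_family" and gen :: "nat \<Rightarrow> 'k laurent"
    and y :: "'k \<Rightarrow> 'k" and pt :: "nat \<Rightarrow> nat \<Rightarrow> 'k" and good :: "'k set"
  assumes Lam_eq: "Lam F = {f \<in> subalgebra {gen i |i. i \<in> {1..nvars F}}. is_symmetric (nvars F) f}"
    and shift_eq: "shift F = (\<lambda>\<kappa> i. pt i (\<kappa> i))"
    and nrm_eq: "nrm F = (\<lambda>x. \<Sum>i = 1..nvars F. y (x i))"
    and degfac_gt_0: "0 < degfac F"
    and vanishing: "\<And>d. vanishing (nvars F) pt y d"
    and polyfun_ev: "\<And>f d. f \<in> subalgebra {gen i |i. i \<in> {1..nvars F}} \<Longrightarrow> ldegree f \<le> degfac F * d \<Longrightarrow>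
      \<exists>G. polyfun {1..nvars F} {..d} G \<and> (\<forall>x. (\<forall>i. x i \<in> good) \<longrightarrow> lpoly_eval f x = G (\<lambda>i. y (x i)))"
    and good_mult: "\<And>f g x. f \<in> subalgebra {gen i |i. i \<in> {1..nvars F}} \<Longrightarrow>
      g \<in> subalgebra {gen i |i. i \<in> {1..nvars F}} \<Longrightarrow> (\<And>i. x i \<in> good) \<Longrightarrow>
      lpoly_eval (f * g) x = lpoly_eval f x * lpoly_eval g x"
    and gen_ev: "\<And>i x. (\<And>i. x i \<in> good) \<Longrightarrow> lpoly_eval (gen i) x = y (x i)"
    and gen_degree: "\<And>i. ldegree (gen i) \<le> degfac F"
    and nonzero_good: "\<And>z. z \<noteq> 0 \<Longrightarrow> z \<in> good"
    and pt_good: "\<And>i m. pt i m \<in> good"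
    and y_pt_inj: "\<And>i. inj (\<lambda>m. y (pt i m))"
    and snorm_neq: "\<And>\<kappa> \<mu>. \<kappa> \<in> parts F \<Longrightarrow> \<mu> \<in> parts F \<Longrightarrow> size_of F \<mu> < size_of F \<kappa> \<Longrightarrow> snorm F \<kappa> \<noteq> snorm F \<mu>"
begin

abbreviation n :: nat where "n \<equiv> nvars F"

definition S :: "'k laurent set" where "S = subalgebra {gen i |i. i \<in> {1..n}}"

lemma S_Const: "Const c \<in> S" and S_add: "f \<in> S \<Longrightarrow> g \<in> S \<Longrightarrow> f + g \<in> S"
  and S_mult: "f \<in> S \<Longrightarrow> g \<in> S \<Longrightarrow> f * g \<in> S"
  unfolding S_def by (fact subalgebra.const subalgebra.add subalgebra.mult)+

lemma gen_S: "i \<in> {1..n} \<Longrightarrow> gen i \<in> S"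
  unfolding S_def by (intro subalgebra.gen) blast

lemmas S_good_mult = good_mult[folded S_def]
lemmas S_polyfun_ev = polyfun_ev[folded S_def]

lemma S_sum: "(\<And>a. a \<in> A \<Longrightarrow> f a \<in> S) \<Longrightarrow> (\<Sum>a\<in>A. f a) \<in> S"
  using S_Const[of 0]
  by (induction A rule: infinite_finite_induct) (auto intro: S_add simp: Const_def)

lemma S_prod: "(\<And>a. a \<in> A \<Longrightarrow> f a \<in> S) \<Longrightarrow> (\<Prod>a\<in>A. f a) \<in> S"
  using S_Const[of 1]
  by (induction A rule: infinite_finite_induct) (auto intro: S_mult simp: Const_def)

lemma S_power: "f \<in> S \<Longrightarrow> f ^ k \<in> S"
  using S_prod[of "{..<k}" "\<lambda>_. f"] by simp

lemma good_prod:
  "(\<And>a. a \<in> A \<Longrightarrow> f a \<in> S) \<Longrightarrow> (\<And>i. x i \<in> good) \<Longrightarrow>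
    lpoly_eval (\<Prod>a\<in>A. f a) x = (\<Prod>a\<in>A. lpoly_eval (f a) x)"
proof (induction A rule: infinite_finite_induct)
  case (insert a A)
  then have "lpoly_eval (f a * (\<Prod>a\<in>A. f a)) x = lpoly_eval (f a) x * lpoly_eval (\<Prod>a\<in>A. f a) x"
    by (intro S_good_mult S_prod) auto
  then show ?case using insert by simp
qed (use lpoly_eval_Const[of 1 x] in \<open>simp_all add: Const_def\<close>)

lemma good_power: "f \<in> S \<Longrightarrow> (\<And>i. x i \<in> good) \<Longrightarrow> lpoly_eval (f ^ k) x = lpoly_eval f x ^ k"
  using good_prod[of "{..<k}" "\<lambda>_. f" x] by simp

lemma Lam_S: "f \<in> Lam F \<Longrightarrow> f \<in> S"
  unfolding Lam_eq S_def by simp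

lemma LamI:
  assumes "f \<in> S"
    and "\<And>\<sigma> x. \<sigma> permutes {1..n} \<Longrightarrow> (\<And>i. x i \<noteq> 0) \<Longrightarrow> lpoly_eval f (x \<circ> \<sigma>) = lpoly_eval f x"
  shows "f \<in> Lam F"
  unfolding Lam_eq S_def[symmetric] using assms by (auto simp: is_symmetric_iff)

lemma Lam_ev:
  "f \<in> Lam F \<Longrightarrow> \<sigma> permutes {1..n} \<Longrightarrow> (\<And>i. x i \<noteq> 0) \<Longrightarrow> lpoly_eval f (x \<circ> \<sigma>) = lpoly_eval f x"
  unfolding Lam_eq by (auto simp: is_symmetric_iff)

lemma infinite_y: "infinite (y ` (- {0}))"
proof
  assume fin: "finite (y ` (- {0}))"
  let ?f = "\<lambda>m. y (pt 1 m)"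
  have "?f ` UNIV \<subseteq> insert (y 0) (y ` (- {0}))" by auto
  then have "finite (range ?f)" using fin finite_subset by blast
  then have "finite (UNIV :: nat set)" by (rule finite_imageD[OF _ y_pt_inj])
  then show False by simp
qed

lemma grid_eq_0:
  assumes "polyfun {1..n} {..d} G" "\<And>x. (\<And>i. x i \<noteq> 0) \<Longrightarrow> G (\<lambda>i. y (x i)) = 0"
  shows "G Y = 0"
proof (rule polyfun_grid[OF _ assms(1), of "\<lambda>_. y ` (- {0})"])
  fix Y assume "\<And>i. i \<in> {1..n} \<Longrightarrow> Y i \<in> y ` (- {0})"
  then have "\<forall>i. \<exists>z. z \<noteq> 0 \<and> (i \<in> {1..n} \<longrightarrow> Y i = y z)" by (metis ComplD imageE insertI1 one_neq_zero)
  then obtain x where x: "\<And>i. x i \<noteq> 0" "\<And>i. i \<in> {1..n} \<Longrightarrow> Y i = y (x i)" by metis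
  show "G Y = 0" using assms(2)[of x] x polyfun_cong_arg[OF assms(1), of Y "\<lambda>i. y (x i)"] by simp
qed (use infinite_y in auto)

text \<open>Coordinates are freed from the first row on. With the rows up to \<open>k\<close> free,
  row \<open>Suc k\<close> can be made arbitrarily long, which gives infinitely many zeros in that
  coordinate.\<close>

lemma partitions_dense:
  assumes G: "polyfun {1..n} {..d} G" and 0: "\<And>\<kappa>. \<kappa> \<in> parts F \<Longrightarrow> G (\<lambda>i. y (pt i (\<kappa> i))) = 0"
  shows "G Y = 0"
proof -
  have "G (\<lambda>i. if i \<le> k then Y i else y (pt i (\<kappa> i))) = 0" if "k \<le> n" "\<kappa> \<in> parts F" for k \<kappa>
    using that
  proof (induction k arbitrary: \<kappa>)
    case 0
    have "G (\<lambda>i. if i \<le> 0 then Y i else y (pt i (\<kappa> i))) = G (\<lambda>i. y (pt i (\<kappa> i)))"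
      by (rule polyfun_cong_arg[OF G]) auto
    then show ?case using assms(2) 0 by simp
  next
    case (Suc k)
    let ?x = "\<lambda>i. if i \<le> k then Y i else y (pt i (\<kappa> i))"
    let ?Z = "(\<lambda>l. y (pt (Suc k) l)) ` {\<kappa> (Suc k)..}"
    have "G (?x(Suc k := Y (Suc k))) = 0"
    proof (rule polyfun_coordinate_eq_0[OF G])
      show "infinite ?Z"
      proof
        assume "finite ?Z"
        then have "finite {\<kappa> (Suc k)..}"
          by (rule finite_imageD) (rule inj_on_subset[OF y_pt_inj subset_UNIV])
        then show False using infinite_Ici by blast
      qed
      fix z assume "z \<in> ?Z"
      then obtain l where l: "\<kappa> (Suc k) \<le> l" "z = y (pt (Suc k) l)" by auto
      \<comment> \<open>Lengthening row \<open>Suc k\<close> to \<open>l\<close> may force earlier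
        rows to grow; that is harmless, since their coordinates have already been replaced by
        \<open>Y\<close>.\<close>
      define \<mu> where "\<mu> = (\<lambda>i. if i \<in> {1..Suc k} then max (\<kappa> i) l else \<kappa> i)"
      have \<kappa>: "\<kappa> j \<le> \<kappa> i" if "1 \<le> i" "i \<le> j" "j \<le> n" for i j
        using Suc.prems(2) that by (auto simp: partitions_def)
      have "\<mu> j \<le> \<mu> i" if ij: "1 \<le> i" "i \<le> j" "j \<le> n" for i j
      proof (cases "j \<le> Suc k")
        case True
        then show ?thesis using \<kappa>[OF ij] ij by (auto simp: \<mu>_def)
      next
        case False
        then have "\<kappa> j \<le> l" using \<kappa>[of "Suc k" j] l ij by simp
        then show ?thesis using \<kappa>[OF ij] False by (auto simp: \<mu>_def)
      qed
      moreover have "\<mu> i = 0" if "i \<notin> {1..n}" for i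
        using that Suc.prems by (auto simp: \<mu>_def partitions_def)
      ultimately have "\<mu> \<in> parts F" unfolding partitions_def by blast
      then have "G (\<lambda>i. if i \<le> k then Y i else y (pt i (\<mu> i))) = 0" using Suc by simp
      moreover have "G (?x(Suc k := z)) = G (\<lambda>i. if i \<le> k then Y i else y (pt i (\<mu> i)))"
        by (rule polyfun_cong_arg[OF G]) (use l in \<open>auto simp: \<mu>_def max_def\<close>)
      ultimately show "G (?x(Suc k := z)) = 0" by simp
    qed
    moreover have "?x(Suc k := Y (Suc k)) = (\<lambda>i. if i \<le> Suc k then Y i else y (pt i (\<kappa> i)))"
      by (auto simp: le_Suc_eq)
    ultimately show ?case by simp
  qed
  from this[of n "\<lambda>_. 0"] have "G (\<lambda>i. if i \<le> n then Y i else y (pt i 0)) = 0"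
    by (simp add: partitions_def)
  moreover have "G (\<lambda>i. if i \<le> n then Y i else y (pt i 0)) = G Y"
    by (rule polyfun_cong_arg[OF G]) auto
  ultimately show ?thesis by simp
qed

section \<open>Symmetrized monomials in the generators\<close>

text \<open>The sum runs over all permutations and so counts each monomial as often as the
  stabilizer of \<kappa> has elements, a nonzero factor in characteristic 0.\<close>

definition msym :: "partition \<Rightarrow> 'k laurent" where
  "msym \<kappa> = (\<Sum>\<sigma> | \<sigma> permutes {1..n}. \<Prod>i = 1..n. gen i ^ \<kappa> (\<sigma> i))"

lemma msym_S: "msym \<kappa> \<in> S"
  unfolding msym_def by (intro S_sum S_prod S_power gen_S)

lemma msym_ev:
  "(\<And>i. x i \<in> good) \<Longrightarrow>
    lpoly_eval (msym \<kappa>) x = (\<Sum>\<sigma> | \<sigma> permutes {1..n}. \<Prod>i = 1..n. y (x i) ^ \<kappa> (\<sigma> i))"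
  unfolding msym_def lpoly_eval_sum
proof (intro sum.cong refl)
  fix \<sigma> assume x: "\<And>i. x i \<in> good"
  have "lpoly_eval (\<Prod>i = 1..n. gen i ^ \<kappa> (\<sigma> i)) x = (\<Prod>i = 1..n. lpoly_eval (gen i ^ \<kappa> (\<sigma> i)) x)"
    by (intro good_prod S_power gen_S x)
  also have "\<dots> = (\<Prod>i = 1..n. y (x i) ^ \<kappa> (\<sigma> i))"
    by (rule prod.cong[OF refl]) (simp only: good_power[OF gen_S x] gen_ev[OF x])
  finally show "lpoly_eval (\<Prod>i = 1..n. gen i ^ \<kappa> (\<sigma> i)) x = (\<Prod>i = 1..n. y (x i) ^ \<kappa> (\<sigma> i))" .
qed

lemma msym_Lam: "msym \<kappa> \<in> Lam F"
proof (rule LamI[OF msym_S])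
  fix \<rho> and x :: "nat \<Rightarrow> 'k" assume \<rho>: "\<rho> permutes {1..n}" and x: "\<And>i. x i \<noteq> 0"
  have "lpoly_eval (msym \<kappa>) (x \<circ> \<rho>) = (\<Sum>\<sigma> | \<sigma> permutes {1..n}. \<Prod>i = 1..n. y (x (\<rho> i)) ^ \<kappa> (\<sigma> i))"
    using x nonzero_good by (subst msym_ev) auto
  also have "\<dots> = (\<Sum>\<sigma> | \<sigma> permutes {1..n}. \<Prod>i = 1..n. y (x (\<rho> i)) ^ \<kappa> ((\<sigma> \<circ> \<rho>) i))"
    by (rule sum_permutations_compose_right[OF \<rho>])
  also have "\<dots> = (\<Sum>\<sigma> | \<sigma> permutes {1..n}. \<Prod>i = 1..n. y (x i) ^ \<kappa> (\<sigma> i))"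
  proof (rule sum.cong[OF refl])
    fix \<sigma>
    show "(\<Prod>i = 1..n. y (x (\<rho> i)) ^ \<kappa> ((\<sigma> \<circ> \<rho>) i)) = (\<Prod>i = 1..n. y (x i) ^ \<kappa> (\<sigma> i))"
      using prod.reindex_bij_betw[OF permutes_imp_bij[OF \<rho>], of "\<lambda>j. y (x j) ^ \<kappa> (\<sigma> j)"] by simp
  qed
  also have "\<dots> = lpoly_eval (msym \<kappa>) x"
    using x nonzero_good by (subst msym_ev) auto
  finally show "lpoly_eval (msym \<kappa>) (x \<circ> \<rho>) = lpoly_eval (msym \<kappa>) x" .
qed

lemma msym_degree: "ldegree (msym \<kappa>) \<le> degfac F * size_of F \<kappa>"
  unfolding msym_def
proof (rule ldegree_sum)
  fix \<sigma> assume "\<sigma> \<in> {\<sigma>. \<sigma> permutes {1..n}}"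
  then have \<sigma>: "\<sigma> permutes {1..n}" by simp
  have pow: "ldegree (gen i ^ k) \<le> degfac F * k" for i k
    using ldegree_prod[of "{..<k}" "\<lambda>_. gen i" "\<lambda>_. degfac F"] gen_degree by (simp add: mult.commute)
  have "ldegree (\<Prod>i = 1..n. gen i ^ \<kappa> (\<sigma> i)) \<le> (\<Sum>i = 1..n. degfac F * \<kappa> (\<sigma> i))"
    by (intro ldegree_prod pow) simp
  also have "\<dots> = degfac F * size_of F \<kappa>"
    unfolding psize_def sum_distrib_left[symmetric]
    using sum.reindex_bij_betw[OF permutes_imp_bij[OF \<sigma>], of \<kappa>] by simp
  finally show "ldegree (\<Prod>i = 1..n. gen i ^ \<kappa> (\<sigma> i)) \<le> degfac F * size_of F \<kappa>" .
qed

lemma msym_indep: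
  assumes T: "finite T" "T \<subseteq> parts F" and 0: "(\<Sum>\<kappa>\<in>T. Const (c \<kappa>) * msym \<kappa>) = 0"
  shows "\<forall>\<kappa>\<in>T. c \<kappa> = 0"
proof
  fix \<mu> assume \<mu>: "\<mu> \<in> T"
  define P where "P = {\<sigma>. \<sigma> permutes {1..n}}"
  have P: "finite P" unfolding P_def by (rule finite_permutations) simp
  define G where "G = (\<lambda>Y::nat \<Rightarrow> 'k. \<Sum>\<kappa>\<in>T. c \<kappa> * (\<Sum>\<sigma>\<in>P. \<Prod>i = 1..n. Y i ^ \<kappa> (\<sigma> i)))"
  define d where "d = (\<Sum>\<kappa>\<in>T. \<Sum>\<sigma>\<in>P. \<Sum>i = 1..n. \<kappa> (\<sigma> i))"
  have G: "polyfun {1..n} {..d} G"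
    unfolding G_def
  proof (intro polyfun_sum polyfun_cmult)
    fix \<kappa> \<sigma> assume \<kappa>: "\<kappa> \<in> T" "\<sigma> \<in> P"
    have "polyfun {1..n} {..\<Sum>i = 1..n. \<kappa> (\<sigma> i)} (\<lambda>Y::nat \<Rightarrow> 'k. \<Prod>i = 1..n. Y i ^ \<kappa> (\<sigma> i))"
      by (intro polyfun_prod polyfun_power_linear polyfun_var) auto
    moreover have "(\<Sum>i = 1..n. \<kappa> (\<sigma> i)) \<le> d"
    proof -
      have "(\<Sum>i = 1..n. \<kappa> (\<sigma> i)) \<le> (\<Sum>\<sigma>\<in>P. \<Sum>i = 1..n. \<kappa> (\<sigma> i))"
        by (rule member_le_sum) (use \<kappa> P in auto)
      also have "\<dots> \<le> d"
        unfolding d_def by (rule member_le_sum[of \<kappa> T "\<lambda>\<kappa>. \<Sum>\<sigma>\<in>P. \<Sum>i = 1..n. \<kappa> (\<sigma> i)"]) (use \<kappa> T in auto)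
      finally show ?thesis .
    qed
    ultimately show "polyfun {1..n} {..d} (\<lambda>Y::nat \<Rightarrow> 'k. \<Prod>i = 1..n. Y i ^ \<kappa> (\<sigma> i))"
      by (rule polyfun_mono_atMost)
  qed
  have G0: "G Y = 0" for Y
  proof (rule grid_eq_0[OF G])
    fix x :: "nat \<Rightarrow> 'k" assume "\<And>i. x i \<noteq> 0"
    then have "lpoly_eval (\<Sum>\<kappa>\<in>T. Const (c \<kappa>) * msym \<kappa>) x = G (\<lambda>i. y (x i))"
      using nonzero_good by (simp add: lpoly_eval_sum lpoly_eval_Const_mult msym_ev G_def P_def)
    then show "G (\<lambda>i. y (x i)) = 0" unfolding 0 by simp
  qed
  \<comment> \<open>Exponent vectors with respect to formal variables that stand for the
    generators.\<close>
  define E where "E = (\<lambda>e::nat \<Rightarrow> nat. Abs_poly_mapping (\<lambda>i. int (e i)))"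
  have E: "lookup (E (\<kappa> \<circ> \<sigma>)) = (\<lambda>i. int (\<kappa> (\<sigma> i)))" if "\<kappa> \<in> parts F" "\<sigma> \<in> P" for \<kappa> \<sigma>
  proof -
    have "\<kappa> (\<sigma> i) = 0" if "i \<notin> {1..n}" for i
      using that \<open>\<kappa> \<in> parts F\<close> \<open>\<sigma> \<in> P\<close> permutes_not_in[of \<sigma> "{1..n}" i] by (auto simp: P_def partitions_def)
    then have "{i. int (\<kappa> (\<sigma> i)) \<noteq> 0} \<subseteq> {1..n}" by force
    then have "finite {i. int (\<kappa> (\<sigma> i)) \<noteq> 0}" by (rule finite_subset) simp
    then show ?thesis unfolding E_def by simp
  qed
  \<comment> \<open>The formal polynomial behind \<open>G\<close>; its coefficients can be compared,
    while in the generators themselves monomials may overlap.\<close>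
  define Q where "Q = (\<Sum>\<kappa>\<in>T. \<Sum>\<sigma>\<in>P. single (E (\<kappa> \<circ> \<sigma>)) (c \<kappa>))"
  have meval_E: "meval (E (\<kappa> \<circ> \<sigma>)) Y = (\<Prod>i = 1..n. Y i ^ \<kappa> (\<sigma> i))" if "\<kappa> \<in> T" "\<sigma> \<in> P" for \<kappa> \<sigma> and Y :: "nat \<Rightarrow> 'k"
  proof -
    have \<kappa>: "\<kappa> \<in> parts F" using T that by auto
    have "keys (E (\<kappa> \<circ> \<sigma>)) \<subseteq> {1..n}"
    proof
      fix i assume "i \<in> keys (E (\<kappa> \<circ> \<sigma>))"
      then have "\<kappa> (\<sigma> i) \<noteq> 0" by (simp add: in_keys_iff E[OF \<kappa> that(2)])
      moreover have "\<kappa> j = 0" if "j \<notin> {1..n}" for j using \<kappa> that by (simp add: partitions_def)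
      ultimately have "\<sigma> i \<in> {1..n}" by metis
      then show "i \<in> {1..n}" using permutes_in_image[of \<sigma> "{1..n}" i] that(2) by (simp add: P_def)
    qed
    then have "meval (E (\<kappa> \<circ> \<sigma>)) Y = (\<Prod>i = 1..n. Y i powi lookup (E (\<kappa> \<circ> \<sigma>)) i)"
      by (intro meval_superset) auto
    then show ?thesis by (simp add: E[OF \<kappa> that(2)])
  qed
  have "Q = 0"
  proof (rule lpoly_eqI)
    fix Y :: "nat \<Rightarrow> 'k"
    have "lpoly_eval Q Y = G Y"
      unfolding Q_def G_def
      by (simp add: lpoly_eval_sum lpoly_eval_single meval_E sum_distrib_left)
    then show "lpoly_eval Q Y = lpoly_eval 0 Y" using G0 by simp
  qed
  have id: "id \<in> P" by (simp add: P_def permutes_id)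
  have "lookup Q (E \<mu>) = (\<Sum>\<kappa>\<in>T. \<Sum>\<sigma>\<in>P. if E (\<kappa> \<circ> \<sigma>) = E \<mu> then c \<kappa> else 0)"
    unfolding Q_def by (simp add: lookup_sum lookup_single when_def)
  \<comment> \<open>Distinct partitions have disjoint orbits, so the exponent of \<mu> occurs only
    for \<kappa> = \<mu>, once for each element of the stabilizer.\<close>
  also have "\<dots> = (\<Sum>\<kappa>\<in>T. if \<kappa> = \<mu> then of_nat (card {\<sigma>\<in>P. E (\<mu> \<circ> \<sigma>) = E \<mu>}) * c \<mu> else 0)"
  proof (rule sum.cong[OF refl])
    fix \<kappa> assume \<kappa>: "\<kappa> \<in> T"
    have ne: "\<kappa> = \<mu>" if "\<sigma> \<in> P" "E (\<kappa> \<circ> \<sigma>) = E \<mu>" for \<sigma>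
    proof -
      have "lookup (E (\<kappa> \<circ> \<sigma>)) i = lookup (E (\<mu> \<circ> id)) i" for i
        using that(2) by simp
      moreover have mem: "\<kappa> \<in> parts F" "\<mu> \<in> parts F" using \<kappa> \<mu> T(2) by auto
      ultimately have "\<kappa> (\<sigma> i) = \<mu> i" for i
        unfolding E[OF mem(1) that(1)] E[OF mem(2) id] by simp
      then show ?thesis
        using partition_permute_eq[OF mem, of \<sigma>] that(1) by (simp add: P_def)
    qed
    show "(\<Sum>\<sigma>\<in>P. if E (\<kappa> \<circ> \<sigma>) = E \<mu> then c \<kappa> else 0) =
      (if \<kappa> = \<mu> then of_nat (card {\<sigma>\<in>P. E (\<mu> \<circ> \<sigma>) = E \<mu>}) * c \<mu> else 0)"
    proof (cases "\<kappa> = \<mu>")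
      case True
      then show ?thesis using P by (simp add: sum.inter_filter[symmetric])
    next
      case False
      then have "E (\<kappa> \<circ> \<sigma>) \<noteq> E \<mu>" if "\<sigma> \<in> P" for \<sigma> using ne that by blast
      then show ?thesis using False by (simp cong: sum.cong_simp)
    qed
  qed
  also have "\<dots> = of_nat (card {\<sigma>\<in>P. E (\<mu> \<circ> \<sigma>) = E \<mu>}) * c \<mu>"
    using T \<mu> by simp
  finally have "of_nat (card {\<sigma>\<in>P. E (\<mu> \<circ> \<sigma>) = E \<mu>}) * c \<mu> = 0"
    unfolding \<open>Q = 0\<close> by simp
  moreover have "card {\<sigma>\<in>P. E (\<mu> \<circ> \<sigma>) = E \<mu>} \<noteq> 0"
  proof -
    have "id \<in> {\<sigma>\<in>P. E (\<mu> \<circ> \<sigma>) = E \<mu>}" using id by simp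
    moreover have "finite {\<sigma>\<in>P. E (\<mu> \<circ> \<sigma>) = E \<mu>}" using P by simp
    ultimately show ?thesis by (metis card_0_eq empty_iff)
  qed
  ultimately show "c \<mu> = 0" by simp
qed

lemma good_shift: "shift F \<kappa> i \<in> good"
  by (simp add: shift_eq pt_good)

sublocale interpolation F msym "\<Sum>i = 1..n. gen i"
proof
  show "Const c \<in> Lam F" for c
    by (rule LamI) (auto intro: S_Const simp: lpoly_eval_Const)
  show "f + g \<in> Lam F" if "f \<in> Lam F" "g \<in> Lam F" for f g
    by (rule LamI) (use that in \<open>auto intro: S_add Lam_S simp: lpoly_eval_add Lam_ev\<close>)
  show "f * g \<in> Lam F" if fg: "f \<in> Lam F" "g \<in> Lam F" for f g
  proof (rule LamI)
    show "f * g \<in> S" using fg by (intro S_mult Lam_S)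
    fix \<sigma> and x :: "nat \<Rightarrow> 'k" assume \<sigma>: "\<sigma> permutes {1..n}" and x: "\<And>i. x i \<noteq> 0"
    have "lpoly_eval (f * g) (x \<circ> \<sigma>) = lpoly_eval f (x \<circ> \<sigma>) * lpoly_eval g (x \<circ> \<sigma>)"
      using x nonzero_good fg by (intro S_good_mult Lam_S) auto
    also have "\<dots> = lpoly_eval (f * g) x"
      using x nonzero_good fg \<sigma> by (simp add: S_good_mult Lam_S Lam_ev)
    finally show "lpoly_eval (f * g) (x \<circ> \<sigma>) = lpoly_eval (f * g) x" .
  qed
  show "lpoly_eval (f * g) (shift F \<kappa>) = lpoly_eval f (shift F \<kappa>) * lpoly_eval g (shift F \<kappa>)"
    if "f \<in> Lam F" "g \<in> Lam F" for f g \<kappa>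
    using that good_shift by (intro S_good_mult Lam_S)
  show "lpoly_eval f (shift F \<kappa>) = 0"
    if f: "f \<in> Lam F" "ldegree f \<le> degfac F * d" and \<kappa>: "\<kappa> \<in> parts F" "d < size_of F \<kappa>"
      and 0: "\<And>\<nu>. \<nu> \<in> parts F \<Longrightarrow> \<nu> \<le> \<kappa> \<Longrightarrow> \<nu> \<noteq> \<kappa> \<Longrightarrow> lpoly_eval f (shift F \<nu>) = 0" for f d \<kappa>
  proof -
    obtain G where G: "polyfun {1..n} {..d} G"
      "\<And>x. (\<And>i. x i \<in> good) \<Longrightarrow> lpoly_eval f x = G (\<lambda>i. y (x i))"
      using S_polyfun_ev[OF Lam_S[OF f(1)] f(2)] by blast
    \<comment> \<open>\<open>f\<close> determines \<open>G\<close> on the grid of values of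
      \<open>y\<close>, which is infinite in each coordinate; symmetry of \<open>f\<close> therefore
      passes to \<open>G\<close>.\<close>
    have sym: "symfun n G"
      unfolding symfun_def
    proof (intro allI impI)
      fix \<sigma> Y assume \<sigma>: "\<sigma> permutes {1..n}"
      have "G (Y \<circ> \<sigma>) - G Y = 0"
      proof (rule grid_eq_0[of d "\<lambda>Y. G (Y \<circ> \<sigma>) - G Y"])
        have "polyfun {1..n} {..d} (\<lambda>Y. G (Y \<circ> \<sigma>))"
        proof (rule polyfun_compose[OF _ G(1)])
          fix i assume "i \<in> {1..n}"
          then have "\<sigma> i \<in> {1..n}" using permutes_in_image[OF \<sigma>] by blast
          then show "polyfun {1..n} {..1} (\<lambda>Y::nat \<Rightarrow> 'k. (Y \<circ> \<sigma>) i)"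
            unfolding o_def by (intro polyfun_var) auto
        qed simp
        then show "polyfun {1..n} {..d} (\<lambda>Y. G (Y \<circ> \<sigma>) - G Y)" by (intro polyfun_diff G(1))
        fix x :: "nat \<Rightarrow> 'k" assume x: "\<And>i. x i \<noteq> 0"
        have "G ((\<lambda>i. y (x i)) \<circ> \<sigma>) = lpoly_eval f (x \<circ> \<sigma>)"
          using G(2)[of "x \<circ> \<sigma>"] x nonzero_good by (simp add: o_def)
        also have "\<dots> = G (\<lambda>i. y (x i))"
          unfolding Lam_ev[OF f(1) \<sigma> x] using x nonzero_good by (intro G(2)) auto
        finally show "G ((\<lambda>i. y (x i)) \<circ> \<sigma>) - G (\<lambda>i. y (x i)) = 0" by simp
      qed
      then show "G (Y \<circ> \<sigma>) = G Y" by simp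
    qed
    have ev: "lpoly_eval f (shift F \<nu>) = G (\<lambda>i. y (pt i (\<nu> i)))" for \<nu>
      using G(2)[of "shift F \<nu>"] good_shift by (simp add: shift_eq)
    show ?thesis
      unfolding ev
      by (rule vanishing[of d, unfolded vanishing_def, rule_format, OF G(1) sym \<kappa>])
        (simp add: 0 ev[symmetric])
  qed
  show "f = 0" if f: "f \<in> Lam F" and 0: "\<And>\<kappa>. \<kappa> \<in> parts F \<Longrightarrow> lpoly_eval f (shift F \<kappa>) = 0" for f
  proof -
    have "ldegree f \<le> degfac F * ldegree f" using degfac_gt_0 by simp
    from S_polyfun_ev[OF Lam_S[OF f] this] obtain G where G: "polyfun {1..n} {..ldegree f} G"
      "\<And>x. (\<And>i. x i \<in> good) \<Longrightarrow> lpoly_eval f x = G (\<lambda>i. y (x i))"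
      by blast
    have "G Y = 0" for Y
    proof (rule partitions_dense[OF G(1)])
      fix \<kappa> assume "\<kappa> \<in> parts F"
      then show "G (\<lambda>i. y (pt i (\<kappa> i))) = 0"
        using 0 G(2)[of "shift F \<kappa>"] good_shift by (simp add: shift_eq)
    qed
    then show ?thesis
      using G(2) nonzero_good by (intro lpoly_eqI) simp
  qed
  show "msym \<kappa> \<in> Lam F" for \<kappa> by (rule msym_Lam)
  show "ldegree (msym \<kappa>) \<le> degfac F * size_of F \<kappa>" for \<kappa> by (rule msym_degree)
  show "\<forall>\<kappa>\<in>T. c \<kappa> = 0" if "finite T" "T \<subseteq> parts F" "(\<Sum>\<kappa>\<in>T. Const (c \<kappa>) * msym \<kappa>) = 0" for T c
    using msym_indep[OF that] .
  have ev_r: "lpoly_eval (\<Sum>i = 1..n. gen i) x = (\<Sum>i = 1..n. y (x i))" if "\<And>i. x i \<in> good" for x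
    using that by (simp add: lpoly_eval_sum gen_ev)
  show "(\<Sum>i = 1..n. gen i) \<in> Lam F"
  proof (rule LamI)
    show "(\<Sum>i = 1..n. gen i) \<in> S" by (intro S_sum gen_S)
    fix \<sigma> and x :: "nat \<Rightarrow> 'k" assume \<sigma>: "\<sigma> permutes {1..n}" and x: "\<And>i. x i \<noteq> 0"
    have "lpoly_eval (\<Sum>i = 1..n. gen i) (x \<circ> \<sigma>) = (\<Sum>i = 1..n. y (x (\<sigma> i)))"
      using x nonzero_good by (subst ev_r) auto
    also have "\<dots> = (\<Sum>i = 1..n. y (x i))"
      by (rule sum.reindex_bij_betw[OF permutes_imp_bij[OF \<sigma>]])
    also have "\<dots> = lpoly_eval (\<Sum>i = 1..n. gen i) x"
      using x nonzero_good by (subst ev_r) auto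
    finally show "lpoly_eval (\<Sum>i = 1..n. gen i) (x \<circ> \<sigma>) = lpoly_eval (\<Sum>i = 1..n. gen i) x" .
  qed
  show "ldegree (\<Sum>i = 1..n. gen i) \<le> degfac F" by (intro ldegree_sum gen_degree)
  show "lpoly_eval (\<Sum>i = 1..n. gen i) (shift F \<kappa>) = snorm F \<kappa>" for \<kappa>
    using ev_r[of "shift F \<kappa>"] good_shift by (simp add: nrm_eq)
  show "snorm F \<kappa> \<noteq> snorm F \<mu>"
    if "\<kappa> \<in> parts F" "\<mu> \<in> parts F" "size_of F \<mu> < size_of F \<kappa>" for \<kappa> \<mu>
    using snorm_neq that .
  show "0 < degfac F" by (rule degfac_gt_0)
qed

end

section \<open>The generators\<close>

lemma keys_Xpow: "keys (Xpow i e :: 'k::field laurent) = {single i e}"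
  by (simp add: Xpow_def)

lemma lpoly_eval_Xpow: "lpoly_eval (Xpow i e) x = x i powi e"
proof -
  have "meval (single i e) x = (\<Prod>j\<in>{i}. x j powi lookup (single i e) j)"
    by (rule meval_superset) auto
  then show ?thesis by (simp add: Xpow_def lpoly_eval_single)
qed

lemma mdegree_single: "mdegree (single i e) = nat \<bar>e\<bar>"
  using mdegree_superset[of "{i}" "single i e"] by simp

lemma ldegree_Xpow: "ldegree (Xpow i e :: 'k::field laurent) \<le> nat \<bar>e\<bar>"
  by (simp add: ldegree_le_iff keys_Xpow mdegree_single)

lemma subalgebra_keys:
  assumes "f \<in> subalgebra G" "P 0" "\<And>\<alpha> \<beta>. P \<alpha> \<Longrightarrow> P \<beta> \<Longrightarrow> P (\<alpha> + \<beta>)"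
    and "\<And>g \<alpha>. g \<in> G \<Longrightarrow> \<alpha> \<in> keys g \<Longrightarrow> P \<alpha>"
    and "\<alpha> \<in> keys f"
  shows "P \<alpha>"
  using assms(1,5)
proof (induction arbitrary: \<alpha> rule: subalgebra.induct)
  case (const c)
  then have "\<alpha> = 0" using keys_Const by blast
  then show ?case using assms(2) by simp
next
  case (gen f)
  then show ?case using assms(4) by blast
next
  case (add f g)
  then show ?case using keys_add[of f g] by blast
next
  case (mult f g)
  then obtain \<beta> \<gamma> where "\<alpha> = \<beta> + \<gamma>" "\<beta> \<in> keys f" "\<gamma> \<in> keys g"
    using keys_mult[of f g] by auto
  then show ?case using mult.IH assms(3) by blast
qed

lemma keys_power_subalgebra:
  fixes f :: "'k::field laurent"
  assumes "f \<in> subalgebra {Xpow i (int e) |i. i \<in> {1..n}}" "\<alpha> \<in> keys f"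
  shows "keys \<alpha> \<subseteq> {1..n} \<and> (\<forall>i. 0 \<le> lookup \<alpha> i \<and> int e dvd lookup \<alpha> i)"
proof (rule subalgebra_keys[OF assms(1) _ _ _ assms(2)])
  fix \<alpha> \<beta> :: "nat \<Rightarrow>\<^sub>0 int"
  assume \<alpha>: "keys \<alpha> \<subseteq> {1..n} \<and> (\<forall>i. 0 \<le> lookup \<alpha> i \<and> int e dvd lookup \<alpha> i)"
    and \<beta>: "keys \<beta> \<subseteq> {1..n} \<and> (\<forall>i. 0 \<le> lookup \<beta> i \<and> int e dvd lookup \<beta> i)"
  have "keys (\<alpha> + \<beta>) \<subseteq> {1..n}" using keys_add[of \<alpha> \<beta>] \<alpha> \<beta> by blast
  then show "keys (\<alpha> + \<beta>) \<subseteq> {1..n} \<and>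
      (\<forall>i. 0 \<le> lookup (\<alpha> + \<beta>) i \<and> int e dvd lookup (\<alpha> + \<beta>) i)"
    using \<alpha> \<beta> by (simp add: lookup_add)
next
  fix g :: "'k laurent" and \<alpha>
  assume "g \<in> {Xpow i (int e) |i. i \<in> {1..n}}" "\<alpha> \<in> keys g"
  then obtain i where "i \<in> {1..n}" "\<alpha> = single i (int e)" by (auto simp: keys_Xpow)
  then show "keys \<alpha> \<subseteq> {1..n} \<and> (\<forall>i. 0 \<le> lookup \<alpha> i \<and> int e dvd lookup \<alpha> i)"
    by (auto simp: lookup_single when_def)
qed simp

lemma power_mult_good:
  fixes f g :: "'k::field laurent"
  assumes "f \<in> subalgebra {Xpow i (int e) |i. i \<in> {1..n}}" "g \<in> subalgebra {Xpow i (int e) |i. i \<in> {1..n}}"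
  shows "lpoly_eval (f * g) x = lpoly_eval f x * lpoly_eval g x"
  by (intro lpoly_eval_mult meval_add)
    (use keys_power_subalgebra[OF assms(1)] keys_power_subalgebra[OF assms(2)] in blast)

text \<open>Only exponents divisible by \<open>e\<close> occur, so each monomial is literally a
  monomial in the powers x_i^e, of \<open>e\<close> times smaller degree.\<close>

lemma power_polyfun:
  fixes f :: "'k::field_char_0 laurent"
  assumes f: "f \<in> subalgebra {Xpow i (int e) |i. i \<in> {1..n}}" and d: "ldegree f \<le> e * d" and "0 < e"
  shows "\<exists>G. polyfun {1..n} {..d} G \<and> (\<forall>x. lpoly_eval f x = G (\<lambda>i. x i ^ e))"
proof -
  let ?K = "keys f" and ?l = "\<lambda>\<alpha> i. nat (lookup \<alpha> i) div e"
  define G where "G = (\<lambda>Y::nat \<Rightarrow> 'k. \<Sum>\<alpha>\<in>?K. lookup f \<alpha> * (\<Prod>i\<in>{1..n}. Y i ^ ?l \<alpha> i))"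
  have l: "nat (lookup \<alpha> i) = e * ?l \<alpha> i" "0 \<le> lookup \<alpha> i" if "\<alpha> \<in> ?K" for \<alpha> i
  proof -
    have "0 \<le> lookup \<alpha> i" "int e dvd lookup \<alpha> i"
      using keys_power_subalgebra[OF f that] by auto
    then have "int e dvd int (nat (lookup \<alpha> i))" by simp
    then have "e dvd nat (lookup \<alpha> i)" by (simp only: int_dvd_int_iff)
    then show "nat (lookup \<alpha> i) = e * ?l \<alpha> i" "0 \<le> lookup \<alpha> i"
      using \<open>0 \<le> _\<close> by simp_all
  qed
  have "polyfun {1..n} {..d} G"
    unfolding G_def
  proof (intro polyfun_sum polyfun_cmult)
    fix \<alpha> assume \<alpha>: "\<alpha> \<in> ?K"
    have "polyfun {1..n} {..\<Sum>i\<in>{1..n}. ?l \<alpha> i} (\<lambda>Y::nat \<Rightarrow> 'k. \<Prod>i\<in>{1..n}. Y i ^ ?l \<alpha> i)"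
      by (intro polyfun_prod polyfun_power_linear polyfun_var) auto
    moreover have "(\<Sum>i\<in>{1..n}. ?l \<alpha> i) \<le> d"
    proof -
      have "e * (\<Sum>i\<in>{1..n}. ?l \<alpha> i) = (\<Sum>i\<in>{1..n}. nat \<bar>lookup \<alpha> i\<bar>)"
        unfolding sum_distrib_left using l[OF \<alpha>] by (intro sum.cong refl) simp
      also have "\<dots> = mdegree \<alpha>"
        by (rule mdegree_superset[symmetric]) (use keys_power_subalgebra[OF f \<alpha>] in auto)
      also have "\<dots> \<le> e * d" using d \<alpha> by (simp add: ldegree_le_iff)
      finally show ?thesis using \<open>0 < e\<close> by simp
    qed
    ultimately show "polyfun {1..n} {..d} (\<lambda>Y::nat \<Rightarrow> 'k. \<Prod>i\<in>{1..n}. Y i ^ ?l \<alpha> i)"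
      by (rule polyfun_mono_atMost)
  qed
  moreover have "lpoly_eval f x = G (\<lambda>i. x i ^ e)" for x
  proof -
    have "meval \<alpha> x = (\<Prod>i\<in>{1..n}. (x i ^ e) ^ ?l \<alpha> i)" if \<alpha>: "\<alpha> \<in> ?K" for \<alpha>
    proof -
      have "meval \<alpha> x = (\<Prod>i\<in>{1..n}. x i powi lookup \<alpha> i)"
        by (rule meval_superset) (use keys_power_subalgebra[OF f \<alpha>] in auto)
      also have "\<dots> = (\<Prod>i\<in>{1..n}. (x i ^ e) ^ ?l \<alpha> i)"
      proof (rule prod.cong[OF refl])
        fix i
        have "x i powi lookup \<alpha> i = x i ^ nat (lookup \<alpha> i)"
          using l(2)[OF \<alpha>] by (simp add: power_int_def)
        also have "\<dots> = x i ^ (e * ?l \<alpha> i)" by (subst l(1)[OF \<alpha>]) simp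
        finally show "x i powi lookup \<alpha> i = (x i ^ e) ^ ?l \<alpha> i" by (simp add: power_mult)
      qed
      finally show ?thesis .
    qed
    then show ?thesis unfolding G_def lpoly_eval_superset[OF finite_keys subset_refl] by simp
  qed
  ultimately show ?thesis by blast
qed

section \<open>Generators invariant under inversion\<close>

abbreviation Xsym :: "nat \<Rightarrow> 'k::field laurent" where
  "Xsym i \<equiv> Xpow i 1 + Xpow i (- 1)"

lemma keys_Xsym_subalgebra:
  fixes f :: "'k::field laurent"
  assumes "f \<in> subalgebra {Xsym i |i. i \<in> {1..n}}" "\<alpha> \<in> keys f"
  shows "keys \<alpha> \<subseteq> {1..n}"
proof (rule subalgebra_keys[OF assms(1) _ _ _ assms(2)])
  show "keys (\<alpha> + \<beta>) \<subseteq> {1..n}"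
    if "keys \<alpha> \<subseteq> {1..n}" "keys \<beta> \<subseteq> {1..n}" for \<alpha> \<beta> :: "nat \<Rightarrow>\<^sub>0 int"
    using keys_add[of \<alpha> \<beta>] that by blast
  fix g :: "'k laurent" and \<alpha>
  assume "g \<in> {Xsym i |i. i \<in> {1..n}}" "\<alpha> \<in> keys g"
  then obtain i where i: "i \<in> {1..n}" "\<alpha> \<in> keys (Xsym i :: 'k laurent)" by auto
  then have "\<alpha> \<in> keys (Xpow i 1 :: 'k laurent) \<union> keys (Xpow i (- 1) :: 'k laurent)"
    using keys_add[of "Xpow i 1 :: 'k laurent" "Xpow i (- 1)"] by auto
  then show "keys \<alpha> \<subseteq> {1..n}" using i(1) by (auto simp: keys_Xpow)
qed simp

lemma lpoly_eval_mult_nonzero: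
  "(\<And>i. x i \<noteq> 0) \<Longrightarrow> lpoly_eval (f * g) x = lpoly_eval f x * lpoly_eval g x"
  by (intro lpoly_eval_mult meval_add) simp

lemma lpoly_eval_Xsym: "lpoly_eval (Xsym i) x = x i + inverse (x i)"
  by (simp add: lpoly_eval_add lpoly_eval_Xpow power_int_minus)

lemma Xsym_flip:
  fixes f :: "'k::field laurent"
  assumes "f \<in> subalgebra {Xsym i |i. i \<in> {1..n}}" "\<And>i. x i \<noteq> 0"
  shows "lpoly_eval f (\<lambda>i. if i \<in> J then inverse (x i) else x i) = lpoly_eval f x"
  using assms(1)
proof (induction rule: subalgebra.induct)
  case (gen f)
  then show ?case by (auto simp: lpoly_eval_Xsym)
qed (simp_all add: lpoly_eval_Const lpoly_eval_add lpoly_eval_mult_nonzero assms(2))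

text \<open>These are rescaled Chebyshev polynomials with the recursion T_m(w) = w T_(m-1)(w) -
  T_(m-2)(w), starting from 2 and w.\<close>

lemma symmetric_power_poly:
  "\<exists>T. degree T \<le> m \<and> (\<forall>z::'k::field. z \<noteq> 0 \<longrightarrow> z ^ m + inverse z ^ m = poly T (z + inverse z))"
proof (induction m rule: less_induct)
  case (less m)
  consider "m = 0" | "m = 1" | k where "m = Suc (Suc k)"
    by (metis One_nat_def old.nat.exhaust)
  then show ?case
  proof cases
    case 1
    then show ?thesis by (intro exI[of _ "[:2:]"]) simp
  next
    case 2
    then show ?thesis by (intro exI[of _ "[:0, 1:]"]) simp
  next
    case 3
    obtain T U where T: "degree T \<le> Suc k" "\<And>z::'k. z \<noteq> 0 \<Longrightarrow> z ^ Suc k + inverse z ^ Suc k = poly T (z + inverse z)"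
      and U: "degree U \<le> k" "\<And>z::'k. z \<noteq> 0 \<Longrightarrow> z ^ k + inverse z ^ k = poly U (z + inverse z)"
      using less.IH[of "Suc k"] less.IH[of k] 3 by auto
    have "degree ([:0, 1:] * T - U) \<le> m"
    proof (rule degree_diff_le)
      have "degree ([:0, 1:] * T) \<le> degree [:0, 1 :: 'k:] + degree T" by (rule degree_mult_le)
      then show "degree ([:0, 1:] * T) \<le> m" using T(1) 3 by simp
      show "degree U \<le> m" using U(1) 3 by simp
    qed
    moreover have "z ^ m + inverse z ^ m = poly ([:0, 1:] * T - U) (z + inverse z)" if "z \<noteq> 0" for z
    proof -
      define w where "w = inverse z"
      have zw: "z * w = 1" using that by (simp add: w_def)
      have "poly ([:0, 1:] * T - U) (z + w) = (z + w) * (z ^ Suc k + w ^ Suc k) - (z ^ k + w ^ k)"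
        using T(2)[OF that] U(2)[OF that] by (simp add: w_def)
      also have "\<dots> = z ^ Suc (Suc k) + w ^ Suc (Suc k) + (z * w) * (z ^ k + w ^ k) - (z ^ k + w ^ k)"
        by (simp add: algebra_simps)
      also have "\<dots> = z ^ m + w ^ m" using zw 3 by simp
      finally show ?thesis by (simp add: w_def)
    qed
    ultimately show ?thesis by blast
  qed
qed

text \<open>A presentation of \<open>f\<close> by generators may involve degrees that cancel, so it
  gives no bound. Averaging over the 2^n inversions of coordinates leaves \<open>f\<close> unchanged
  and turns each of its own monomials into a product of sums z^k + z^(-k), which keeps the
  degree.\<close>

lemma Xsym_polyfun:
  fixes f :: "'k::field_char_0 laurent"
  assumes f: "f \<in> subalgebra {Xsym i |i. i \<in> {1..n}}" and d: "ldegree f \<le> d"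
  shows "\<exists>G. polyfun {1..n} {..d} G \<and>
    (\<forall>x. (\<forall>i. x i \<noteq> 0) \<longrightarrow> lpoly_eval f x = G (\<lambda>i. x i + inverse (x i)))"
proof -
  let ?K = "keys f" and ?l = "\<lambda>\<alpha> i. nat \<bar>lookup \<alpha> i\<bar>"
  obtain T where T: "\<And>m. degree (T m) \<le> m"
    "\<And>m z::'k. z \<noteq> 0 \<Longrightarrow> z ^ m + inverse z ^ m = poly (T m) (z + inverse z)"
    using symmetric_power_poly by metis
  define G where "G = (\<lambda>Y::nat \<Rightarrow> 'k. 1 / 2 ^ n *
    (\<Sum>\<alpha>\<in>?K. lookup f \<alpha> * (\<Prod>i\<in>{1..n}. poly (T (?l \<alpha> i)) (Y i))))"
  have "polyfun {1..n} {..d} G"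
    unfolding G_def
  proof (intro polyfun_sum polyfun_cmult)
    fix \<alpha> assume \<alpha>: "\<alpha> \<in> ?K"
    have "polyfun {1..n} {..\<Sum>i\<in>{1..n}. ?l \<alpha> i} (\<lambda>Y. \<Prod>i\<in>{1..n}. poly (T (?l \<alpha> i)) (Y i))"
      by (intro polyfun_prod polyfun_poly T) auto
    moreover have "mdegree \<alpha> \<le> d" using d \<alpha> by (simp add: ldegree_le_iff)
    then have "(\<Sum>i\<in>{1..n}. ?l \<alpha> i) \<le> d"
      by (subst (asm) mdegree_superset[of "{1..n}"]) (use keys_Xsym_subalgebra[OF f \<alpha>] in auto)
    ultimately show "polyfun {1..n} {..d} (\<lambda>Y. \<Prod>i\<in>{1..n}. poly (T (?l \<alpha> i)) (Y i))"
      by (rule polyfun_mono_atMost)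
  qed
  moreover have "lpoly_eval f x = G (\<lambda>i. x i + inverse (x i))" if x: "\<forall>i. x i \<noteq> 0" for x
  proof -
    let ?x = "\<lambda>J i. if i \<in> J then inverse (x i) else x i"
    have m: "meval \<alpha> (?x J) = (\<Prod>i\<in>{1..n}. if i \<in> J then inverse (x i) powi lookup \<alpha> i
        else x i powi lookup \<alpha> i)" if "\<alpha> \<in> ?K" for \<alpha> J
    proof -
      have "meval \<alpha> (?x J) = (\<Prod>i\<in>{1..n}. ?x J i powi lookup \<alpha> i)"
        by (rule meval_superset) (use keys_Xsym_subalgebra[OF f that] in auto)
      then show ?thesis by (simp add: if_distrib[of "\<lambda>z. z powi _"])
    qed
    have p: "z powi k + inverse z powi k = poly (T (nat \<bar>k\<bar>)) (z + inverse z)" if "z \<noteq> 0" for z :: 'k and k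
      using T(2)[OF that, of "nat \<bar>k\<bar>"] that by (cases "k \<ge> 0") (auto simp: power_int_def add.commute)
    have "2 ^ n * lpoly_eval f x = (\<Sum>J\<in>Pow {1..n}. lpoly_eval f (?x J))"
      using x by (simp add: Xsym_flip[OF f] card_Pow)
    also have "\<dots> = (\<Sum>J\<in>Pow {1..n}. \<Sum>\<alpha>\<in>?K. lookup f \<alpha> * meval \<alpha> (?x J))"
      by (simp only: lpoly_eval_superset[of ?K f, OF finite_keys subset_refl])
    also have "\<dots> = (\<Sum>\<alpha>\<in>?K. \<Sum>J\<in>Pow {1..n}. lookup f \<alpha> * meval \<alpha> (?x J))"
      by (rule sum.swap)
    also have "\<dots> = (\<Sum>\<alpha>\<in>?K. lookup f \<alpha> *
        (\<Prod>i\<in>{1..n}. x i powi lookup \<alpha> i + inverse (x i) powi lookup \<alpha> i))"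
    proof (rule sum.cong[OF refl])
      fix \<alpha> assume \<alpha>: "\<alpha> \<in> ?K"
      show "(\<Sum>J\<in>Pow {1..n}. lookup f \<alpha> * meval \<alpha> (?x J)) = lookup f \<alpha> *
        (\<Prod>i\<in>{1..n}. x i powi lookup \<alpha> i + inverse (x i) powi lookup \<alpha> i)"
        unfolding m[OF \<alpha>] prod_add_Pow[OF finite_atLeastAtMost] sum_distrib_left ..
    qed
    also have "\<dots> = 2 ^ n * G (\<lambda>i. x i + inverse (x i))"
      unfolding G_def using x by (simp add: p)
    finally show ?thesis by simp
  qed
  ultimately show ?thesis by blast
qed

section \<open>Generic parameters\<close>

context jack
begin

text \<open>The difference of two values factors into the difference of the row lengths and an
  expression covered by \<open>affine_neq_0\<close>.\<close>

lemma inj_y_pt: "inj (\<lambda>m. y 0 (pt i m))"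
proof (rule injI)
  fix m l assume eq: "y 0 (pt i m) = y 0 (pt i l)"
  have "y 0 (pt i m) - y 0 (pt i l) = (of_nat m - of_nat l) *
      (\<kappa>\<^sub>0 + of_nat 0 * \<sigma> - \<sigma> * (2 * a + of_nat (m + l) + of_nat (2 * (n - i)) * \<tau>))"
    unfolding of_nat_mult by (simp add: y_def pt_def power2_eq_square algebra_simps)
  then have "(of_nat m :: 'k) - of_nat l = 0"
    using eq affine_neq_0 by (metis eq_iff_diff_eq_0 mult_eq_0_iff)
  then show "m = l" by simp
qed

end

context macdonald
begin

lemma q_power_inj:
  assumes "q ^ m = q ^ l"
  shows "m = l"
proof -
  have "m = l" if "q ^ m = q ^ l" "l \<le> m" for m l
  proof -
    have "q ^ m = q ^ l * q ^ (m - l)" using that(2) by (simp flip: power_add)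
    then have "q ^ (m - l) * t ^ 0 = 1" using that(1) neq_0 by simp
    then show ?thesis using qt_generic[of "m - l" 0] that(2) by fastforce
  qed
  from this[of m l] this[of l m] assms show ?thesis by (metis nat_le_linear)
qed

lemma inj_y_pt: "inj (\<lambda>m. y 0 (pt i m))"
proof (rule injI)
  fix m l assume eq: "y 0 (pt i m) = y 0 (pt i l)"
  have "(y 0 (pt i m) - y 0 (pt i l)) * (pt i m * pt i l) =
      (pt i m - pt i l) * (pt i m * pt i l * t ^ 0 - s * q ^ 0)"
    using pt_neq_0 by (simp add: y_def field_simps)
  then have "pt i m = pt i l"
    using eq pt_mult_neq[of i m i l 0 0] by auto
  then show "m = l" using neq_0 by (intro q_power_inj) (simp add: pt_def)
qed

end

lemma to_fract_of_nat: "to_fract (of_nat m) = of_nat m"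
  by (induction m) simp_all

lemma to_fract_power: "to_fract (x ^ m) = to_fract x ^ m"
  by (induction m) simp_all

lemma monom_1_power: "[:0, 1:] ^ m = monom 1 m"
  by (simp add: monom_altdef)

lemma const_poly_power: "[:c:] ^ m = [:c ^ m:]" for c :: "'a::comm_semiring_1"
  by (induction m) (simp_all add: mult_ac)

lemma to_fract_of_int: "to_fract (of_int k) = of_int k"
  by (cases k) (simp_all add: to_fract_of_nat)

section \<open>The four families\<close>

text \<open>Common to \<open>AJ\<close> and \<open>AM\<close> with \<open>e = 1\<close> and to
  \<open>BJ\<close> with \<open>e = 2\<close>; for nonnegative exponents evaluation is
  multiplicative everywhere, so every value is good.\<close>

lemma power_familyI:
  fixes F :: "'k::field_char_0 interp_family"
  assumes "0 < e" and sel: "degfac F = e" "nrm F = (\<lambda>x. \<Sum>i = 1..nvars F. x i ^ e)"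
      "Lam F = {f \<in> subalgebra {Xpow i (int e) |i. i \<in> {1..nvars F}}. is_symmetric (nvars F) f}"
      "shift F = (\<lambda>\<kappa> i. pt i (\<kappa> i))"
    and "\<And>d. vanishing (nvars F) pt (\<lambda>x. x ^ e) d" and "\<And>i. inj (\<lambda>m. pt i m ^ e)"
    and "\<And>\<kappa> \<mu>. size_of F \<mu> < size_of F \<kappa> \<Longrightarrow> snorm F \<kappa> \<noteq> snorm F \<mu>"
  shows "family F (\<lambda>i. Xpow i (int e)) (\<lambda>x. x ^ e) pt UNIV"
proof
  show "\<exists>G. polyfun {1..nvars F} {..d} G \<and> (\<forall>x. (\<forall>i. x i \<in> UNIV) \<longrightarrow> lpoly_eval f x = G (\<lambda>i. x i ^ e))"
    if "f \<in> subalgebra {Xpow i (int e) |i. i \<in> {1..nvars F}}" "ldegree f \<le> degfac F * d"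
    for f :: "'k laurent" and d
    using power_polyfun[of f e "nvars F" d] that assms(1) by (simp add: sel)
  show "ldegree (Xpow i (int e) :: 'k laurent) \<le> degfac F" for i
    using ldegree_Xpow[of i "int e"] by (simp add: sel)
qed (use assms in \<open>simp_all add: lpoly_eval_Xpow power_mult_good\<close>)

lemma AJ_sel:
  "nvars (AJ n) = n" "degfac (AJ n) = 1" "nrm (AJ n) = (\<lambda>x. \<Sum>i = 1..n. x i)"
  "Lam (AJ n) = {f \<in> subalgebra {Xpow i 1 |i. i \<in> {1..n}}. is_symmetric n f}"
  "shift (AJ n) = (\<lambda>\<kappa> i. of_nat (\<kappa> i) + of_nat (n - i) * to_fract [:0, 1:])"
  by (simp_all add: AJ_def Let_def)

lemma AJ_family:
  assumes "n \<ge> 1"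
  shows "family (AJ n) (\<lambda>i. Xpow i (int 1)) (\<lambda>x. x ^ 1) (\<lambda>i m. of_nat m + of_nat (n - i) * to_fract [:0, 1:]) UNIV"
proof -
  define \<tau> :: "rat poly fract" where "\<tau> = to_fract [:0, 1:]"
  interpret J: jack n \<tau> 0 0 1
  proof
    fix m v :: nat assume "(m, v) \<noteq> (0, 0)"
    have "of_nat m + of_nat v * \<tau> = to_fract [:of_nat m, of_nat v:]"
      unfolding \<tau>_def to_fract_of_nat[symmetric] to_fract_mult[symmetric] to_fract_add[symmetric]
      by (simp add: of_nat_poly)
    then show "of_nat m + of_nat v * \<tau> \<noteq> 0" using \<open>(m, v) \<noteq> (0, 0)\<close> by auto
  qed simp
  have pt: "J.pt = (\<lambda>i m. of_nat m + of_nat (n - i) * \<tau>)" by (simp add: J.pt_def fun_eq_iff)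
  have y: "J.y 0 = (\<lambda>x. x)" by (simp add: J.y_def fun_eq_iff)
  show ?thesis
    unfolding \<tau>_def[symmetric]
  proof (rule power_familyI)
    show "vanishing (nvars (AJ n)) (\<lambda>i m. of_nat m + of_nat (n - i) * \<tau>) (\<lambda>x. x ^ 1) d" for d
      using J.vanishing[OF assms, of 0 d] by (simp add: pt y AJ_sel)
    show "inj (\<lambda>m. (of_nat m + of_nat (n - i) * \<tau>) ^ 1)" for i
      using J.inj_y_pt[of i] by (simp add: pt y)
    show "snorm (AJ n) \<kappa> \<noteq> snorm (AJ n) \<mu>" if "size_of (AJ n) \<mu> < size_of (AJ n) \<kappa>" for \<kappa> \<mu>
    proof -
      have "snorm (AJ n) \<kappa> = of_nat (psize n \<kappa>) + (\<Sum>i = 1..n. of_nat (n - i) * \<tau>)" for \<kappa>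
        by (simp add: AJ_sel psize_def sum.distrib \<tau>_def)
      then show ?thesis using that by (simp add: AJ_sel)
    qed
  qed (simp_all add: AJ_sel \<tau>_def)
qed

lemma BJ_sel:
  "nvars (BJ n) = n" "degfac (BJ n) = 2" "nrm (BJ n) = (\<lambda>x. \<Sum>i = 1..n. (x i)\<^sup>2)"
  "Lam (BJ n) = {f \<in> subalgebra {Xpow i 2 |i. i \<in> {1..n}}. is_symmetric n f}"
  "shift (BJ n) = (\<lambda>\<kappa> i. of_nat (\<kappa> i) + of_nat (n - i) * to_fract [:[:0, 1:]:] + to_fract [:0, 1:])"
  by (simp_all add: BJ_def Let_def)

lemma BJ_affine:
  "of_int u + of_nat v * to_fract [:[:0, 1:]:] + of_nat k * to_fract [:0, 1:] =
    to_fract ([:[:of_int u, of_nat v:], of_nat k:] :: rat poly poly)"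
  unfolding to_fract_of_nat[symmetric] to_fract_of_int[symmetric] to_fract_mult[symmetric] to_fract_add[symmetric]
  by (simp add: of_nat_poly of_int_poly)

lemma BJ_family:
  assumes "n \<ge> 1"
  shows "family (BJ n) (\<lambda>i. Xpow i (int 2)) (\<lambda>x. x ^ 2)
    (\<lambda>i m. of_nat m + of_nat (n - i) * to_fract [:[:0, 1:]:] + to_fract [:0, 1:]) UNIV"
proof -
  define \<tau> \<alpha> :: "rat poly poly fract" where "\<tau> = to_fract [:[:0, 1:]:]" and "\<alpha> = to_fract [:0, 1:]"
  have affine: "of_int u + of_nat v * \<tau> + of_nat k * \<alpha> = to_fract ([:[:of_int u, of_nat v:], of_nat k:])" for u v k
    unfolding \<tau>_def \<alpha>_def by (rule BJ_affine)
  interpret J: jack n \<tau> \<alpha> "- 1" 0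
  proof
    fix m v :: nat assume "(m, v) \<noteq> (0, 0)"
    then show "of_nat m + of_nat v * \<tau> \<noteq> 0" using affine[of "int m" v 0] by auto
  next
    have "2 * \<alpha> + of_int u + of_nat v * \<tau> \<noteq> 0" for u v
    proof -
      have "2 * \<alpha> + of_int u + of_nat v * \<tau> = to_fract [:[:of_int u, of_nat v:], of_nat 2:]"
        using affine[of u v 2] by (simp add: add_ac)
      then show ?thesis by simp
    qed
    then show "- 1 = 0 \<and> 0 = 1 \<or> - 1 = - 1 \<and> 0 = 0 \<and> (\<forall>u v. 2 * \<alpha> + of_int u + of_nat v * \<tau> \<noteq> 0)"
      by simp
  qed
  have pt: "J.pt = (\<lambda>i m. of_nat m + of_nat (n - i) * \<tau> + \<alpha>)" by (simp add: J.pt_def fun_eq_iff)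
  have y: "J.y 0 = (\<lambda>x. x\<^sup>2)" by (simp add: J.y_def fun_eq_iff)
  show ?thesis
    unfolding \<tau>_def[symmetric] \<alpha>_def[symmetric]
  proof (rule power_familyI)
    show "vanishing (nvars (BJ n)) (\<lambda>i m. of_nat m + of_nat (n - i) * \<tau> + \<alpha>) (\<lambda>x. x\<^sup>2) d" for d
      using J.vanishing[OF assms, of 0 d] by (simp add: pt y BJ_sel)
    show "inj (\<lambda>m. (of_nat m + of_nat (n - i) * \<tau> + \<alpha>)\<^sup>2)" for i
      using J.inj_y_pt[of i] by (simp add: pt y)
    show "snorm (BJ n) \<kappa> \<noteq> snorm (BJ n) \<mu>" if less: "size_of (BJ n) \<mu> < size_of (BJ n) \<kappa>" for \<kappa> \<mu>
    proof
      define U :: "partition \<Rightarrow> rat poly poly" where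
        "U = (\<lambda>\<kappa>. \<Sum>i = 1..n. [:[:of_nat (\<kappa> i), of_nat (n - i):], 1:]\<^sup>2)"
      have "snorm (BJ n) \<kappa> = to_fract (U \<kappa>)" for \<kappa>
        using affine[of "int (\<kappa> _)" _ 1] by (simp add: BJ_sel U_def to_fract_power \<tau>_def \<alpha>_def)
      moreover assume "snorm (BJ n) \<kappa> = snorm (BJ n) \<mu>"
      ultimately have "U \<kappa> = U \<mu>" by simp
      \<comment> \<open>The coefficient of \<alpha> is twice the sum of the \<kappa>_i + (n - i)
        \<tau>; its part free of \<tau> recovers the size.\<close>
      moreover have "coeff (coeff (U \<kappa>) 1) 0 = of_nat (2 * psize n \<kappa>)" for \<kappa>
        by (simp add: U_def coeff_sum power2_eq_square psize_def sum_distrib_left)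
      ultimately have "(of_nat (2 * psize n \<kappa>) :: rat) = of_nat (2 * psize n \<mu>)" by metis
      then show False using less by (simp only: of_nat_eq_iff BJ_sel)
    qed
  qed (simp_all add: BJ_sel \<tau>_def \<alpha>_def)
qed

lemma AM_sel:
  "nvars (AM n) = n" "degfac (AM n) = 1" "nrm (AM n) = (\<lambda>x. \<Sum>i = 1..n. x i)"
  "Lam (AM n) = {f \<in> subalgebra {Xpow i 1 |i. i \<in> {1..n}}. is_symmetric n f}"
  "shift (AM n) = (\<lambda>\<kappa> i. to_fract [:[:0, 1:]:] ^ \<kappa> i * to_fract [:0, 1:] ^ (n - i))"
  by (simp_all add: AM_def Let_def)

lemma AM_monom:
  "to_fract [:[:0, 1:]:] ^ m * to_fract [:0, 1:] ^ v = to_fract (monom (monom (1 :: rat) m) v)"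
  unfolding to_fract_power[symmetric] to_fract_mult[symmetric] const_poly_power monom_1_power
  by (simp add: smult_monom)

text \<open>Different rows carry different powers of \<open>t\<close>, so a single row can be read
  off. The offset \<open>k\<close> is 0 for \<open>AM\<close> and \<open>n\<close> for
  \<open>BM\<close>.\<close>

lemma coeff_sum_monom:
  assumes "i \<in> {1..n}"
  shows "coeff (\<Sum>j = 1..n. monom (c j) (k + (n - j))) (k + (n - i)) = c i"
proof -
  have "coeff (\<Sum>j = 1..n. monom (c j) (k + (n - j))) (k + (n - i)) = (\<Sum>j = 1..n. if j = i then c j else 0)"
    unfolding coeff_sum coeff_monom using assms by (intro sum.cong refl) auto
  then show ?thesis using assms by simp
qed

lemma AM_family:
  assumes "n \<ge> 1"
  shows "family (AM n) (\<lambda>i. Xpow i (int 1)) (\<lambda>x. x ^ 1)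
    (\<lambda>i m. to_fract [:[:0, 1:]:] ^ m * to_fract [:0, 1:] ^ (n - i)) UNIV"
proof -
  define q t :: "rat poly poly fract" where "q = to_fract [:[:0, 1:]:]" and "t = to_fract [:0, 1:]"
  have qt: "q ^ m * t ^ v = to_fract (monom (monom 1 m) v)" for m v
    unfolding q_def t_def by (rule AM_monom)
  have ne: "q \<noteq> 0" "t \<noteq> 0" by (simp_all add: q_def t_def)
  interpret M: macdonald n q t 1 0
  proof
    fix m v :: nat assume "(m, v) \<noteq> (0, 0)"
    have "to_fract (monom (monom (1 :: rat) m) v) \<noteq> to_fract (monom (monom 1 0) 0)"
      using \<open>(m, v) \<noteq> (0, 0)\<close> by (simp only: to_fract_eq_iff monom_eq_iff') auto
    then show "q ^ m * t ^ v \<noteq> 1" unfolding qt by (simp add: monom_0 flip: one_pCons)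
  qed (use ne in auto)
  have pt: "M.pt = (\<lambda>i m. q ^ m * t ^ (n - i))" by (simp add: M.pt_def fun_eq_iff)
  have y: "M.y 0 = (\<lambda>x. x)" by (simp add: M.y_def fun_eq_iff)
  show ?thesis
    unfolding q_def[symmetric] t_def[symmetric]
  proof (rule power_familyI)
    show "vanishing (nvars (AM n)) (\<lambda>i m. q ^ m * t ^ (n - i)) (\<lambda>x. x ^ 1) d" for d
      using M.vanishing[OF assms, of 0 d] by (simp add: pt y AM_sel)
    show "inj (\<lambda>m. (q ^ m * t ^ (n - i)) ^ 1)" for i
      using M.inj_y_pt[of i] by (simp add: pt y)
    show "snorm (AM n) \<kappa> \<noteq> snorm (AM n) \<mu>" if less: "size_of (AM n) \<mu> < size_of (AM n) \<kappa>" for \<kappa> \<mu>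
    proof
      define U :: "partition \<Rightarrow> rat poly poly" where
        "U = (\<lambda>\<kappa>. \<Sum>i = 1..n. monom (monom 1 (\<kappa> i)) (0 + (n - i)))"
      have "snorm (AM n) \<kappa> = to_fract (U \<kappa>)" for \<kappa>
        using qt by (simp add: AM_sel U_def q_def t_def)
      moreover assume "snorm (AM n) \<kappa> = snorm (AM n) \<mu>"
      ultimately have U: "U \<kappa> = U \<mu>" by simp
      \<comment> \<open>Here the norm determines the whole partition, not just its size.\<close>
      have "\<kappa> i = \<mu> i" if "i \<in> {1..n}" for i
      proof -
        have "coeff (U \<kappa>) (0 + (n - i)) = coeff (U \<mu>) (0 + (n - i))" unfolding U ..
        then have "monom (1 :: rat) (\<kappa> i) = monom 1 (\<mu> i)"
          unfolding U_def coeff_sum_monom[OF that] .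
        then show ?thesis by (simp add: monom_eq_iff')
      qed
      then have "psize n \<kappa> = psize n \<mu>" unfolding psize_def by (intro sum.cong) auto
      then show False using less by (simp add: AM_sel)
    qed
  qed (simp_all add: AM_sel q_def t_def)
qed

lemma BM_sel:
  "nvars (BM n) = n" "degfac (BM n) = 1" "nrm (BM n) = (\<lambda>x. \<Sum>i = 1..n. x i + inverse (x i))"
  "Lam (BM n) = {f \<in> subalgebra {Xpow i 1 + Xpow i (- 1) |i. i \<in> {1..n}}. is_symmetric n f}"
  "shift (BM n) = (\<lambda>\<kappa> i. to_fract [:0, 1:] * to_fract [:[:[:0, 1:]:]:] ^ \<kappa> i * to_fract [:[:0, 1:]:] ^ (n - i))"
  by (simp_all add: BM_def Let_def)

lemma BM_monom:
  "to_fract [:0, 1:] ^ w * to_fract [:[:[:0, 1:]:]:] ^ m * to_fract [:[:0, 1:]:] ^ v =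
    to_fract (monom (monom (monom (1 :: rat) m) v) w)"
  unfolding to_fract_power[symmetric] to_fract_mult[symmetric] const_poly_power monom_1_power
  by (simp add: smult_monom mult_monom flip: smult_conv_map_poly)

lemma BM_family:
  assumes "n \<ge> 1"
  shows "family (BM n) (\<lambda>i. Xpow i 1 + Xpow i (- 1)) (\<lambda>x. x + inverse x)
    (\<lambda>i m. to_fract [:0, 1:] * to_fract [:[:[:0, 1:]:]:] ^ m * to_fract [:[:0, 1:]:] ^ (n - i)) (- {0})"
proof -
  define q t a :: "rat poly poly poly fract" where "q = to_fract [:[:[:0, 1:]:]:]"
    and "t = to_fract [:[:0, 1:]:]" and "a = to_fract [:0, 1:]"
  have aqt: "a ^ w * q ^ m * t ^ v = to_fract (monom (monom (monom 1 m) v) w)" for w m v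
    unfolding q_def t_def a_def by (rule BM_monom)
  have aqt_eq: "a ^ w * q ^ m * t ^ v = a ^ w' * q ^ m' * t ^ v' \<longleftrightarrow> w = w' \<and> m = m' \<and> v = v'" for w m v w' m' v'
    unfolding aqt to_fract_eq_iff monom_eq_iff' by (auto simp: monom_eq_iff')
  have ne: "q \<noteq> 0" "t \<noteq> 0" "a \<noteq> 0" by (simp_all add: q_def t_def a_def)
  interpret M: macdonald n q t a 1
  proof
    show "q ^ m * t ^ v \<noteq> 1" if "(m, v) \<noteq> (0, 0)" for m v
      using aqt_eq[of 0 m v 0 0 0] that by auto
    show "a\<^sup>2 * q ^ m * t ^ v \<noteq> 1 * q ^ k" for m v k
      using aqt_eq[of 2 m v 0 k 0] by simp
  qed (use ne in auto)
  have pt: "M.pt = (\<lambda>i m. a * q ^ m * t ^ (n - i))" by (simp add: M.pt_def fun_eq_iff)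
  have y: "M.y 0 = (\<lambda>x. x + inverse x)" by (simp add: M.y_def fun_eq_iff divide_inverse)
  show ?thesis
    unfolding q_def[symmetric] t_def[symmetric] a_def[symmetric]
  proof
    show "vanishing (nvars (BM n)) (\<lambda>i m. a * q ^ m * t ^ (n - i)) (\<lambda>x. x + inverse x) d" for d
      using M.vanishing[OF assms, of 0 d] by (simp add: pt y BM_sel)
    show "inj (\<lambda>m. a * q ^ m * t ^ (n - i) + inverse (a * q ^ m * t ^ (n - i)))" for i
      using M.inj_y_pt[of i] unfolding pt y .
    show "\<exists>G. polyfun {1..nvars (BM n)} {..d} G \<and>
        (\<forall>x. (\<forall>i. x i \<in> - {0}) \<longrightarrow> lpoly_eval f x = G (\<lambda>i. x i + inverse (x i)))"
      if "f \<in> subalgebra {Xsym i |i. i \<in> {1..nvars (BM n)}}" "ldegree f \<le> degfac (BM n) * d" for f :: "rat poly poly poly fract laurent" and d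
      using Xsym_polyfun[of f n d] that by (simp add: BM_sel)
    show "lpoly_eval (f * g) x = lpoly_eval f x * lpoly_eval g x" if "\<And>i. x i \<in> - {0}" for f g :: "rat poly poly poly fract laurent" and x
      using that by (intro lpoly_eval_mult_nonzero) simp
    show "ldegree (Xsym i :: rat poly poly poly fract laurent) \<le> degfac (BM n)" for i
      using ldegree_add[of "Xpow i 1 :: rat poly poly poly fract laurent" 1 "Xpow i (- 1)"] ldegree_Xpow[of i 1] ldegree_Xpow[of i "- 1"]
      by (simp add: BM_sel)
    show "a * q ^ m * t ^ (n - i) \<in> - {0}" for i m using ne by simp
    show "snorm (BM n) \<kappa> \<noteq> snorm (BM n) \<mu>" if less: "size_of (BM n) \<mu> < size_of (BM n) \<kappa>" for \<kappa> \<mu>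
    proof
      \<comment> \<open>\<open>K\<close> is large enough for multiplication by a q^K t^n to clear
        the denominators of both norms.\<close>
      define K where "K = psize n \<kappa> + psize n \<mu>"
      define U :: "partition \<Rightarrow> rat poly poly poly" where
        "U = (\<lambda>\<nu>. monom (\<Sum>i = 1..n. monom (monom 1 (K + \<nu> i)) (n + (n - i))) 2
          + monom (\<Sum>i = 1..n. monom (monom 1 (K - \<nu> i)) i) 0)"
      have U: "a * q ^ K * t ^ n * snorm (BM n) \<nu> = to_fract (U \<nu>)" if "\<And>i. i \<in> {1..n} \<Longrightarrow> \<nu> i \<le> K" for \<nu>
      proof -
        have "a * q ^ K * t ^ n * (a * q ^ \<nu> i * t ^ (n - i) + inverse (a * q ^ \<nu> i * t ^ (n - i))) =
            to_fract (monom (monom (monom 1 (K + \<nu> i)) (n + (n - i))) 2) +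
            to_fract (monom (monom (monom 1 (K - \<nu> i)) i) 0)" if i: "i \<in> {1..n}" for i
        proof -
          have "q ^ K = q ^ \<nu> i * q ^ (K - \<nu> i)" "t ^ n = t ^ (n - i) * t ^ i"
            using i \<open>\<And>i. i \<in> {1..n} \<Longrightarrow> \<nu> i \<le> K\<close>[of i] by (simp_all flip: power_add)
          then have "a * q ^ K * t ^ n * inverse (a * q ^ \<nu> i * t ^ (n - i)) = a ^ 0 * q ^ (K - \<nu> i) * t ^ i"
            using ne by (simp add: field_simps)
          moreover have "a * q ^ K * t ^ n * (a * q ^ \<nu> i * t ^ (n - i)) = a ^ 2 * q ^ (K + \<nu> i) * t ^ (n + (n - i))"
            by (simp add: power_add power2_eq_square mult_ac)
          ultimately show ?thesis unfolding aqt[symmetric] by (simp only: distrib_left)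
        qed
        then have "a * q ^ K * t ^ n * snorm (BM n) \<nu> =
            (\<Sum>i = 1..n. to_fract (monom (monom (monom 1 (K + \<nu> i)) (n + (n - i))) 2) +
              to_fract (monom (monom (monom 1 (K - \<nu> i)) i) 0))"
          unfolding BM_sel sum_distrib_left q_def[symmetric] t_def[symmetric] a_def[symmetric]
          by (intro sum.cong refl)
        also have "\<dots> = to_fract (U \<nu>)"
          by (simp add: U_def sum.distrib monom_sum)
        finally show ?thesis .
      qed
      have le: "\<nu> i \<le> psize n \<nu>" if "i \<in> {1..n}" for \<nu> i
        unfolding psize_def using that by (intro member_le_sum) auto
      have "\<And>i. i \<in> {1..n} \<Longrightarrow> \<kappa> i \<le> K" "\<And>i. i \<in> {1..n} \<Longrightarrow> \<mu> i \<le> K"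
        using le[of _ \<kappa>] le[of _ \<mu>] unfolding K_def by (meson trans_le_add1 trans_le_add2)+
      moreover assume "snorm (BM n) \<kappa> = snorm (BM n) \<mu>"
      ultimately have "U \<kappa> = U \<mu>" using U[of \<kappa>] U[of \<mu>] by simp
      \<comment> \<open>The coefficient of a^2 comes from the terms without inverse and is, up to a
        power of \<open>q\<close> and \<open>t\<close>, the norm of the \<open>AM\<close>
        family.\<close>
      then have "coeff (U \<kappa>) 2 = coeff (U \<mu>) 2" by simp
      then have eq: "(\<Sum>i = 1..n. monom (monom (1 :: rat) (K + \<kappa> i)) (n + (n - i))) =
          (\<Sum>i = 1..n. monom (monom 1 (K + \<mu> i)) (n + (n - i)))"
        by (simp add: U_def)
      have "\<kappa> i = \<mu> i" if "i \<in> {1..n}" for i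
      proof -
        have "monom (1 :: rat) (K + \<kappa> i) = monom 1 (K + \<mu> i)"
          using coeff_sum_monom[OF that, of "\<lambda>i. monom (1 :: rat) (K + \<kappa> i)" n]
            coeff_sum_monom[OF that, of "\<lambda>i. monom (1 :: rat) (K + \<mu> i)" n] unfolding eq by simp
        then show ?thesis by (simp add: monom_eq_iff')
      qed
      then have "psize n \<kappa> = psize n \<mu>" unfolding psize_def by (intro sum.cong) auto
      then show False using less by (simp add: BM_sel)
    qed
  qed (simp_all add: BM_sel q_def t_def a_def lpoly_eval_Xsym)
qed

theorem theorem3p5:
  fixes n :: nat
  assumes "n \<ge> 1"
  shows "(\<forall>p\<in>Lam (AJ n).
           (\<forall>c. structure_vanishing (AJ n) c \<and> structure_recursion (AJ n) p c \<longleftrightarrow>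
                 (\<forall>\<kappa>\<in>partitions n. \<forall>\<mu>\<in>partitions n. c \<kappa> \<mu> = structure_coeff (AJ n) p \<kappa> \<mu>))
         \<and> matC (AJ n) p = pmat_inverse (AJ n) (matB (AJ n)) \<odot> matD (AJ n) p \<odot> matB (AJ n)
         \<and> commutator (matZ (AJ n)) (matC (AJ n) p) =
             commutator (matC (AJ n) p) (commutator (matZ (AJ n)) (matA (AJ n)))
         \<and> (\<forall>\<kappa>\<in>partitions n. \<forall>\<mu>\<in>partitions n.
               structure_coeff (AJ n) p \<kappa> \<mu> =
                 (\<Sum>\<zeta> | \<zeta> \<in> partitions n \<and> \<mu> \<le> \<zeta> \<and> \<zeta> \<le> \<kappa>.
                    inv_binom (AJ n) \<kappa> \<zeta> * binom (AJ n) \<zeta> \<mu> * lpoly_eval p (shift (AJ n) \<zeta>))))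
     \<and> (\<forall>p\<in>Lam (BJ n).
           (\<forall>c. structure_vanishing (BJ n) c \<and> structure_recursion (BJ n) p c \<longleftrightarrow>
                 (\<forall>\<kappa>\<in>partitions n. \<forall>\<mu>\<in>partitions n. c \<kappa> \<mu> = structure_coeff (BJ n) p \<kappa> \<mu>))
         \<and> matC (BJ n) p = pmat_inverse (BJ n) (matB (BJ n)) \<odot> matD (BJ n) p \<odot> matB (BJ n)
         \<and> commutator (matZ (BJ n)) (matC (BJ n) p) =
             commutator (matC (BJ n) p) (commutator (matZ (BJ n)) (matA (BJ n)))
         \<and> (\<forall>\<kappa>\<in>partitions n. \<forall>\<mu>\<in>partitions n.
               structure_coeff (BJ n) p \<kappa> \<mu> =
                 (\<Sum>\<zeta> | \<zeta> \<in> partitions n \<and> \<mu> \<le> \<zeta> \<and> \<zeta> \<le> \<kappa>.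
                    inv_binom (BJ n) \<kappa> \<zeta> * binom (BJ n) \<zeta> \<mu> * lpoly_eval p (shift (BJ n) \<zeta>))))
     \<and> (\<forall>p\<in>Lam (AM n).
           (\<forall>c. structure_vanishing (AM n) c \<and> structure_recursion (AM n) p c \<longleftrightarrow>
                 (\<forall>\<kappa>\<in>partitions n. \<forall>\<mu>\<in>partitions n. c \<kappa> \<mu> = structure_coeff (AM n) p \<kappa> \<mu>))
         \<and> matC (AM n) p = pmat_inverse (AM n) (matB (AM n)) \<odot> matD (AM n) p \<odot> matB (AM n)
         \<and> commutator (matZ (AM n)) (matC (AM n) p) =
             commutator (matC (AM n) p) (commutator (matZ (AM n)) (matA (AM n)))
         \<and> (\<forall>\<kappa>\<in>partitions n. \<forall>\<mu>\<in>partitions n.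
               structure_coeff (AM n) p \<kappa> \<mu> =
                 (\<Sum>\<zeta> | \<zeta> \<in> partitions n \<and> \<mu> \<le> \<zeta> \<and> \<zeta> \<le> \<kappa>.
                    inv_binom (AM n) \<kappa> \<zeta> * binom (AM n) \<zeta> \<mu> * lpoly_eval p (shift (AM n) \<zeta>))))
     \<and> (\<forall>p\<in>Lam (BM n).
           (\<forall>c. structure_vanishing (BM n) c \<and> structure_recursion (BM n) p c \<longleftrightarrow>
                 (\<forall>\<kappa>\<in>partitions n. \<forall>\<mu>\<in>partitions n. c \<kappa> \<mu> = structure_coeff (BM n) p \<kappa> \<mu>))
         \<and> matC (BM n) p = pmat_inverse (BM n) (matB (BM n)) \<odot> matD (BM n) p \<odot> matB (BM n)
         \<and> commutator (matZ (BM n)) (matC (BM n) p) =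
             commutator (matC (BM n) p) (commutator (matZ (BM n)) (matA (BM n)))
         \<and> (\<forall>\<kappa>\<in>partitions n. \<forall>\<mu>\<in>partitions n.
               structure_coeff (BM n) p \<kappa> \<mu> =
                 (\<Sum>\<zeta> | \<zeta> \<in> partitions n \<and> \<mu> \<le> \<zeta> \<and> \<zeta> \<le> \<kappa>.
                    inv_binom (BM n) \<kappa> \<zeta> * binom (BM n) \<zeta> \<mu> * lpoly_eval p (shift (BM n) \<zeta>))))"
proof -
  \<comment> \<open>Polymorphic in the base field, since the four families live over different
    fields.\<close>
  have main: "\<forall>p\<in>Lam F.
         (\<forall>c. structure_vanishing F c \<and> structure_recursion F p c \<longleftrightarrow>
               (\<forall>\<kappa>\<in>partitions n. \<forall>\<mu>\<in>partitions n. c \<kappa> \<mu> = structure_coeff F p \<kappa> \<mu>))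
       \<and> matC F p = pmat_inverse F (matB F) \<odot> matD F p \<odot> matB F
       \<and> commutator (matZ F) (matC F p) = commutator (matC F p) (commutator (matZ F) (matA F))
       \<and> (\<forall>\<kappa>\<in>partitions n. \<forall>\<mu>\<in>partitions n.
             structure_coeff F p \<kappa> \<mu> =
               (\<Sum>\<zeta> | \<zeta> \<in> partitions n \<and> \<mu> \<le> \<zeta> \<and> \<zeta> \<le> \<kappa>.
                  inv_binom F \<kappa> \<zeta> * binom F \<zeta> \<mu> * lpoly_eval p (shift F \<zeta>)))"
    if "family F gen y pt good" "nvars F = n" for F :: "'k::field_char_0 interp_family" and gen y pt good
  proof -
    interpret family F gen y pt good by fact
    show ?thesis using main unfolding that(2) by blast
  qed
  show ?thesis
    by (intro conjI main[OF AJ_family[OF assms] AJ_sel(1)] main[OF BJ_family[OF assms] BJ_sel(1)]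
      main[OF AM_family[OF assms] AM_sel(1)] main[OF BM_family[OF assms] BM_sel(1)])
qed

end
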